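(* Let $p(x)$ be a pmf on a finite set $\mathcal X$, let $p(y,z|x)$ and $p(\tilde y,\tilde z|\tilde x)$ be broadcast channels with finite alphabets, and let $R\ge0$. The pair $(p(x),p(y,z|x))$ is in the admissible region of the channel-rate pair $(p(\tilde y,\tilde z|\tilde x),R)$ if there exist finite-valued auxiliary random variables $U,V,W$ and conditional pmfs $p(u,v,w,\tilde x|x)$, $p(y|\tilde y,u,w)$ and $p(z|\tilde z,v,w)$ such that $(X,U,V,W,\tilde X,\tilde Y,\tilde Z,Y,Z)$ distributed according to $$p(x,u,v,w,\tilde x,\tilde y,\tilde z,y,z)=p(x)\,p(u,v,w,\tilde x|x)\,p(\tilde y,\tilde z|\tilde x)\,p(y|\tilde y,u,w)\,p(z|\tilde z,v,w)$$ has the given marginal $p(x,y,z)=p(x)p(y,z|x)$ and satisfies \begin{align*} I(WU;\tilde Y)&>I(UW;X),\\ R+I(WU;\tilde Y)&>I(UW;XYZ),\\ I(WV;\tilde Z)&>I(WV;X),\\ R+I(WV;\tilde Z)&>I(WV;XYZ),\\ I(WU;\tilde Y)+I(WV;\tilde Z)&>I(UW;X)+I(WV;X)+I(U;V|WX),\\ 2R+I(UW;\tilde Y)+I(VW;\tilde Z)&>I(UW;XYZ)+I(VW;XYZ)+I(U;V|WXYZ),\\ \min\{I(W;\tilde Y),I(W;\tilde Z)\}+I(U;\tilde Y|W)+I(V;\tilde Z|W)&>I(W;X)+I(U;X|W)+I(V;X|W)+I(U;V|WX),\\ R+\min\{I(W;\tilde Y),I(W;\tilde Z)\}+I(U;\tilde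 Y|W)+I(V;\tilde Z|W)&>I(W;XYZ)+I(U;XYZ|W)+I(V;XYZ|W)+I(U;V|WXYZ),\\ R+I(W;YZ|X)+I(UW;\tilde Y)+I(VW;\tilde Z)&>I(UW;XYZ)+I(VW;XYZ)+I(U;V|WXYZ). \end{align*}
   Context: All random variables take values in finite sets. Logarithms are base 2. Broadcast channel simulation (average-case): the goal is to simulate memoryless copies of $p(y,z|x)$ using memoryless copies of $p(\tilde y,\tilde z|\tilde x)$. The sender observes $X^n$, i.i.d. with pmf $p(x)$. The sender and the two receivers share a random variable $\omega$, independent of $X^n$ and uniformly distributed on $[1:2^{nR}]=\{1,\dots,2^{nR}\}$ (with $2^{nR}$ understood as an integer, e.g. rounded down). An $(n,R)$ code consists of a stochastic encoder $q^{\mathrm{enc}}(\tilde x^n|x^n,\omega)$ and two stochastic decoders $q^{\mathrm{dec}_1}(y^n|\tilde y^n,\omega)$ and $q^{\mathrm{dec}_2}(z^n|\tilde z^n,\omega)$. It induces the distribution $$q(\tilde x^n,\tilde y^n,\tilde z^n,y^n,z^n|\omega,x^n)=q^{\mathrm{enc}}(\tilde x^n|x^n,\omega)\Big(\prod_{i=1}^n p(\tilde y_i,\tilde z_i|\tilde x_i)\Big)q^{\mathrm{dec}_1}(y^n|\tilde y^n,\omega)\,q^{\mathrm{dec}_2}(z^n|\tilde z^n,\omega).$$ The pair $(p(x),p(y,z|x))$ is in the admissible region of $(p(\tilde y,\tilde z|\tilde x),R)$ if there is a sequence of $(n,R)$ codes whose induced marginals $q(x^n,y^n,z^n)$ satisfy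 $$\lim_{n\to\infty}\Big\|q(x^n,y^n,z^n)-\prod_{i=1}^n p(x_i,y_i,z_i)\Big\|_1=0,$$ where $p(x,y,z)=p(x)p(y,z|x)$ and $\|\cdot\|_1$ is the total variation distance. *)

theory Defs
  imports "HOL-Probability.Probability"
begin

text \<open>A length-\<open>n\<close> sequence is an extensional function on \<open>{..<n}\<close> (positions are numbered from 0).\<close>

definition seqs :: "nat \<Rightarrow> (nat \<Rightarrow> 'a) set" where
  "seqs n = {..<n} \<rightarrow>\<^sub>E UNIV"

definition seq_map :: "nat \<Rightarrow> ('a \<Rightarrow> 'b) \<Rightarrow> (nat \<Rightarrow> 'a) \<Rightarrow> nat \<Rightarrow> 'b" where
  "seq_map n f s = (\<lambda>i\<in>{..<n}. f (s i))"

definition iid_pmf :: "nat \<Rightarrow> 'a pmf \<Rightarrow> (nat \<Rightarrow> 'a) pmf" where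
  "iid_pmf n p = Pi_pmf {..<n} undefined (\<lambda>_. p)"

text \<open>The sequence of output pairs is converted to a pair of output sequences;
  see \<open>pmf_memoryless\<close> below for the resulting product formula.\<close>

definition memoryless :: "nat \<Rightarrow> ('a \<Rightarrow> ('b \<times> 'c) pmf) \<Rightarrow> (nat \<Rightarrow> 'a)
    \<Rightarrow> ((nat \<Rightarrow> 'b) \<times> (nat \<Rightarrow> 'c)) pmf" where
  "memoryless n K a =
     map_pmf (\<lambda>s. (seq_map n fst s, seq_map n snd s)) (Pi_pmf {..<n} undefined (\<lambda>i. K (a i)))"

definition iid_triple :: "nat \<Rightarrow> ('a \<times> 'b \<times> 'c) pmf
    \<Rightarrow> ((nat \<Rightarrow> 'a) \<times> (nat \<Rightarrow> 'b) \<times> (nat \<Rightarrow> 'c)) pmf" where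
  "iid_triple n p =
     map_pmf (\<lambda>s. (seq_map n fst s, seq_map n (fst \<circ> snd) s, seq_map n (snd \<circ> snd) s))
       (iid_pmf n p)"

text \<open>Total variation distance, normalised by one half.\<close>

definition tv_dist :: "'a pmf \<Rightarrow> 'a pmf \<Rightarrow> real" where
  "tv_dist p q = (\<Sum>\<^sub>\<infinity>a. \<bar>pmf p a - pmf q a\<bar>) / 2"


definition source_target :: "'x pmf \<Rightarrow> ('x \<Rightarrow> ('y \<times> 'z) pmf) \<Rightarrow> ('x \<times> 'y \<times> 'z) pmf" where
  "source_target p T = do {
     x \<leftarrow> p;
     (y, z) \<leftarrow> T x;
     return_pmf (x, y, z) }"

definition messages :: "nat \<Rightarrow> real \<Rightarrow> nat set" where
  "messages n R = {1..nat \<lfloor>2 powr (real n * R)\<rfloor>}"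

type_synonym ('a, 'b) seq_kernel = "(nat \<Rightarrow> 'a) \<Rightarrow> nat \<Rightarrow> (nat \<Rightarrow> 'b) pmf"

definition is_seq_kernel :: "nat \<Rightarrow> real \<Rightarrow> ('a, 'b) seq_kernel \<Rightarrow> bool" where
  "is_seq_kernel n R k \<longleftrightarrow> (\<forall>a\<in>seqs n. \<forall>\<omega>\<in>messages n R. set_pmf (k a \<omega>) \<subseteq> seqs n)"

definition is_code :: "nat \<Rightarrow> real \<Rightarrow> ('x, 'xt) seq_kernel \<Rightarrow> ('yt, 'y) seq_kernel
    \<Rightarrow> ('zt, 'z) seq_kernel \<Rightarrow> bool" where
  "is_code n R enc dec1 dec2 \<longleftrightarrow>
     is_seq_kernel n R enc \<and> is_seq_kernel n R dec1 \<and> is_seq_kernel n R dec2"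

definition induced :: "nat \<Rightarrow> ('xt \<Rightarrow> ('yt \<times> 'zt) pmf) \<Rightarrow> ('x, 'xt) seq_kernel
    \<Rightarrow> ('yt, 'y) seq_kernel \<Rightarrow> ('zt, 'z) seq_kernel \<Rightarrow> nat \<Rightarrow> (nat \<Rightarrow> 'x)
    \<Rightarrow> ((nat \<Rightarrow> 'xt) \<times> (nat \<Rightarrow> 'yt) \<times> (nat \<Rightarrow> 'zt) \<times> (nat \<Rightarrow> 'y) \<times> (nat \<Rightarrow> 'z)) pmf" where
  "induced n K enc dec1 dec2 \<omega> x = do {
     xt \<leftarrow> enc x \<omega>;
     (yt, zt) \<leftarrow> memoryless n K xt;
     y \<leftarrow> dec1 yt \<omega>;
     z \<leftarrow> dec2 zt \<omega>;
     return_pmf (xt, yt, zt, y, z) }"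

definition induced_marginal :: "nat \<Rightarrow> real \<Rightarrow> 'x pmf \<Rightarrow> ('xt \<Rightarrow> ('yt \<times> 'zt) pmf)
    \<Rightarrow> ('x, 'xt) seq_kernel \<Rightarrow> ('yt, 'y) seq_kernel \<Rightarrow> ('zt, 'z) seq_kernel
    \<Rightarrow> ((nat \<Rightarrow> 'x) \<times> (nat \<Rightarrow> 'y) \<times> (nat \<Rightarrow> 'z)) pmf" where
  "induced_marginal n R p K enc dec1 dec2 = do {
     x \<leftarrow> iid_pmf n p;
     \<omega> \<leftarrow> pmf_of_set (messages n R);
     (xt, yt, zt, y, z) \<leftarrow> induced n K enc dec1 dec2 \<omega> x;
     return_pmf (x, y, z) }"

definition in_admissible_region :: "'x pmf \<Rightarrow> ('x \<Rightarrow> ('y \<times> 'z) pmf)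
    \<Rightarrow> ('xt \<Rightarrow> ('yt \<times> 'zt) pmf) \<Rightarrow> real \<Rightarrow> bool" where
  "in_admissible_region p T K R \<longleftrightarrow>
     (\<exists>(enc :: nat \<Rightarrow> ('x, 'xt) seq_kernel) (dec1 :: nat \<Rightarrow> ('yt, 'y) seq_kernel)
        (dec2 :: nat \<Rightarrow> ('zt, 'z) seq_kernel).
        (\<forall>n. is_code n R (enc n) (dec1 n) (dec2 n)) \<and>
        (\<lambda>n. tv_dist (induced_marginal n R p K (enc n) (dec1 n) (dec2 n))
                (iid_triple n (source_target p T))) \<longlonglongrightarrow> 0)"


definition auxiliary_joint :: "'x pmf \<Rightarrow> ('x \<Rightarrow> ('u \<times> 'v \<times> 'w \<times> 'xt) pmf)
    \<Rightarrow> ('xt \<Rightarrow> ('yt \<times> 'zt) pmf) \<Rightarrow> ('yt \<Rightarrow> 'u \<Rightarrow> 'w \<Rightarrow> 'y pmf) \<Rightarrow> ('zt \<Rightarrow> 'v \<Rightarrow> 'w \<Rightarrow> 'z pmf)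
    \<Rightarrow> ('x \<times> 'u \<times> 'v \<times> 'w \<times> 'xt \<times> 'yt \<times> 'zt \<times> 'y \<times> 'z) pmf" where
  "auxiliary_joint p A K D1 D2 = do {
     x \<leftarrow> p;
     (u, v, w, xt) \<leftarrow> A x;
     (yt, zt) \<leftarrow> K xt;
     y \<leftarrow> D1 yt u w;
     z \<leftarrow> D2 zt v w;
     return_pmf (x, u, v, w, xt, yt, zt, y, z) }"

text \<open>Base-2 information measures of random variables on the probability space \<open>S\<close>. These are
  the library's abbreviations \<open>mutual_information_Pow\<close> and \<open>conditional_mutual_information_Pow\<close>
  of the locale \<open>information_space\<close>, taken at \<open>measure_pmf S\<close>.\<close>

definition mutual_info :: "'s pmf \<Rightarrow> ('s \<Rightarrow> 'a) \<Rightarrow> ('s \<Rightarrow> 'b) \<Rightarrow> real"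
    (\<open>\<I>\<^bsub>_\<^esub>'(_ ; _')\<close>) where
  "\<I>\<^bsub>S\<^esub>(A ; B) = prob_space.mutual_information (measure_pmf S) 2
     (count_space (range A)) (count_space (range B)) A B"

definition cond_mutual_info :: "'s pmf \<Rightarrow> ('s \<Rightarrow> 'a) \<Rightarrow> ('s \<Rightarrow> 'b) \<Rightarrow> ('s \<Rightarrow> 'c) \<Rightarrow> real"
    (\<open>\<I>\<^bsub>_\<^esub>'(_ ; _ \<bar> _')\<close>) where
  "\<I>\<^bsub>S\<^esub>(A ; B \<bar> C) = prob_space.conditional_mutual_information (measure_pmf S) 2
     (count_space (range A)) (count_space (range B)) (count_space (range C)) A B C"

abbreviation (input) joint_rv :: "('s \<Rightarrow> 'a) \<Rightarrow> ('s \<Rightarrow> 'b) \<Rightarrow> 's \<Rightarrow> 'a \<times> 'b" (infixr \<open>\<bowtie>\<close> 90) where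
  "A \<bowtie> B \<equiv> \<lambda>s. (A s, B s)"


lemma seq_map_in_seqs [simp]: "seq_map n f s \<in> seqs n"
  by (simp add: seq_map_def seqs_def)

lemma seq_map_eq_iff: "seq_map n f s = seq_map n g t \<longleftrightarrow> (\<forall>i<n. f (s i) = g (t i))"
  by (auto simp: seq_map_def fun_eq_iff restrict_def split: if_splits)

lemma pmf_iid_pmf: "x \<in> seqs n \<Longrightarrow> pmf (iid_pmf n p) x = (\<Prod>i<n. pmf p (x i))"
  unfolding iid_pmf_def seqs_def by (subst pmf_Pi') (auto simp: PiE_def extensional_def)

lemma pmf_map_Pi_pmf:
  fixes n :: nat
  assumes "inj_on g (PiE_dflt {..<n} undefined (\<lambda>_. UNIV))"
    and "\<And>i. i \<ge> n \<Longrightarrow> s i = undefined" and "g s = b"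
  shows "pmf (map_pmf g (Pi_pmf {..<n} undefined q)) b = (\<Prod>i<n. pmf (q i) (s i))"
proof -
  let ?P = "Pi_pmf {..<n} undefined q" and ?D = "PiE_dflt {..<n} undefined (\<lambda>_. UNIV)"
  have s: "s \<in> ?D" using assms(2)[OF leI] by (auto simp: PiE_dflt_def)
  have sub: "set_pmf ?P \<subseteq> ?D" by (auto simp: set_Pi_pmf PiE_dflt_def)
  have "pmf (map_pmf g ?P) b = measure_pmf.prob ?P (g -` {b})"
    by (simp add: pmf_map)
  also have "\<dots> = measure_pmf.prob ?P {s}"
  proof (rule measure_pmf.finite_measure_eq_AE)
    show "AE x in ?P. (x \<in> g -` {b}) = (x \<in> {s})"
      using sub s assms(1,3) by (auto simp: AE_measure_pmf_iff dest: inj_onD)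
  qed auto
  also have "\<dots> = (\<Prod>i<n. pmf (q i) (s i))"
    using assms(2) by (subst measure_pmf_single, subst pmf_Pi') auto
  finally show ?thesis .
qed

lemma pmf_memoryless:
  fixes y :: "nat \<Rightarrow> 'b" and z :: "nat \<Rightarrow> 'c"
  assumes "y \<in> seqs n" "z \<in> seqs n"
  shows "pmf (memoryless n K x) (y, z) = (\<Prod>i<n. pmf (K (x i)) (y i, z i))"
proof -
  have inj: "inj_on (\<lambda>s :: nat \<Rightarrow> 'b \<times> 'c. (seq_map n fst s, seq_map n snd s))
      (PiE_dflt {..<n} undefined (\<lambda>_. UNIV))"
  proof (rule inj_onI, rule ext)
    fix s t :: "nat \<Rightarrow> 'b \<times> 'c" and i
    assume "s \<in> PiE_dflt {..<n} undefined (\<lambda>_. UNIV)" "t \<in> PiE_dflt {..<n} undefined (\<lambda>_. UNIV)"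
      and "(seq_map n fst s, seq_map n snd s)
        = (seq_map n fst t, seq_map n snd t)"
    then show "s i = t i"
      by (cases "i < n") (auto simp: PiE_dflt_def seq_map_eq_iff prod_eq_iff)
  qed
  have "pmf (memoryless n K x) (y, z)
      = (\<Prod>i<n. pmf (K (x i)) ((\<lambda>i. if i < n then (y i, z i) else undefined) i))"
    unfolding memoryless_def
    by (rule pmf_map_Pi_pmf[OF inj])
      (use assms in \<open>auto simp: fun_eq_iff seq_map_def seqs_def PiE_def extensional_def restrict_def\<close>)
  then show ?thesis by simp
qed

lemma pmf_iid_triple:
  fixes x :: "nat \<Rightarrow> 'a" and y :: "nat \<Rightarrow> 'b" and z :: "nat \<Rightarrow> 'c"
  assumes "x \<in> seqs n" "y \<in> seqs n" "z \<in> seqs n"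
  shows "pmf (iid_triple n p) (x, y, z) = (\<Prod>i<n. pmf p (x i, y i, z i))"
proof -
  have inj: "inj_on (\<lambda>s :: nat \<Rightarrow> 'a \<times> 'b \<times> 'c.
        (seq_map n fst s, seq_map n (fst \<circ> snd) s, seq_map n (snd \<circ> snd) s))
      (PiE_dflt {..<n} undefined (\<lambda>_. UNIV))"
  proof (rule inj_onI, rule ext)
    fix s t :: "nat \<Rightarrow> 'a \<times> 'b \<times> 'c" and i
    assume "s \<in> PiE_dflt {..<n} undefined (\<lambda>_. UNIV)" "t \<in> PiE_dflt {..<n} undefined (\<lambda>_. UNIV)"
      and "(seq_map n fst s, seq_map n (fst \<circ> snd) s, seq_map n (snd \<circ> snd) s)
        = (seq_map n fst t, seq_map n (fst \<circ> snd) t, seq_map n (snd \<circ> snd) t)"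
    then show "s i = t i"
      by (cases "i < n") (auto simp: PiE_dflt_def seq_map_eq_iff prod_eq_iff)
  qed
  have "pmf (iid_triple n p) (x, y, z)
      = (\<Prod>i<n. pmf p ((\<lambda>i. if i < n then (x i, y i, z i) else undefined) i))"
    unfolding iid_triple_def iid_pmf_def
    by (rule pmf_map_Pi_pmf[OF inj])
      (use assms in \<open>auto simp: fun_eq_iff seq_map_def seqs_def PiE_def extensional_def restrict_def\<close>)
  then show ?thesis by simp
qed

lemma pmf_bind_tagged:
  assumes "\<And>a c. c \<in> set_pmf (f a) \<Longrightarrow> h c = a"
  shows "pmf (bind_pmf p f) c = pmf p (h c) * pmf (f (h c)) c"
proof -
  have "pmf (bind_pmf p f) c = measure_pmf.expectation p (\<lambda>a. pmf (f a) c)"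
    by (rule pmf_bind)
  also have "\<dots> = measure_pmf.expectation p (\<lambda>a. indicator {h c} a * pmf (f (h c)) c)"
    using assms by (intro Bochner_Integration.integral_cong)
      (auto simp: indicator_def pmf_eq_0_set_pmf)
  finally show ?thesis by (simp add: measure_pmf_single)
qed

lemma pmf_induced:
  assumes "yt \<in> seqs n" "zt \<in> seqs n"
  shows "pmf (induced n K enc dec1 dec2 \<omega> x) (xt, yt, zt, y, z) =
    pmf (enc x \<omega>) xt * (\<Prod>i<n. pmf (K (xt i)) (yt i, zt i)) * pmf (dec1 yt \<omega>) y * pmf (dec2 zt \<omega>) z"
  unfolding induced_def
  apply (subst pmf_bind_tagged[where h = "\<lambda>(xt, yt, zt, y, z). xt"], force)
  apply (simp add: case_prod_beta)
  apply (subst pmf_bind_tagged[where h = "\<lambda>(xt, yt, zt, y, z). (yt, zt)"], force)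
  apply simp
  apply (subst pmf_bind_tagged[where h = "\<lambda>(xt, yt, zt, y, z). y"], force)
  apply simp
  apply (subst pmf_bind_tagged[where h = "\<lambda>(xt, yt, zt, y, z). z"], force)
  apply (simp add: pmf_memoryless assms)
  done

lemma pmf_source_target: "pmf (source_target p T) (x, y, z) = pmf p x * pmf (T x) (y, z)"
  unfolding source_target_def
  apply (subst pmf_bind_tagged[where h = "\<lambda>(x, y, z). x"], force)
  apply (simp add: case_prod_beta)
  apply (subst pmf_bind_tagged[where h = "\<lambda>(x, y, z). (y, z)"], force)
  apply simp
  done

lemma pmf_auxiliary_joint:
  "pmf (auxiliary_joint p A K D1 D2) (x, u, v, w, xt, yt, zt, y, z) =
    pmf p x * pmf (A x) (u, v, w, xt) * pmf (K xt) (yt, zt) * pmf (D1 yt u w) y * pmf (D2 zt v w) z"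
  unfolding auxiliary_joint_def
  apply (subst pmf_bind_tagged[where h = "\<lambda>(x, u, v, w, xt, yt, zt, y, z). x"], force)
  apply (simp add: case_prod_beta)
  apply (subst pmf_bind_tagged[where h = "\<lambda>(x, u, v, w, xt, yt, zt, y, z). (u, v, w, xt)"], force)
  apply simp
  apply (subst pmf_bind_tagged[where h = "\<lambda>(x, u, v, w, xt, yt, zt, y, z). (yt, zt)"], force)
  apply simp
  apply (subst pmf_bind_tagged[where h = "\<lambda>(x, u, v, w, xt, yt, zt, y, z). y"], force)
  apply simp
  apply (subst pmf_bind_tagged[where h = "\<lambda>(x, u, v, w, xt, yt, zt, y, z). z"], force)
  apply simp
  done

lemma tv_dist_finite:
  assumes "finite F" "set_pmf p \<subseteq> F" "set_pmf q \<subseteq> F"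
  shows "tv_dist p q = (\<Sum>a\<in>F. \<bar>pmf p a - pmf q a\<bar>) / 2"
proof -
  have "(\<Sum>\<^sub>\<infinity>a. \<bar>pmf p a - pmf q a\<bar>) = (\<Sum>\<^sub>\<infinity>a\<in>F. \<bar>pmf p a - pmf q a\<bar>)"
  proof (rule infsum_cong_neutral)
    fix a assume "a \<in> UNIV - F"
    then have "a \<notin> set_pmf p" "a \<notin> set_pmf q" using assms(2,3) by auto
    then show "\<bar>pmf p a - pmf q a\<bar> = 0" by (simp add: set_pmf_iff)
  qed auto
  then show ?thesis using assms(1) by (simp add: tv_dist_def)
qed

lemma information_space_pmf: "information_space (measure_pmf S) 2"
  by unfold_locales simp

lemma simple_distributed_rv:
  fixes A :: "'s \<Rightarrow> 'a::finite"
  shows "simple_distributed (measure_pmf S) A (pmf (map_pmf A S))"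
  by (rule prob_space.simple_distributedI)
    (auto simp: measure_pmf.prob_space_axioms simple_function_def pmf_map vimage_def)

lemma mutual_info_eq:
  fixes A :: "'s \<Rightarrow> 'a::finite" and B :: "'s \<Rightarrow> 'b::finite"
  shows "\<I>\<^bsub>S\<^esub>(A ; B) = (\<Sum>(a, b)\<in>UNIV. pmf (map_pmf (A \<bowtie> B) S) (a, b) *
    log 2 (pmf (map_pmf (A \<bowtie> B) S) (a, b) / (pmf (map_pmf A S) a * pmf (map_pmf B S) b)))"
proof -
  interpret information_space "measure_pmf S" 2 by (rule information_space_pmf)
  have 0: "pmf (map_pmf (A \<bowtie> B) S) c = 0" if "c \<notin> range (A \<bowtie> B)" for c
    using that by (auto simp: pmf_eq_0_set_pmf)
  show ?thesis
    unfolding mutual_info_def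
    using mutual_information_simple_distributed[OF simple_distributed_rv simple_distributed_rv
        simple_distributed_rv, where X = A and Y = B]
    by (simp, intro sum.mono_neutral_left) (simp, simp, use 0 in force)
qed

lemma cond_mutual_info_eq:
  fixes A :: "'s \<Rightarrow> 'a::finite" and B :: "'s \<Rightarrow> 'b::finite" and C :: "'s \<Rightarrow> 'c::finite"
  shows "\<I>\<^bsub>S\<^esub>(A ; B \<bar> C) = (\<Sum>(a, b, c)\<in>UNIV. pmf (map_pmf (A \<bowtie> B \<bowtie> C) S) (a, b, c) *
    log 2 (pmf (map_pmf (A \<bowtie> B \<bowtie> C) S) (a, b, c) /
      (pmf (map_pmf (A \<bowtie> C) S) (a, c) * (pmf (map_pmf (B \<bowtie> C) S) (b, c) / pmf (map_pmf C S) c))))"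
proof -
  interpret information_space "measure_pmf S" 2 by (rule information_space_pmf)
  have 0: "pmf (map_pmf (A \<bowtie> B \<bowtie> C) S) c = 0" if "c \<notin> range (A \<bowtie> B \<bowtie> C)" for c
    using that by (auto simp: pmf_eq_0_set_pmf)
  show ?thesis
    unfolding cond_mutual_info_def
    using conditional_mutual_information_eq[OF simple_distributed_rv simple_distributed_rv
        simple_distributed_rv simple_distributed_rv, where X = A and Y = B and Z = C]
    by (simp, intro sum.mono_neutral_left) (simp, simp, use 0 in force)
qed

end

theory Submission
  imports Defs "HOL-Real_Asymp.Real_Asymp"
begin

text \<open>Random coding. For every value \<open>\<omega>\<close> of the shared randomness draw a superposition codebook:
  cloud centres \<open>w(\<omega>, m\<^sub>0)\<close> from \<open>p(w)\<close> and, around each of them, independent satellites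
  \<open>u(\<omega>, m\<^sub>0, m\<^sub>1)\<close> from \<open>p(u|w)\<close> and \<open>v(\<omega>, m\<^sub>0, m\<^sub>2)\<close> from \<open>p(v|w)\<close>. Give a codeword
  together with an output \<open>t\<close> the weight \<open>\<phi> = p(w, u, v, t) / (p(w) p(u|w) p(v|w))\<close>; the quotient
  accounts for the dependence of \<open>U\<close> and \<open>V\<close> given \<open>W\<close>. A second moment computation with
  truncation to typical words (soft covering) shows that the average of \<open>\<phi>\<close> over the codewords
  belonging to one \<open>\<omega>\<close> approximates \<open>p(x)\<close>, and that the average over all codewords approximates
  \<open>p(x, y, z)\<close>, as soon as the rates of \<open>m\<^sub>0, m\<^sub>1, m\<^sub>2\<close> (increased by \<open>R\<close> in the second case)
  exceed certain informations. So the encoder may sample \<open>(m, xt)\<close> from \<open>\<phi>\<close> normalised by its sum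
  over the codebook of \<open>\<omega>\<close>, and each receiver, after decoding \<open>(m\<^sub>0, m\<^sub>1)\<close> or \<open>(m\<^sub>0, m\<^sub>2)\<close>, applies
  its channel \<open>p(y|yt, u, w)\<close> or \<open>p(z|zt, v, w)\<close>. Decoding succeeds if the rates stay below the
  informations \<open>I(U; Yt|W)\<close>, \<open>I(U W; Yt)\<close> and \<open>I(V; Zt|W)\<close>, \<open>I(V W; Zt)\<close>. Eliminating the three
  rates gives exactly the nine hypotheses; one further inequality produced by the elimination is
  implied by \<open>I(U V; Y Z|W X) \<ge> 0\<close>.\<close>

section \<open>Expectations under finitely supported laws\<close>

text \<open>Uniformly chosen codewords follow p(w) p(u|w) p(v|w), under which U and V are
  conditionally independent; \<phi> is the density of the true law with respect to it, so no jointly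
  typical pair of satellites has to be searched for. For fixed (w, u, v) the weight is linear in the
  law of t, hence the channel and the output maps turn the weight for (x, xt) into the weight for
  (x, y, z) exactly. The weights belonging to one \<omega> need not average to p(x); normalising
  them costs precisely this deviation. That is why covering is required twice: for each \<omega>
  with output x, and over all \<omega> together with output (x, y, z). Decoding errors are weighed
  with the same \<phi>, so a change of measure reduces them to the true law. All losses add up to
  one random number per codebook that is bounded in expectation, so a single codebook serves all
  purposes. The argument is carried out for one use of finitely supported laws; the block length
  enters by taking sequences as letters.\<close>

abbreviation expect :: "'a pmf \<Rightarrow> ('a \<Rightarrow> real) \<Rightarrow> real" where
  "expect p \<equiv> measure_pmf.expectation p"

lemma expect_bind:
  assumes "finite (set_pmf p)" "\<And>a. a \<in> set_pmf p \<Longrightarrow> finite (set_pmf (f a))"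
  shows "expect (bind_pmf p f) h = expect p (\<lambda>a. expect (f a) h)"
proof -
  have "expect (bind_pmf p f) h = (\<Sum>a\<in>set_pmf p. pmf p a *\<^sub>R expect (f a) h)"
    by (rule pmf_expectation_bind) (use assms in auto)
  also have "\<dots> = expect p (\<lambda>a. expect (f a) h)"
    by (rule integral_measure_pmf[symmetric]) (use assms in auto)
  finally show ?thesis .
qed

lemma expect_mono:
  assumes "finite (set_pmf p)" "\<And>a. a \<in> set_pmf p \<Longrightarrow> f a \<le> g a"
  shows "expect p f \<le> expect p g"
  by (intro integral_mono_AE integrable_measure_pmf_finite assms(1))
     (auto simp: AE_measure_pmf_iff assms(2))

lemma expect_cong:
  assumes "\<And>a. a \<in> set_pmf p \<Longrightarrow> f a = g a"
  shows "expect p f = expect p g"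
  by (intro integral_cong_AE) (auto simp: AE_measure_pmf_iff assms)

lemma expect_nonneg: "(\<And>a. f a \<ge> 0) \<Longrightarrow> expect p f \<ge> 0"
  by (rule Bochner_Integration.integral_nonneg) auto

lemma expect_add:
  "finite (set_pmf p) \<Longrightarrow> expect p (\<lambda>a. f a + g a) = expect p f + expect p g"
  by (intro Bochner_Integration.integral_add integrable_measure_pmf_finite)

lemma expect_sum:
  "finite (set_pmf p) \<Longrightarrow> expect p (\<lambda>a. \<Sum>i\<in>I. f i a) = (\<Sum>i\<in>I. expect p (f i))"
  by (intro Bochner_Integration.integral_sum integrable_measure_pmf_finite)

lemma expect_abs_le_sqrt:
  assumes "finite (set_pmf p)"
  shows "expect p (\<lambda>a. \<bar>f a\<bar>) \<le> sqrt (expect p (\<lambda>a. (f a)\<^sup>2))"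
proof -
  have "measure_pmf.variance p (\<lambda>a. \<bar>f a\<bar>) =
      expect p (\<lambda>a. \<bar>f a\<bar>\<^sup>2) - (expect p (\<lambda>a. \<bar>f a\<bar>))\<^sup>2"
    by (intro measure_pmf.variance_eq integrable_measure_pmf_finite assms)
  moreover have "measure_pmf.variance p (\<lambda>a. \<bar>f a\<bar>) \<ge> 0"
    by (rule measure_pmf.variance_positive)
  ultimately have "(expect p (\<lambda>a. \<bar>f a\<bar>))\<^sup>2 \<le> expect p (\<lambda>a. (f a)\<^sup>2)"
    by simp
  then show ?thesis by (rule real_le_rsqrt)
qed

lemma expect_exists_le:
  assumes "finite (set_pmf p)"
  shows "\<exists>a\<in>set_pmf p. f a \<le> expect p f"
proof (rule ccontr)
  assume "\<not> ?thesis"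
  then have *: "expect p f < f a" if "a \<in> set_pmf p" for a using that by force
  have "(\<Sum>a\<in>set_pmf p. pmf p a * expect p f) < (\<Sum>a\<in>set_pmf p. pmf p a * f a)"
    using assms * by (intro sum_strict_mono) (auto simp: set_pmf_not_empty pmf_positive)
  also have "(\<Sum>a\<in>set_pmf p. pmf p a * f a) = expect p f"
    by (subst integral_measure_pmf[OF assms]) auto
  also have "(\<Sum>a\<in>set_pmf p. pmf p a * expect p f) = expect p f"
    using assms by (simp add: sum_distrib_right[symmetric] sum_pmf_eq_1)
  finally show False by simp
qed

lemma sum_pmf_le_pmf_map:
  assumes "finite F" "inj_on k F" "\<And>b. b \<in> F \<Longrightarrow> f (k b) = a"
  shows "(\<Sum>b\<in>F. pmf p (k b)) \<le> pmf (map_pmf f p) a"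
proof -
  have "(\<Sum>b\<in>F. pmf p (k b)) = measure p (k ` F)"
    using assms by (simp add: measure_measure_pmf_finite sum.reindex)
  also have "\<dots> \<le> measure p (f -` {a})"
    using assms by (intro measure_pmf.finite_measure_mono) auto
  finally show ?thesis by (simp add: pmf_map)
qed

lemma expect_swap:
  assumes "finite (set_pmf p)" "finite (set_pmf q)"
  shows "expect p (\<lambda>a. expect q (\<lambda>b. f a b)) = expect q (\<lambda>b. expect p (\<lambda>a. f a b))"
proof -
  have "expect p (\<lambda>a. expect q (\<lambda>b. f a b)) = (\<Sum>a\<in>set_pmf p. \<Sum>b\<in>set_pmf q. pmf p a * (pmf q b * f a b))"
    by (simp add: integral_measure_pmf[OF assms(1)] integral_measure_pmf[OF assms(2)] sum_distrib_left)
  also have "\<dots> = expect q (\<lambda>b. expect p (\<lambda>a. f a b))"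
    by (subst sum.swap)
       (simp add: integral_measure_pmf[OF assms(1)] integral_measure_pmf[OF assms(2)] sum_distrib_left mult_ac)
  finally show ?thesis .
qed

text \<open>The joint law of two entries of an i.i.d. family, with \<open>e\<close> telling whether
  the two indices coincide. Keeping both cases in one formula lets the second moment of a cluster be
  expanded before its index patterns are separated.\<close>

definition pair_law :: "bool \<Rightarrow> 'a pmf \<Rightarrow> ('a \<times> 'a) pmf" where
  "pair_law e p = (if e then map_pmf (\<lambda>x. (x, x)) p else pair_pmf p p)"

lemma Pi_pmf_pair:
  assumes "finite A" "i \<in> A" "j \<in> A"
  shows "map_pmf (\<lambda>f. (f i, f j)) (Pi_pmf A d (\<lambda>_. p)) = pair_law (i = j) p"
proof (cases "i = j")
  case True
  have "map_pmf (\<lambda>f. (f i, f i)) (Pi_pmf A d (\<lambda>_. p))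
      = map_pmf (\<lambda>x. (x, x)) (map_pmf (\<lambda>f. f i) (Pi_pmf A d (\<lambda>_. p)))"
    by (simp add: map_pmf_comp)
  then show ?thesis using True assms by (simp add: Pi_pmf_component pair_law_def)
next
  case False
  define B where "B = A - {i}"
  have B: "A = insert i B" "finite B" "i \<notin> B" "j \<in> B" using assms False by (auto simp: B_def)
  have "map_pmf (\<lambda>f. (f i, f j)) (Pi_pmf A d (\<lambda>_. p))
     = map_pmf (\<lambda>(a, b). (id a, b j)) (pair_pmf p (Pi_pmf B d (\<lambda>_. p)))"
    using B False by (auto simp: Pi_pmf_insert map_pmf_comp case_prod_beta intro!: map_pmf_cong)
  also have "\<dots> = pair_pmf p p"
    unfolding map_pair using B by (simp add: Pi_pmf_component)
  finally show ?thesis using False by (simp add: pair_law_def)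
qed

lemma expect_Pi_pmf_pair:
  assumes "finite A" "i \<in> A" "j \<in> A"
  shows "expect (Pi_pmf A d (\<lambda>_. p)) (\<lambda>f. F (f i) (f j)) = expect (pair_law (i = j) p) (\<lambda>(x, y). F x y)"
  unfolding Pi_pmf_pair[OF assms, where d = d, symmetric] by (simp)

lemma expect_pair_law_True: "expect (pair_law True p) (\<lambda>(x, y). F x y) = expect p (\<lambda>x. F x x)"
  by (simp add: pair_law_def)

lemma expect_pair_law_False:
  "finite (set_pmf p) \<Longrightarrow> expect (pair_law False p) (\<lambda>(x, y). F x y) = expect p (\<lambda>x. expect p (F x))"
  by (simp add: pair_law_def pair_pmf_def expect_bind)

lemma finite_set_Pi_pmf:
  assumes "finite A" "\<And>i. finite (set_pmf (q i))"
  shows "finite (set_pmf (Pi_pmf A d q))"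
  using assms by (subst set_Pi_pmf) auto

section \<open>Superposition codebooks\<close>

abbreviation "marg_w \<equiv> map_pmf (\<lambda>(w, u, v, t). w)"
abbreviation "marg_t \<equiv> map_pmf (\<lambda>(w, u, v, t). t)"
abbreviation "marg_wt \<equiv> map_pmf (\<lambda>(w, u, v, t). (w, t))"
abbreviation "marg_wu \<equiv> map_pmf (\<lambda>(w, u, v, t). (w, u))"
abbreviation "marg_wv \<equiv> map_pmf (\<lambda>(w, u, v, t). (w, v))"
abbreviation "marg_wut \<equiv> map_pmf (\<lambda>(w, u, v, t). (w, u, t))"
abbreviation "marg_wvt \<equiv> map_pmf (\<lambda>(w, u, v, t). (w, v, t))"

locale superposition =
  fixes pw :: "'w pmf" and pu :: "'w \<Rightarrow> 'u pmf" and pv :: "'w \<Rightarrow> 'v pmf" and M1 M2 :: nat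
  assumes finite_pw: "finite (set_pmf pw)" and finite_pu: "finite (set_pmf (pu w))"
    and finite_pv: "finite (set_pmf (pv w))" and M1_pos: "M1 > 0" and M2_pos: "M2 > 0"
begin

section \<open>One cloud with its satellites, and the first two moments of its average
  weight\<close>

definition cluster :: "('w \<times> (nat \<Rightarrow> 'u) \<times> (nat \<Rightarrow> 'v)) pmf" where
  "cluster = do {
     w \<leftarrow> pw;
     us \<leftarrow> Pi_pmf {..<M1} undefined (\<lambda>_. pu w);
     vs \<leftarrow> Pi_pmf {..<M2} undefined (\<lambda>_. pv w);
     return_pmf (w, us, vs) }"

definition codebook :: "'i set \<Rightarrow> ('i \<Rightarrow> 'w \<times> (nat \<Rightarrow> 'u) \<times> (nat \<Rightarrow> 'v)) pmf" where
  "codebook I = Pi_pmf I undefined (\<lambda>_. cluster)"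

definition expect3 :: "('w \<Rightarrow> 'u \<Rightarrow> 'v \<Rightarrow> real) \<Rightarrow> real" where
  "expect3 h = expect pw (\<lambda>w. expect (pu w) (\<lambda>u. expect (pv w) (\<lambda>v. h w u v)))"

text \<open>The \<open>M1 * M2\<close> codewords of a cluster reuse its \<open>M1 + M2\<close>
  satellites, so they are not independent. The result type is arbitrary because \<open>h\<close>
  stands for weights and for predicates alike.\<close>

definition word :: "'w \<times> (nat \<Rightarrow> 'u) \<times> (nat \<Rightarrow> 'v) \<Rightarrow> nat \<Rightarrow> nat \<Rightarrow> ('w \<Rightarrow> 'u \<Rightarrow> 'v \<Rightarrow> 'r) \<Rightarrow> 'r" where
  "word C a b h = h (fst C) (fst (snd C) a) (snd (snd C) b)"

lemmas finite_Pi = finite_set_Pi_pmf[OF finite_lessThan finite_pu] finite_set_Pi_pmf[OF finite_lessThan finite_pv]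

lemma finite_cluster: "finite (set_pmf cluster)"
  by (auto simp: cluster_def finite_pw intro!: finite_Pi)

lemma finite_codebook: "finite I \<Longrightarrow> finite (set_pmf (codebook I))"
  unfolding codebook_def by (intro finite_set_Pi_pmf finite_cluster)

lemma expect_cluster_pair:
  assumes "a < M1" "a' < M1" "b < M2" "b' < M2"
  shows "expect cluster (\<lambda>C. F (fst C) (fst (snd C) a) (fst (snd C) a') (snd (snd C) b) (snd (snd C) b'))
    = expect pw (\<lambda>w. expect (pair_law (a = a') (pu w)) (\<lambda>(u, u').
        expect (pair_law (b = b') (pv w)) (\<lambda>(v, v'). F w u u' v v')))"
proof -
  have "expect cluster (\<lambda>C. F (fst C) (fst (snd C) a) (fst (snd C) a') (snd (snd C) b) (snd (snd C) b'))
    = expect pw (\<lambda>w. expect (Pi_pmf {..<M1} undefined (\<lambda>_. pu w)) (\<lambda>us.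
        expect (Pi_pmf {..<M2} undefined (\<lambda>_. pv w)) (\<lambda>vs. F w (us a) (us a') (vs b) (vs b'))))"
    unfolding cluster_def by (simp add: expect_bind finite_pw finite_Pi)
  then show ?thesis
    using assms by (simp add: expect_Pi_pmf_pair
        expect_Pi_pmf_pair[where F = "\<lambda>u u'. expect (pair_law (b = b') (pv w)) (\<lambda>(v, v'). F w u u' v v')" for w])
qed

lemma expect_cluster:
  assumes "a < M1" "b < M2"
  shows "expect cluster (\<lambda>C. word C a b h) = expect3 h"
  using expect_cluster_pair[OF assms(1,1) assms(2,2), of "\<lambda>w u _ v _. h w u v"]
  by (simp add: expect_pair_law_True expect3_def word_def)

lemma expect_codebook:
  assumes "finite I" "i \<in> I" 
  shows "expect (codebook I) (\<lambda>c. f (c i)) = expect cluster f"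
  using expect_Pi_pmf_pair[OF assms(1,2,2), of undefined cluster "\<lambda>x _. f x"]
  by (simp add: codebook_def expect_pair_law_True)

lemma expect_codebook_indep:
  assumes "finite I" "i \<in> I" "j \<in> I" "i \<noteq> j"
  shows "expect (codebook I) (\<lambda>c. F (c i) (c j)) = expect cluster (\<lambda>C. expect cluster (F C))"
  using expect_Pi_pmf_pair[OF assms(1,2,3), of undefined cluster F] assms(4)
  by (simp add: codebook_def expect_pair_law_False finite_cluster)

definition word_avg :: "('w \<Rightarrow> 'u \<Rightarrow> 'v \<Rightarrow> real) \<Rightarrow> 'w \<times> (nat \<Rightarrow> 'u) \<times> (nat \<Rightarrow> 'v) \<Rightarrow> real" where
  "word_avg g C = (\<Sum>(a, b)\<in>{..<M1} \<times> {..<M2}. word C a b g) / (real M1 * real M2)"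

lemma expect_word_avg: "expect cluster (word_avg g) = expect3 g"
proof -
  have "expect cluster (word_avg g)
      = (\<Sum>p\<in>{..<M1} \<times> {..<M2}. expect cluster (\<lambda>C. word C (fst p) (snd p) g)) / (real M1 * real M2)"
    unfolding word_avg_def case_prod_unfold by (simp add: expect_sum[OF finite_cluster])
  also have "\<dots> = (\<Sum>p\<in>{..<M1} \<times> {..<M2}. expect3 g) / (real M1 * real M2)"
    by (intro arg_cong[where f = "\<lambda>x. x / _"] sum.cong refl expect_cluster) auto
  finally have "expect cluster (word_avg g) = (\<Sum>p\<in>{..<M1} \<times> {..<M2}. expect3 g) / (real M1 * real M2)" .
  then show ?thesis using M1_pos M2_pos by simp
qed

text \<open>The four terms correspond to the ways in which two codewords of a cluster can share their
  satellites; each is bounded by conditioning on the shared part.\<close>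

lemma expect_word_product:
  assumes "a < M1" "a' < M1" "b < M2" "b' < M2"
    and g: "\<And>w u v. 0 \<le> g w u v"
    and B0: "\<And>w. expect (pu w) (\<lambda>u. expect (pv w) (\<lambda>v. g w u v)) \<le> B0"
    and B1: "\<And>w u. expect (pv w) (\<lambda>v. g w u v) \<le> B1"
    and B2: "\<And>w v. expect (pu w) (\<lambda>u. g w u v) \<le> B2"
    and B3: "\<And>w u v. g w u v \<le> B3"
  shows "expect cluster (\<lambda>C. word C a b g * word C a' b' g)
    \<le> (B0 + of_bool (a = a') * B1 + of_bool (b = b') * B2 + of_bool (a = a') * of_bool (b = b') * B3) * expect3 g"
proof -
  have pos: "B0 \<ge> 0" "B1 \<ge> 0" "B2 \<ge> 0" "B3 \<ge> 0"
    by (rule order_trans[OF _ B0] order_trans[OF _ B1] order_trans[OF _ B2] order_trans[OF _ B3];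
        intro expect_nonneg g)+
  have e3: "expect3 g \<ge> 0" unfolding expect3_def by (intro expect_nonneg g)
  note fin = finite_pw finite_pu finite_pv
  let ?L = "expect cluster (\<lambda>C. word C a b g * word C a' b' g)"
  have L: "?L = expect pw (\<lambda>w. expect (pair_law (a = a') (pu w)) (\<lambda>(u, u').
        expect (pair_law (b = b') (pv w)) (\<lambda>(v, v'). g w u v * g w u' v')))"
    using expect_cluster_pair[OF assms(1-4), of "\<lambda>w u u' v v'. g w u v * g w u' v'"]
    by (simp add: word_def)
  consider "a = a'" "b = b'" | "a = a'" "b \<noteq> b'" | "a \<noteq> a'" "b = b'" | "a \<noteq> a'" "b \<noteq> b'" by blast
  then show ?thesis
  proof cases
    case 1
    have "?L = expect pw (\<lambda>w. expect (pu w) (\<lambda>u. expect (pv w) (\<lambda>v. g w u v * g w u v)))"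
      unfolding L using 1 by (simp add: expect_pair_law_True)
    also have "\<dots> \<le> expect pw (\<lambda>w. expect (pu w) (\<lambda>u. expect (pv w) (\<lambda>v. B3 * g w u v)))"
      by (intro expect_mono fin mult_right_mono g B3)
    also have "\<dots> = B3 * expect3 g" by (simp add: expect3_def)
    also have "\<dots> \<le> (B0 + B1 + B2 + B3) * expect3 g" using pos by (intro mult_right_mono e3) simp
    finally show ?thesis using 1 by simp
  next
    case 2
    have "?L = expect pw (\<lambda>w. expect (pu w) (\<lambda>u. expect (pv w) (\<lambda>v. g w u v) * expect (pv w) (\<lambda>v. g w u v)))"
      unfolding L using 2 by (simp add: expect_pair_law_True
           expect_pair_law_False fin)
    also have "\<dots> \<le> expect pw (\<lambda>w. expect (pu w) (\<lambda>u. B1 * expect (pv w) (\<lambda>v. g w u v)))"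
      by (intro expect_mono fin mult_right_mono expect_nonneg g B1)
    also have "\<dots> = B1 * expect3 g" by (simp add: expect3_def)
    also have "\<dots> \<le> (B0 + B1) * expect3 g" using pos by (intro mult_right_mono e3) simp
    finally show ?thesis using 2 by simp
  next
    case 3
    have "?L = expect pw (\<lambda>w. expect (pu w) (\<lambda>u. expect (pu w) (\<lambda>u'. expect (pv w) (\<lambda>v. g w u v * g w u' v))))"
      unfolding L using 3 by (simp add: expect_pair_law_False fin expect_pair_law_True)
    \<comment> \<open>With \<open>v\<close> shared, the average over the second satellite
      \<open>u'\<close> must be taken at fixed \<open>v\<close> for \<open>B2\<close> to apply, so
      it is moved inside the one over \<open>v\<close>.\<close>
    also have "\<dots> = expect pw (\<lambda>w. expect (pu w) (\<lambda>u. expect (pv w) (\<lambda>v. expect (pu w) (\<lambda>u'. g w u' v) * g w u v)))"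
      by (subst expect_swap) (simp_all add: fin mult.commute)
    also have "\<dots> \<le> expect pw (\<lambda>w. expect (pu w) (\<lambda>u. expect (pv w) (\<lambda>v. B2 * g w u v)))"
      by (intro expect_mono fin mult_right_mono g B2)
    also have "\<dots> = B2 * expect3 g" by (simp add: expect3_def)
    also have "\<dots> \<le> (B0 + B2) * expect3 g" using pos by (intro mult_right_mono e3) simp
    finally show ?thesis using 3 by simp
  next
    case 4
    have "?L = expect pw (\<lambda>w. expect (pu w) (\<lambda>u. expect (pv w) (\<lambda>v. g w u v)) * expect (pu w) (\<lambda>u. expect (pv w) (\<lambda>v. g w u v)))"
      unfolding L using 4 by (simp add: expect_pair_law_False fin)
    also have "\<dots> \<le> expect pw (\<lambda>w. B0 * expect (pu w) (\<lambda>u. expect (pv w) (\<lambda>v. g w u v)))"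
      by (intro expect_mono fin mult_right_mono expect_nonneg g B0)
    also have "\<dots> = B0 * expect3 g" by (simp add: expect3_def)
    finally show ?thesis using 4 by simp
  qed
qed

lemma word_avg_second_moment:
  assumes g: "\<And>w u v. 0 \<le> g w u v"
    and B: "\<And>w. expect (pu w) (\<lambda>u. expect (pv w) (\<lambda>v. g w u v)) \<le> B0"
     "\<And>w u. expect (pv w) (\<lambda>v. g w u v) \<le> B1"
     "\<And>w v. expect (pu w) (\<lambda>u. g w u v) \<le> B2"
     "\<And>w u v. g w u v \<le> B3"
  shows "expect cluster (\<lambda>C. (word_avg g C)\<^sup>2)
    \<le> (B0 + B1 / M1 + B2 / M2 + B3 / (real M1 * real M2)) * expect3 g"
proof -
  let ?S = "{..<M1} \<times> {..<M2}" and ?N = "real M1 * real M2"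
  let ?K = "\<lambda>a b a' b'. B0 + of_bool (a = a') * B1 + of_bool (b = b') * B2 + of_bool (a = a') * of_bool (b = b') * B3"
  have "(word_avg g C)\<^sup>2 = (\<Sum>p\<in>?S. \<Sum>q\<in>?S. word C (fst p) (snd p) g * word C (fst q) (snd q) g) / ?N\<^sup>2" for C
    unfolding word_avg_def by (simp add: power2_eq_square sum_product case_prod_beta)
  then have "expect cluster (\<lambda>C. (word_avg g C)\<^sup>2)
    = (\<Sum>p\<in>?S. \<Sum>q\<in>?S. expect cluster (\<lambda>C. word C (fst p) (snd p) g * word C (fst q) (snd q) g)) / ?N\<^sup>2"
    by (simp add: expect_sum[OF finite_cluster])
  also have "\<dots> \<le> (\<Sum>p\<in>?S. \<Sum>q\<in>?S. ?K (fst p) (snd p) (fst q) (snd q) * expect3 g) / ?N\<^sup>2"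
    by (intro divide_right_mono sum_mono expect_word_product g B) auto
  also have "\<dots> = (\<Sum>p\<in>?S. (\<Sum>q\<in>?S. ?K (fst p) (snd p) (fst q) (snd q))) * expect3 g / ?N\<^sup>2"
    by (simp add: sum_distrib_right)
  \<comment> \<open>For a fixed codeword, \<open>M2\<close> codewords share its first satellite,
    \<open>M1\<close> share its second one and only itself shares both; this gives the weights of
    \<open>B1\<close>, \<open>B2\<close> and \<open>B3\<close>.\<close>
  also have "(\<Sum>p\<in>?S. (\<Sum>q\<in>?S. ?K (fst p) (snd p) (fst q) (snd q)))
    = (\<Sum>p\<in>?S. ?N * B0 + M2 * B1 + M1 * B2 + B3)"
  proof (intro sum.cong refl)
    fix p assume p: "p \<in> ?S"
    have "?S \<inter> {q. fst p = fst q} = {fst p} \<times> {..<M2}" "?S \<inter> {q. snd p = snd q} = {..<M1} \<times> {snd p}"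
      "{fst p} \<times> {..<M2} \<inter> {q. snd p = snd q} = {p}"
      using p by auto
    then show "(\<Sum>q\<in>?S. ?K (fst p) (snd p) (fst q) (snd q)) = ?N * B0 + M2 * B1 + M1 * B2 + B3"
      by (simp add: sum.distrib flip: sum_distrib_left sum_distrib_right)
  qed
  also have "(\<Sum>p\<in>?S. ?N * B0 + M2 * B1 + M1 * B2 + B3) * expect3 g / ?N\<^sup>2
    = (B0 + B1 / M1 + B2 / M2 + B3 / ?N) * expect3 g"
    using M1_pos M2_pos by (simp add: field_simps power2_eq_square)
  finally show ?thesis .
qed

text \<open>Distinct clusters are independent, so the cross terms of the variance vanish.\<close>

lemma codebook_deviation:
  assumes I: "finite I" "I' \<subseteq> I" "I' \<noteq> {}"
  shows "expect (codebook I) (\<lambda>c. \<bar>(\<Sum>i\<in>I'. G (c i)) / card I' - expect cluster G\<bar>)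
    \<le> sqrt (expect cluster (\<lambda>C. (G C)\<^sup>2) / card I')"
proof -
  have I': "finite I'" "card I' > 0" using I by (auto intro: finite_subset simp: card_gt_0_iff)
  define H where "H C = G C - expect cluster G" for C
  have int: "integrable (measure_pmf cluster) f" for f :: "_ \<Rightarrow> real"
    by (rule integrable_measure_pmf_finite[OF finite_cluster])
  have H0: "expect cluster H = 0" unfolding H_def by (subst Bochner_Integration.integral_diff) (auto simp: int)
  have H2: "expect cluster (\<lambda>C. (H C)\<^sup>2) \<le> expect cluster (\<lambda>C. (G C)\<^sup>2)"
    unfolding H_def by (subst measure_pmf.variance_eq) (auto simp: int)
  have eq: "(\<Sum>i\<in>I'. G (c i)) / card I' - expect cluster G = (\<Sum>i\<in>I'. H (c i)) / card I'" for c
    using I I' by (simp add: H_def sum_subtractf diff_divide_distrib)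
  have "expect (codebook I) (\<lambda>c. (\<Sum>i\<in>I'. H (c i))\<^sup>2)
      = (\<Sum>i\<in>I'. \<Sum>j\<in>I'. expect (codebook I) (\<lambda>c. H (c i) * H (c j)))"
    by (simp add: power2_eq_square sum_product expect_sum[OF finite_codebook[OF I(1)]])
  also have "\<dots> = (\<Sum>i\<in>I'. \<Sum>j\<in>I'. of_bool (i = j) * expect cluster (\<lambda>C. (H C)\<^sup>2))"
  proof (intro sum.cong refl)
    fix i j assume "i \<in> I'" "j \<in> I'"
    then show "expect (codebook I) (\<lambda>c. H (c i) * H (c j)) = of_bool (i = j) * expect cluster (\<lambda>C. (H C)\<^sup>2)"
      using I expect_codebook_indep[of I i j "\<lambda>C D. H C * H D"] expect_codebook[of I i "\<lambda>C. H C * H C"]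
      by (cases "i = j") (auto simp: H0 power2_eq_square)
  qed
  also have "\<dots> = card I' * expect cluster (\<lambda>C. (H C)\<^sup>2)"
    using I' by (simp add: of_bool_def if_distrib[of "\<lambda>x. x * _"] cong: if_cong)
  finally have S: "expect (codebook I) (\<lambda>c. (\<Sum>i\<in>I'. H (c i))\<^sup>2) = card I' * expect cluster (\<lambda>C. (H C)\<^sup>2)" .
  have "expect (codebook I) (\<lambda>c. \<bar>(\<Sum>i\<in>I'. H (c i)) / card I'\<bar>)
    \<le> sqrt (expect (codebook I) (\<lambda>c. ((\<Sum>i\<in>I'. H (c i)) / card I')\<^sup>2))"
    by (intro expect_abs_le_sqrt finite_codebook I)
  also have "expect (codebook I) (\<lambda>c. ((\<Sum>i\<in>I'. H (c i)) / card I')\<^sup>2) = expect cluster (\<lambda>C. (H C)\<^sup>2) / card I'"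
    using I' by (simp add: power_divide S) (simp add: power2_eq_square)
  also have "sqrt \<dots> \<le> sqrt (expect cluster (\<lambda>C. (G C)\<^sup>2) / card I')"
    using H2 by (intro real_sqrt_le_mono divide_right_mono) auto
  finally show ?thesis by (simp add: eq)
qed

text \<open>Only the two pair marginals are prescribed: under \<open>J\<close>, U and V may be
  dependent given W. The pair marginals still force the support of \<open>J\<close> into that of
  p(w) p(u|w) p(v|w), so \<open>phi\<close> is a genuine density.\<close>

definition joint :: "('w \<times> 'u \<times> 'v \<times> 't) pmf \<Rightarrow> bool" where
  "joint J \<longleftrightarrow> finite (set_pmf J)
    \<and> marg_wu J = bind_pmf pw (\<lambda>w. map_pmf (Pair w) (pu w))
    \<and> marg_wv J = bind_pmf pw (\<lambda>w. map_pmf (Pair w) (pv w))"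

definition phi :: "('w \<times> 'u \<times> 'v \<times> 't) pmf \<Rightarrow> 't \<Rightarrow> 'w \<Rightarrow> 'u \<Rightarrow> 'v \<Rightarrow> real" where
  "phi J t w u v = pmf J (w, u, v, t) / (pmf pw w * pmf (pu w) u * pmf (pv w) v)"

lemma phi_nonneg: "phi J t w u v \<ge> 0"
  by (simp add: phi_def)

lemma pmf_joint:
  assumes "joint J"
  shows "pmf (marg_wu J) (w, u) = pmf pw w * pmf (pu w) u"
    and "pmf (marg_wv J) (w, v) = pmf pw w * pmf (pv w) v"
proof -
  have *: "pmf (bind_pmf pw (\<lambda>w. map_pmf (Pair w) (q w))) (w, x) = pmf pw w * pmf (q w) x" for q :: "'w \<Rightarrow> 'r pmf" and x
    by (subst pmf_bind_tagged[where h = fst]) (auto simp: pmf_map_inj' inj_on_def)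
  show "pmf (marg_wu J) (w, u) = pmf pw w * pmf (pu w) u"
     "pmf (marg_wv J) (w, v) = pmf pw w * pmf (pv w) v"
    using assms by (simp_all add: joint_def *)
qed

text \<open>Change of measure: a codeword drawn from the product law and weighted by
  \<open>phi\<close> behaves like a draw from \<open>J\<close>. This turns averages over random
  codebooks into probabilities under \<open>J\<close>.\<close>

lemma expect3_phi:
  assumes J: "joint J"
  shows "expect3 (\<lambda>w u v. phi J t w u v * h w u v) = expect J (\<lambda>(w, u, v, t'). of_bool (t' = t) * h w u v)"
proof -
  define q where "q = bind_pmf pw (\<lambda>w. bind_pmf (pu w) (\<lambda>u. bind_pmf (pv w) (\<lambda>v. return_pmf (w, u, v))))"
  note fin = finite_pw finite_pu finite_pv
  have finq: "finite (set_pmf q)" by (simp add: q_def fin)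
  have q: "pmf q (w, u, v) = pmf pw w * pmf (pu w) u * pmf (pv w) v" for w u v
    unfolding q_def
    apply (subst pmf_bind_tagged[where h = "\<lambda>(w, u, v). w"], force)
    apply simp
    apply (subst pmf_bind_tagged[where h = "\<lambda>(w, u, v). u"], force)
    apply simp
    apply (subst pmf_bind_tagged[where h = "\<lambda>(w, u, v). v"], force)
    apply simp
    done
  \<comment> \<open>Absolute continuity: positive mass under \<open>J\<close> gives positive mass of
    both pair marginals, hence of all three factors of the product law.\<close>
  have sub: "(w, u, v) \<in> set_pmf q" if "(w, u, v, t) \<in> set_pmf J" for w u v t
  proof -
    have "(w, u) \<in> set_pmf (marg_wu J)" "(w, v) \<in> set_pmf (marg_wv J)"
      using that by force+
    then show ?thesis unfolding set_pmf_iff pmf_joint[OF J] q by simp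
  qed
  have "expect3 (\<lambda>w u v. phi J t w u v * h w u v) = expect q (\<lambda>(w, u, v). phi J t w u v * h w u v)"
    unfolding expect3_def q_def by (simp add: expect_bind fin)
  also have "\<dots> = (\<Sum>(w, u, v)\<in>set_pmf q. pmf q (w, u, v) * (phi J t w u v * h w u v))"
    by (subst integral_measure_pmf[OF finq]) (auto simp: case_prod_beta)
  also have "\<dots> = (\<Sum>(w, u, v)\<in>set_pmf q. pmf J (w, u, v, t) * h w u v)"
    by (intro sum.cong refl) (auto simp: phi_def set_pmf_iff q)
  also have "\<dots> = (\<Sum>s\<in>(\<lambda>(w, u, v). (w, u, v, t)) ` set_pmf q. pmf J s * (case s of (w, u, v, t') \<Rightarrow> of_bool (t' = t) * h w u v))"
    by (subst sum.reindex) (auto simp: inj_on_def intro!: sum.cong)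
  also have "\<dots> = expect J (\<lambda>(w, u, v, t'). of_bool (t' = t) * h w u v)"
    by (subst integral_measure_pmf[of "(\<lambda>(w, u, v). (w, u, v, t)) ` set_pmf q"])
       (use finq sub in \<open>force simp: image_iff\<close>)+
  finally show ?thesis .
qed

lemma sum_expect3_phi:
  assumes J: "joint J" and "finite F" "\<And>w u v t. (w, u, v, t) \<in> set_pmf J \<Longrightarrow> t \<in> F"
  shows "(\<Sum>t\<in>F. expect3 (\<lambda>w u v. phi J t w u v * h w u v t)) = expect J (\<lambda>(w, u, v, t). h w u v t)"
proof -
  have fin: "finite (set_pmf J)" using J by (simp add: joint_def)
  have "(\<Sum>t\<in>F. expect3 (\<lambda>w u v. phi J t w u v * h w u v t))
     = expect J (\<lambda>s. \<Sum>t\<in>F. (case s of (w, u, v, t') \<Rightarrow> of_bool (t' = t) * h w u v t))"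
    by (simp add: expect3_phi[OF J] expect_sum[OF fin])
  also have "\<dots> = expect J (\<lambda>(w, u, v, t). h w u v t)"
    by (rule expect_cong) (use assms in \<open>auto simp: of_bool_def if_distrib[of "\<lambda>x. x * _"] cong: if_cong\<close>)
  finally show ?thesis .
qed

lemma expect3_phi_pmf:
  assumes "joint J"
  shows "expect3 (\<lambda>w u v. phi J t w u v) = pmf (marg_t J) t"
proof -
  have "pmf (marg_t J) t = expect J (indicator ((\<lambda>(w, u, v, t). t) -` {t}))"
    by (simp add: pmf_map)
  also have "\<dots> = expect J (\<lambda>(w, u, v, t'). of_bool (t' = t) * 1)"
    by (intro expect_cong) (auto simp: indicator_def)
  finally show ?thesis using expect3_phi[OF assms, of t "\<lambda>_ _ _. 1"] by simp
qed

end

section \<open>Soft covering and packing\<close>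

lemma divide_le_if_le_mult: "x \<le> c * d \<Longrightarrow> 0 \<le> c \<Longrightarrow> 0 \<le> d \<Longrightarrow> x / d \<le> (c :: real)"
  by (cases "d = 0") (auto simp: field_simps)

text \<open>Averaging over \<open>q\<close> cancels \<open>q\<close> in the denominator, and the
  surviving masses of \<open>p\<close> lie in one fibre of \<open>f\<close>. If the truncated set is
  empty the sum vanishes; otherwise any of its points supplies the bound on the fibre. The fibres
  used later fix (w, t), (w, u, t) or (w, v, t).\<close>

lemma expect_truncated_le:
  assumes fin: "finite (set_pmf q)" and "inj k" "\<And>a. f (k a) = s" "0 \<le> d" "0 \<le> (c :: real)"
    and T: "\<And>a. T a \<Longrightarrow> pmf (map_pmf f p) s \<le> c * d"
  shows "expect q (\<lambda>a. pmf p (k a) / (d * pmf q a) * of_bool (T a)) \<le> c"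
proof -
  let ?S = "{a \<in> set_pmf q. T a}"
  have "expect q (\<lambda>a. pmf p (k a) / (d * pmf q a) * of_bool (T a))
      = (\<Sum>a\<in>set_pmf q. pmf q a * (pmf p (k a) / (d * pmf q a) * of_bool (T a)))"
    by (subst integral_measure_pmf[OF fin]) auto
  also have "\<dots> = (\<Sum>a\<in>set_pmf q. if T a then pmf p (k a) / d else 0)"
    by (intro sum.cong refl) (auto simp: set_pmf_iff)
  also have "\<dots> = (\<Sum>a\<in>?S. pmf p (k a)) / d"
    using fin by (auto simp: sum.inter_filter sum_divide_distrib intro!: sum.cong)
  also have "\<dots> \<le> c"
  proof (cases "?S = {}")
    case False
    then obtain a where "T a" by auto
    have "(\<Sum>a\<in>?S. pmf p (k a)) \<le> pmf (map_pmf f p) s"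
      using assms(2,3) fin by (intro sum_pmf_le_pmf_map) (auto intro: inj_on_subset)
    also have "\<dots> \<le> c * d" using T \<open>T a\<close> .
    finally show ?thesis using assms by (intro divide_le_if_le_mult)
  next
    case True
    show ?thesis unfolding True using assms by simp
  qed
  finally show ?thesis .
qed

section \<open>Soft covering at a single output \<open>t\<close>\<close>

context superposition begin

lemma word_avg_add: "word_avg (\<lambda>w u v. g w u v + h w u v) C = word_avg g C + word_avg h C"
  by (simp add: word_avg_def word_def case_prod_unfold sum.distrib add_divide_distrib)

lemma word_avg_nonneg: "(\<And>w u v. g w u v \<ge> 0) \<Longrightarrow> word_avg g C \<ge> 0"
  by (auto simp: word_avg_def word_def case_prod_unfold intro!: divide_nonneg_nonneg sum_nonneg)

lemma expect3_add: "expect3 (\<lambda>w u v. g w u v + h w u v) = expect3 g + expect3 h"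
  by (simp add: expect3_def expect_add finite_pw finite_pu finite_pv)

lemma expect3_nonneg: "(\<And>w u v. g w u v \<ge> 0) \<Longrightarrow> expect3 g \<ge> 0"
  unfolding expect3_def by (intro expect_nonneg)

text \<open>The weight itself may have a huge second moment, so it is cut to \<open>T\<close>. The
  truncated part has conditional averages at most \<open>p\<close> times the corresponding \<beta>,
  which bounds its mean deviation through the second moment; the removed part is estimated by its
  mean alone.\<close>

lemma soft_covering_pointwise:
  fixes J :: "('w \<times> 'u \<times> 'v \<times> 't) pmf" and t :: 't and T :: "'w \<Rightarrow> 'u \<Rightarrow> 'v \<Rightarrow> bool"
  defines "p \<equiv> pmf (marg_t J) t"
  assumes J: "joint J" and I: "finite I" "I' \<subseteq> I" "I' \<noteq> {}"
    and \<beta>: "\<beta>0 \<ge> 0" "\<beta>1 \<ge> 0" "\<beta>2 \<ge> 0" "\<beta>3 \<ge> 0"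
    and T0: "\<And>w u v. T w u v \<Longrightarrow> pmf (marg_wt J) (w, t) \<le> \<beta>0 * (pmf pw w * p)"
    and T1: "\<And>w u v. T w u v \<Longrightarrow> pmf (marg_wut J) (w, u, t)
      \<le> \<beta>1 * (pmf pw w * pmf (pu w) u * p)"
    and T2: "\<And>w u v. T w u v \<Longrightarrow> pmf (marg_wvt J) (w, v, t)
      \<le> \<beta>2 * (pmf pw w * pmf (pv w) v * p)"
    and T3: "\<And>w u v. T w u v \<Longrightarrow> pmf J (w, u, v, t)
      \<le> \<beta>3 * (pmf pw w * pmf (pu w) u * pmf (pv w) v * p)"
  shows "expect (codebook I) (\<lambda>c. \<bar>(\<Sum>i\<in>I'. word_avg (phi J t) (c i)) / card I' - p\<bar>)
    \<le> p * sqrt ((\<beta>0 + \<beta>1 / M1 + \<beta>2 / M2 + \<beta>3 / (real M1 * real M2)) / card I')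
      + 2 * expect3 (\<lambda>w u v. phi J t w u v * of_bool (\<not> T w u v))"
proof -
  define g where "g w u v = phi J t w u v * of_bool (T w u v)" for w u v
  define h where "h w u v = phi J t w u v * of_bool (\<not> T w u v)" for w u v
  define \<beta> where "\<beta> = \<beta>0 + \<beta>1 / M1 + \<beta>2 / M2 + \<beta>3 / (real M1 * real M2)"
  note fin = finite_pw finite_pu finite_pv and finc = finite_codebook[OF I(1)]
  have gh: "phi J t = (\<lambda>w u v. g w u v + h w u v)" by (auto simp: g_def h_def fun_eq_iff)
  have nn: "g w u v \<ge> 0" "h w u v \<ge> 0" for w u v by (auto simp: g_def h_def phi_nonneg)
  have p0: "p \<ge> 0" by (simp add: p_def)
  have p: "p = expect3 g + expect3 h"
    unfolding p_def expect3_phi_pmf[OF J, symmetric] gh by (rule expect3_add)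
  have k: "card I' > 0" using I by (auto intro: finite_subset simp: card_gt_0_iff)
  have B0: "expect (pu w) (\<lambda>u. expect (pv w) (g w u)) \<le> p * \<beta>0" for w
  proof -
    have "expect (pu w) (\<lambda>u. expect (pv w) (g w u)) = expect (pair_pmf (pu w) (pv w)) (\<lambda>(u, v). g w u v)"
      by (simp add: pair_pmf_def expect_bind fin)
    also have "\<dots> = expect (pair_pmf (pu w) (pv w))
        (\<lambda>a. pmf J (case a of (u, v) \<Rightarrow> (w, u, v, t)) / (pmf pw w * pmf (pair_pmf (pu w) (pv w)) a) * of_bool (T w (fst a) (snd a)))"
      by (intro expect_cong) (auto simp: g_def phi_def pmf_pair mult_ac)
    also have "\<dots> \<le> p * \<beta>0"
      by (rule expect_truncated_le[where f = "\<lambda>(w, u, v, t). (w, t)" and s = "(w, t)"])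
         (use T0 \<beta> p0 in \<open>auto simp: fin inj_on_def mult_ac\<close>)
    finally show ?thesis .
  qed
  have B1: "expect (pv w) (g w u) \<le> p * \<beta>1" for w u
    unfolding g_def phi_def
    by (rule expect_truncated_le[where f = "\<lambda>(w, u, v, t). (w, u, t)" and s = "(w, u, t)"])
       (use T1 \<beta> p0 in \<open>auto simp: fin inj_on_def mult_ac\<close>)
  have B2: "expect (pu w) (\<lambda>u. g w u v) \<le> p * \<beta>2" for w v
  proof -
    have "expect (pu w) (\<lambda>u. g w u v) = expect (pu w)
        (\<lambda>u. pmf J (w, u, v, t) / (pmf pw w * pmf (pv w) v * pmf (pu w) u) * of_bool (T w u v))"
      by (intro expect_cong) (auto simp: g_def phi_def mult_ac)
    also have "\<dots> \<le> p * \<beta>2"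
      by (rule expect_truncated_le[where f = "\<lambda>(w, u, v, t). (w, v, t)" and s = "(w, v, t)"])
       (use T2 \<beta> p0 in \<open>auto simp: fin inj_on_def mult_ac\<close>)
    finally show ?thesis .
  qed
  have B3: "g w u v \<le> p * \<beta>3" for w u v
    unfolding g_def phi_def using T3[of w u v] \<beta> p0
    by (cases "T w u v") (auto intro!: divide_le_if_le_mult simp: mult_ac)
  have "expect cluster (\<lambda>C. (word_avg g C)\<^sup>2)
      \<le> (p * \<beta>0 + p * \<beta>1 / M1 + p * \<beta>2 / M2 + p * \<beta>3 / (real M1 * real M2)) * expect3 g"
    by (rule word_avg_second_moment[OF nn(1) B0 B1 B2 B3])
  also have "\<dots> = p * \<beta> * expect3 g" by (simp add: \<beta>_def algebra_simps)
  also have "\<dots> \<le> p * \<beta> * p"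
    using p expect3_nonneg[of h] nn p0 \<beta> by (intro mult_left_mono) (auto simp: \<beta>_def)
  finally have m2: "expect cluster (\<lambda>C. (word_avg g C)\<^sup>2) \<le> p\<^sup>2 * \<beta>" by (simp add: power2_eq_square mult_ac)
  \<comment> \<open>The removed part is counted twice, once in the empirical average and once in the
    mean it is compared with; both have expectation \<open>expect3 h\<close>. Hence the factor
    2.\<close>
  have "\<bar>(\<Sum>i\<in>I'. word_avg (phi J t) (c i)) / card I' - p\<bar>
      \<le> \<bar>(\<Sum>i\<in>I'. word_avg g (c i)) / card I' - expect3 g\<bar> + ((\<Sum>i\<in>I'. word_avg h (c i)) / card I' + expect3 h)" for c
  proof -
    have "(\<Sum>i\<in>I'. word_avg h (c i)) / card I' \<ge> 0"
      by (intro divide_nonneg_nonneg sum_nonneg word_avg_nonneg nn) auto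
    then show ?thesis
      using expect3_nonneg[of h] nn unfolding p gh by (simp add: word_avg_add sum.distrib add_divide_distrib)
  qed
  then have "expect (codebook I) (\<lambda>c. \<bar>(\<Sum>i\<in>I'. word_avg (phi J t) (c i)) / card I' - p\<bar>)
    \<le> expect (codebook I) (\<lambda>c. \<bar>(\<Sum>i\<in>I'. word_avg g (c i)) / card I' - expect3 g\<bar>
        + ((\<Sum>i\<in>I'. word_avg h (c i)) / card I' + expect3 h))"
    by (intro expect_mono finc)
  also have "\<dots> = expect (codebook I) (\<lambda>c. \<bar>(\<Sum>i\<in>I'. word_avg g (c i)) / card I' - expect3 g\<bar>)
     + ((\<Sum>i\<in>I'. expect (codebook I) (\<lambda>c. word_avg h (c i))) / card I' + expect3 h)"
    by (simp add: expect_add[OF finc] expect_sum[OF finc])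
  also have "(\<Sum>i\<in>I'. expect (codebook I) (\<lambda>c. word_avg h (c i))) = (\<Sum>i\<in>I'. expect3 h)"
    using I by (intro sum.cong refl) (auto simp: expect_codebook expect_word_avg)
  also have "expect (codebook I) (\<lambda>c. \<bar>(\<Sum>i\<in>I'. word_avg g (c i)) / card I' - expect3 g\<bar>)
      \<le> sqrt (expect cluster (\<lambda>C. (word_avg g C)\<^sup>2) / card I')"
    using codebook_deviation[OF I, of "word_avg g"] by (simp add: expect_word_avg)
  also have "\<dots> \<le> sqrt (p\<^sup>2 * (\<beta> / card I'))"
    using m2 by (intro real_sqrt_le_mono) (simp add: divide_right_mono)
  also have "\<dots> = p * sqrt (\<beta> / card I')" using p0 unfolding real_sqrt_mult by simp
  finally show ?thesis using k unfolding \<beta>_def h_def[abs_def] by simp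
qed

section \<open>Packing: the chance that a wrong codeword looks right\<close>

lemma sum_expect_word_phi:
  assumes J: "joint J" and F: "finite F" "\<And>w u v t. (w, u, v, t) \<in> set_pmf J \<Longrightarrow> t \<in> F"
    and I: "finite I" "i \<in> I" and ab: "a < M1" "b < M2"
  shows "expect (codebook I) (\<lambda>c. \<Sum>t\<in>F. word (c i) a b (\<lambda>w u v. phi J t w u v * h w u v t))
    = expect J (\<lambda>(w, u, v, t). h w u v t)"
proof -
  have "expect (codebook I) (\<lambda>c. word (c i) a b (\<lambda>w u v. phi J t w u v * h w u v t))
      = expect3 (\<lambda>w u v. phi J t w u v * h w u v t)" for t
    using expect_codebook[OF I, of "\<lambda>C. word C a b (\<lambda>w u v. phi J t w u v * h w u v t)"]
    by (simp add: expect_cluster[OF ab])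
  then show ?thesis by (simp add: expect_sum[OF finite_codebook[OF I(1)]] sum_expect3_phi[OF J F])
qed

text \<open>A codeword of another cluster is independent of the weighted one, whose weight then
  integrates to the mass of \<open>t\<close> alone.\<close>

lemma expect_word_other_cluster:
  assumes J: "joint J" and I: "finite I" "i \<in> I" "j \<in> I" "i \<noteq> j" and ab: "a < M1" "b < M2" "a' < M1" "b' < M2"
  shows "expect (codebook I) (\<lambda>c. word (c i) a b (phi J t) * word (c j) a' b' h)
    = pmf (marg_t J) t * expect3 h"
  by (subst expect_codebook_indep[OF I, of "\<lambda>C D. word C a b (phi J t) * word D a' b' h"])
     (simp add: expect_cluster ab expect3_phi_pmf[OF J])

text \<open>The common core of the packing bounds. A criterion that forces the true mass to be at
  least \<gamma> times the mass seen by an independent codeword accepts such a codeword with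
  probability at most 1/\<gamma>, since the true masses add up to at most 1.\<close>

lemma sum_expect_le_inverse:
  assumes F: "finite F" and r: "\<And>w. finite (set_pmf (r w))" and \<gamma>: "\<gamma> > (0 :: real)"
    and le: "\<And>w x t. w \<in> set_pmf pw \<Longrightarrow> x \<in> set_pmf (r w) \<Longrightarrow>
      pmf pw w * pmf (r w) x * f w x t \<le> pmf Q (w, x, t) / \<gamma>"
  shows "(\<Sum>t\<in>F. expect pw (\<lambda>w. expect (r w) (\<lambda>x. f w x t))) \<le> 1 / \<gamma>"
proof -
  let ?S = "SIGMA t:F. SIGMA w:set_pmf pw. set_pmf (r w)"
  have "(\<Sum>t\<in>F. expect pw (\<lambda>w. expect (r w) (\<lambda>x. f w x t)))
    = (\<Sum>t\<in>F. \<Sum>w\<in>set_pmf pw. \<Sum>x\<in>set_pmf (r w). pmf pw w * pmf (r w) x * f w x t)"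
    by (simp add: integral_measure_pmf[OF finite_pw] integral_measure_pmf[OF r] sum_distrib_left mult_ac)
  also have "\<dots> \<le> (\<Sum>t\<in>F. \<Sum>w\<in>set_pmf pw. \<Sum>x\<in>set_pmf (r w). pmf Q (w, x, t) / \<gamma>)"
    by (intro sum_mono le)
  also have "\<dots> = (\<Sum>(t, w, x)\<in>?S. pmf Q (w, x, t)) / \<gamma>"
    by (simp add: sum.Sigma F r finite_pw case_prod_unfold sum_divide_distrib)
  also have "(\<Sum>(t, w, x)\<in>?S. pmf Q (w, x, t)) = (\<Sum>s\<in>?S. pmf Q ((\<lambda>(t, w, x). (w, x, t)) s))"
    by (simp add: case_prod_unfold)
  also have "\<dots> = measure_pmf.prob Q ((\<lambda>(t, w, x). (w, x, t)) ` ?S)"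
    by (subst measure_measure_pmf_finite)
       (auto simp: F r finite_pw sum.reindex inj_on_def intro!: finite_imageI finite_SigmaI)
  also have "\<dots> \<le> 1" by simp
  finally show ?thesis using \<gamma> by (simp add: divide_right_mono)
qed

text \<open>Averaging out both satellites leaves at most the conditional mass of \<open>t\<close>
  given \<open>w\<close>, which is how the output looks to a satellite that was not chosen.\<close>

lemma expect_phi_le:
  assumes w: "w \<in> set_pmf pw"
  shows "expect (pu w) (\<lambda>u. expect (pv w) (phi J t w u))
    \<le> pmf (marg_wt J) (w, t) / pmf pw w"
proof -
  note fin = finite_pw finite_pu finite_pv
  have "expect (pu w) (\<lambda>u. expect (pv w) (phi J t w u)) = expect (pair_pmf (pu w) (pv w)) (\<lambda>(u, v). phi J t w u v)"
    by (simp add: pair_pmf_def expect_bind fin)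
  also have "\<dots> = expect (pair_pmf (pu w) (pv w))
      (\<lambda>a. pmf J (case a of (u, v) \<Rightarrow> (w, u, v, t)) / (pmf pw w * pmf (pair_pmf (pu w) (pv w)) a) * of_bool True)"
    by (intro expect_cong) (auto simp: phi_def pmf_pair mult_ac)
  also have "\<dots> \<le> pmf (marg_wt J) (w, t) / pmf pw w"
    by (rule expect_truncated_le[where f = "\<lambda>(w, u, v, t). (w, t)" and s = "(w, t)"])
       (use w in \<open>auto simp: fin inj_on_def set_pmf_iff\<close>)
  finally show ?thesis .
qed

lemma packing_sum_le:
  assumes w: "w \<in> set_pmf pw" and "\<gamma> > 0" and x: "0 \<le> x" "x \<le> q / pmf pw w" and "r \<ge> 0" "s \<ge> 0"
    and good: "G \<Longrightarrow> \<gamma> * (pmf pw w * r * q) \<le> s * pmf pw w"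
  shows "pmf pw w * r * (of_bool G * x) \<le> s / \<gamma>"
proof (cases G)
  case True
  have pos: "pmf pw w > 0" using w by (simp add: pmf_positive)
  have "pmf pw w * r * x \<le> pmf pw w * r * (q / pmf pw w)" using assms by (intro mult_left_mono) auto
  also have "\<dots> = r * q" using pos by simp
  also have "\<dots> \<le> s / \<gamma>" using good[OF True] pos \<open>\<gamma> > 0\<close> by (simp add: field_simps)
  finally show ?thesis using True by simp
qed (use assms in simp)

text \<open>Given the centre \<open>w\<close>, a wrong satellite \<open>a'\<close> is independent of
  the chosen one, while the output still depends on \<open>w\<close>. Hence the comparison is with
  p(w, t) / p(w) rather than p(t), and the threshold concerns information conditional on W.\<close>

lemma packing_same_cluster_u:
  assumes F: "finite F" and I: "finite I" "i \<in> I"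
    and ab: "a < M1" "b < M2" "a' < M1" "a \<noteq> a'" and \<gamma>: "\<gamma> > 0"
    and good: "\<And>w u t. good w u t \<Longrightarrow>
      \<gamma> * (pmf pw w * pmf (pu w) u * pmf (marg_wt J) (w, t))
        \<le> pmf (marg_wut J) (w, u, t) * pmf pw w"
  shows "expect (codebook I) (\<lambda>c. \<Sum>t\<in>F. word (c i) a b (phi J t) * of_bool (word (c i) a' b (\<lambda>w u v. good w u t)))
    \<le> 1 / \<gamma>"
proof -
  note fin = finite_pw finite_pu finite_pv
  have "expect (codebook I) (\<lambda>c. word (c i) a b (phi J t) * of_bool (word (c i) a' b (\<lambda>w u v. good w u t)))
    = expect pw (\<lambda>w. expect (pu w) (\<lambda>u'. of_bool (good w u' t) * expect (pu w) (\<lambda>u. expect (pv w) (phi J t w u))))" for t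
  proof -
    have "expect (codebook I) (\<lambda>c. word (c i) a b (phi J t) * of_bool (word (c i) a' b (\<lambda>w u v. good w u t)))
      = expect cluster (\<lambda>C. word C a b (phi J t) * of_bool (word C a' b (\<lambda>w u v. good w u t)))"
      using expect_codebook[OF I, of "\<lambda>C. word C a b (phi J t) * of_bool (word C a' b (\<lambda>w u v. good w u t))"] .
    also have "\<dots> = expect pw (\<lambda>w. expect (pu w) (\<lambda>u. expect (pu w) (\<lambda>u'. expect (pv w) (phi J t w u) * of_bool (good w u' t))))"
      using expect_cluster_pair[OF ab(1,3,2,2), of "\<lambda>w u u' v v'. phi J t w u v * of_bool (good w u' t)"] ab(4)
      by (simp add: word_def expect_pair_law_False expect_pair_law_True fin)
    also have "\<dots> = expect pw (\<lambda>w. expect (pu w) (\<lambda>u'. of_bool (good w u' t) * expect (pu w) (\<lambda>u. expect (pv w) (phi J t w u))))"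
      by (simp add: mult.commute)
    finally show ?thesis .
  qed
  then have "expect (codebook I) (\<lambda>c. \<Sum>t\<in>F. word (c i) a b (phi J t) * of_bool (word (c i) a' b (\<lambda>w u v. good w u t)))
    = (\<Sum>t\<in>F. expect pw (\<lambda>w. expect (pu w) (\<lambda>u'. of_bool (good w u' t) * expect (pu w) (\<lambda>u. expect (pv w) (phi J t w u)))))"
    by (simp add: expect_sum[OF finite_codebook[OF I(1)]])
  also have "\<dots> \<le> 1 / \<gamma>"
    by (rule sum_expect_le_inverse[OF F fin(2) \<gamma>, where Q = "marg_wut J"])
       (rule packing_sum_le, assumption, rule \<gamma>, intro expect_nonneg phi_nonneg,
        erule expect_phi_le, simp, simp, rule good)
  finally show ?thesis .
qed

lemma packing_same_cluster_v:
  assumes F: "finite F" and I: "finite I" "i \<in> I"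
    and ab: "a < M1" "b < M2" "b' < M2" "b \<noteq> b'" and \<gamma>: "\<gamma> > 0"
    and good: "\<And>w v t. good w v t \<Longrightarrow>
      \<gamma> * (pmf pw w * pmf (pv w) v * pmf (marg_wt J) (w, t))
        \<le> pmf (marg_wvt J) (w, v, t) * pmf pw w"
  shows "expect (codebook I) (\<lambda>c. \<Sum>t\<in>F. word (c i) a b (phi J t) * of_bool (word (c i) a b' (\<lambda>w u v. good w v t)))
    \<le> 1 / \<gamma>"
proof -
  note fin = finite_pw finite_pu finite_pv
  have "expect (codebook I) (\<lambda>c. word (c i) a b (phi J t) * of_bool (word (c i) a b' (\<lambda>w u v. good w v t)))
    = expect pw (\<lambda>w. expect (pv w) (\<lambda>v'. of_bool (good w v' t) * expect (pu w) (\<lambda>u. expect (pv w) (phi J t w u))))" for t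
  proof -
    have "expect (codebook I) (\<lambda>c. word (c i) a b (phi J t) * of_bool (word (c i) a b' (\<lambda>w u v. good w v t)))
      = expect cluster (\<lambda>C. word C a b (phi J t) * of_bool (word C a b' (\<lambda>w u v. good w v t)))"
      using expect_codebook[OF I, of "\<lambda>C. word C a b (phi J t) * of_bool (word C a b' (\<lambda>w u v. good w v t))"] .
    also have "\<dots> = expect pw (\<lambda>w. expect (pu w) (\<lambda>u. expect (pv w) (\<lambda>v. phi J t w u v * expect (pv w) (\<lambda>v'. of_bool (good w v' t)))))"
      using expect_cluster_pair[OF ab(1,1,2,3), of "\<lambda>w u u' v v'. phi J t w u v * of_bool (good w v' t)"] ab(4)
      by (simp add: word_def expect_pair_law_False expect_pair_law_True fin)
    also have "\<dots> = expect pw (\<lambda>w. expect (pv w) (\<lambda>v'. of_bool (good w v' t) * expect (pu w) (\<lambda>u. expect (pv w) (phi J t w u))))"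
      by (simp add: mult.commute)
    finally show ?thesis .
  qed
  then have "expect (codebook I) (\<lambda>c. \<Sum>t\<in>F. word (c i) a b (phi J t) * of_bool (word (c i) a b' (\<lambda>w u v. good w v t)))
    = (\<Sum>t\<in>F. expect pw (\<lambda>w. expect (pv w) (\<lambda>v'. of_bool (good w v' t) * expect (pu w) (\<lambda>u. expect (pv w) (phi J t w u)))))"
    by (simp add: expect_sum[OF finite_codebook[OF I(1)]])
  also have "\<dots> \<le> 1 / \<gamma>"
    by (rule sum_expect_le_inverse[OF F fin(3) \<gamma>, where Q = "marg_wvt J"])
       (rule packing_sum_le, assumption, rule \<gamma>, intro expect_nonneg phi_nonneg,
        erule expect_phi_le, simp, simp, rule good)
  finally show ?thesis .
qed

text \<open>The first receiver cares only about the pair \<open>(i, a)\<close>: another satellite \<open>v\<close> of the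
  same cloud centre does not matter.\<close>

definition confusable_u where
  "confusable_u good I' c i a t \<longleftrightarrow>
    (\<exists>j\<in>I'. \<exists>a'<M1. (j, a') \<noteq> (i, a) \<and> good (fst (c j)) (fst (snd (c j)) a') t)"

definition confusable_v where
  "confusable_v good I' c i b t \<longleftrightarrow>
    (\<exists>j\<in>I'. \<exists>b'<M2. (j, b') \<noteq> (i, b) \<and> good (fst (c j)) (snd (snd (c j)) b') t)"

lemma of_bool_Bex_le:
  assumes "finite A"
  shows "of_bool (\<exists>x\<in>A. P x) \<le> (\<Sum>x\<in>A. of_bool (P x) :: real)"
proof (cases "\<exists>x\<in>A. P x")
  case True
  then obtain x where "x \<in> A" "P x" by blast
  then show ?thesis using assms True member_le_sum[of x A "\<lambda>x. of_bool (P x) :: real"] by simp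
qed (simp add: sum_nonneg)

lemma packing_u:
  fixes J :: "('w \<times> 'u \<times> 'v \<times> 't) pmf"
  assumes J: "joint J" and F: "finite F" "\<And>w u v t. (w, u, v, t) \<in> set_pmf J \<Longrightarrow> t \<in> F"
    and I: "finite I" "I' \<subseteq> I" "i \<in> I'" and ab: "a < M1" "b < M2" and \<gamma>: "\<gamma>0 > 0" "\<gamma>1 > 0"
    and good0: "\<And>w u t. good w u t \<Longrightarrow>
      \<gamma>0 * (pmf pw w * pmf (pu w) u * pmf (marg_t J) t)
        \<le> pmf (marg_wut J) (w, u, t)"
    and good1: "\<And>w u t. good w u t \<Longrightarrow>
      \<gamma>1 * (pmf pw w * pmf (pu w) u * pmf (marg_wt J) (w, t))
        \<le> pmf (marg_wut J) (w, u, t) * pmf pw w"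
  shows "expect (codebook I) (\<lambda>c. \<Sum>t\<in>F. word (c i) a b (phi J t)
      * of_bool (\<not> word (c i) a b (\<lambda>w u v. good w u t) \<or> confusable_u good I' c i a t))
    \<le> measure_pmf.prob J {(w, u, v, t). \<not> good w u t} + card I' * M1 / \<gamma>0 + (M1 - 1) / \<gamma>1"
proof -
  note finc = finite_codebook[OF I(1)] and fin = finite_pw finite_pu finite_pv
  have I': "finite I'" "i \<in> I" using I by (auto intro: finite_subset)
  let ?p = "\<lambda>c t. word (c i) a b (phi J t)"
  let ?g = "\<lambda>c j a' t. of_bool (word (c j) a' b (\<lambda>w u v. good w u t)) :: real"
  \<comment> \<open>A failure is charged to the true word failing its test, to a word of another
    cluster, or to another satellite of the same cloud. Wrong words are all formed with the same
    \<open>b\<close>, as the test looks only at \<open>w\<close> and \<open>u\<close>.\<close>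
  have bound: "of_bool (\<not> word (c i) a b (\<lambda>w u v. good w u t) \<or> confusable_u good I' c i a t)
    \<le> word (c i) a b (\<lambda>w u v. of_bool (\<not> good w u t)) + (\<Sum>(j, a')\<in>(I' - {i}) \<times> {..<M1}. ?g c j a' t)
      + (\<Sum>a'\<in>{..<M1} - {a}. ?g c i a' t)" for c t
  proof -
    have "confusable_u good I' c i a t \<longleftrightarrow>
       (\<exists>x\<in>(I' - {i}) \<times> {..<M1}. word (c (fst x)) (snd x) b (\<lambda>w u v. good w u t))
       \<or> (\<exists>a'\<in>{..<M1} - {a}. word (c i) a' b (\<lambda>w u v. good w u t))"
      using I unfolding confusable_u_def word_def by fastforce
    then have "(of_bool (confusable_u good I' c i a t) :: real)
      \<le> of_bool (\<exists>x\<in>(I' - {i}) \<times> {..<M1}. word (c (fst x)) (snd x) b (\<lambda>w u v. good w u t))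
       + of_bool (\<exists>a'\<in>{..<M1} - {a}. word (c i) a' b (\<lambda>w u v. good w u t))"
      by auto
    also have "\<dots> \<le> (\<Sum>(j, a')\<in>(I' - {i}) \<times> {..<M1}. ?g c j a' t) + (\<Sum>a'\<in>{..<M1} - {a}. ?g c i a' t)"
      unfolding case_prod_unfold using I' by (intro add_mono of_bool_Bex_le) auto
    finally have "of_bool (confusable_u good I' c i a t)
      \<le> (\<Sum>(j, a')\<in>(I' - {i}) \<times> {..<M1}. ?g c j a' t) + (\<Sum>a'\<in>{..<M1} - {a}. ?g c i a' t)" .
    moreover have "(\<Sum>(j, a')\<in>(I' - {i}) \<times> {..<M1}. ?g c j a' t) \<ge> 0" "(\<Sum>a'\<in>{..<M1} - {a}. ?g c i a' t) \<ge> 0"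
      by (auto intro!: sum_nonneg)
    ultimately show ?thesis
      by (cases "good (fst (c i)) (fst (snd (c i)) a) t") (simp_all only: word_def, auto)
  qed
  have "expect (codebook I) (\<lambda>c. \<Sum>t\<in>F. ?p c t
      * of_bool (\<not> word (c i) a b (\<lambda>w u v. good w u t) \<or> confusable_u good I' c i a t))
    \<le> expect (codebook I) (\<lambda>c. \<Sum>t\<in>F. ?p c t * (word (c i) a b (\<lambda>w u v. of_bool (\<not> good w u t))
      + (\<Sum>(j, a')\<in>(I' - {i}) \<times> {..<M1}. ?g c j a' t) + (\<Sum>a'\<in>{..<M1} - {a}. ?g c i a' t)))"
    using bound by (intro expect_mono finc sum_mono mult_left_mono) (auto simp: word_def phi_nonneg)
  also have "\<dots> = expect (codebook I) (\<lambda>c. \<Sum>t\<in>F. word (c i) a b (\<lambda>w u v. phi J t w u v * of_bool (\<not> good w u t)))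
     + (\<Sum>(j, a')\<in>(I' - {i}) \<times> {..<M1}. \<Sum>t\<in>F. expect (codebook I) (\<lambda>c. ?p c t * ?g c j a' t))
     + (\<Sum>a'\<in>{..<M1} - {a}. expect (codebook I) (\<lambda>c. \<Sum>t\<in>F. ?p c t * ?g c i a' t))"
    by (simp add: distrib_left sum.distrib expect_add[OF finc] expect_sum[OF finc] sum_distrib_left
       sum.swap[of _ _ F] case_prod_unfold word_def del: sum_of_bool_eq sum_mult_of_bool_eq sum_of_bool_mult_eq)
  also have "expect (codebook I) (\<lambda>c. \<Sum>t\<in>F. word (c i) a b (\<lambda>w u v. phi J t w u v * of_bool (\<not> good w u t)))
     = expect J (\<lambda>(w, u, v, t). of_bool (\<not> good w u t))"
    by (rule sum_expect_word_phi[OF J F I(1) I'(2) ab])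
  also have "\<dots> = expect J (indicator {(w, u, v, t). \<not> good w u t})"
    by (intro expect_cong) (auto simp: indicator_def)
  also have "\<dots> = measure_pmf.prob J {(w, u, v, t). \<not> good w u t}" by simp
  also have "(\<Sum>a'\<in>{..<M1} - {a}. expect (codebook I) (\<lambda>c. \<Sum>t\<in>F. ?p c t * ?g c i a' t))
      \<le> (\<Sum>a'\<in>{..<M1} - {a}. 1 / \<gamma>1)"
    using good1 ab by (intro sum_mono packing_same_cluster_u[OF F(1) I(1) I'(2)] \<gamma>) auto
  \<comment> \<open>The exact count \<open>M1 - 1\<close> matters: with a single satellite this term
    vanishes, however small \<open>\<gamma>1\<close> is.\<close>
  also have "\<dots> = (M1 - 1) / \<gamma>1" using ab by simp
  also have "(\<Sum>(j, a')\<in>(I' - {i}) \<times> {..<M1}. \<Sum>t\<in>F. expect (codebook I) (\<lambda>c. ?p c t * ?g c j a' t))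
      \<le> (\<Sum>(j, a')\<in>(I' - {i}) \<times> {..<M1}. 1 / \<gamma>0)"
  proof (intro sum_mono)
    fix x assume x: "x \<in> (I' - {i}) \<times> {..<M1}"
    obtain j a' where x_eq: "x = (j, a')" by (cases x)
    have ja: "j \<in> I'" "j \<noteq> i" "a' \<in> {..<M1}" using x x_eq by auto
    have "expect (codebook I) (\<lambda>c. ?p c t * ?g c j a' t)
      = expect pw (\<lambda>w. expect (pu w) (\<lambda>u. of_bool (good w u t) * pmf (marg_t J) t))" for t
      using expect_word_other_cluster[OF J I(1) I'(2), of j a b a' b t "\<lambda>w u v. of_bool (good w u t)"] ja I ab
      by (auto simp: word_def expect3_def mult.commute)
    then have "(\<Sum>t\<in>F. expect (codebook I) (\<lambda>c. ?p c t * ?g c j a' t))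
       = (\<Sum>t\<in>F. expect pw (\<lambda>w. expect (pu w) (\<lambda>u. of_bool (good w u t) * pmf (marg_t J) t)))"
      by simp
    also have "\<dots> \<le> 1 / \<gamma>0"
    proof (rule sum_expect_le_inverse[OF F(1) fin(2) \<gamma>(1), where Q = "marg_wut J"])
      fix w u t
      show "pmf pw w * pmf (pu w) u * (of_bool (good w u t) * pmf (marg_t J) t)
         \<le> pmf (marg_wut J) (w, u, t) / \<gamma>0"
        using good0[of w u t] \<gamma> by (cases "good w u t") (auto simp: field_simps)
    qed
    finally show "(case x of (j, a') \<Rightarrow> \<Sum>t\<in>F. expect (codebook I) (\<lambda>c. ?p c t * ?g c j a' t))
        \<le> (case x of (j, a') \<Rightarrow> 1 / \<gamma>0)" by (simp only: x_eq prod.case)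
  qed
  also have "(\<Sum>(j, a')\<in>(I' - {i}) \<times> {..<M1}. 1 / \<gamma>0) = card (I' - {i}) * M1 / \<gamma>0" by (simp add: card_cartesian_product)
  also have "\<dots> \<le> card I' * M1 / \<gamma>0"
    using I' \<gamma> by (intro divide_right_mono) (auto intro!: mult_right_mono card_mono)
  finally show ?thesis by simp
qed

lemma packing_v:
  fixes J :: "('w \<times> 'u \<times> 'v \<times> 't) pmf"
  assumes J: "joint J" and F: "finite F" "\<And>w u v t. (w, u, v, t) \<in> set_pmf J \<Longrightarrow> t \<in> F"
    and I: "finite I" "I' \<subseteq> I" "i \<in> I'" and ab: "a < M1" "b < M2" and \<gamma>: "\<gamma>0 > 0" "\<gamma>1 > 0"
    and good0: "\<And>w v t. good w v t \<Longrightarrow>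
      \<gamma>0 * (pmf pw w * pmf (pv w) v * pmf (marg_t J) t)
        \<le> pmf (marg_wvt J) (w, v, t)"
    and good1: "\<And>w v t. good w v t \<Longrightarrow>
      \<gamma>1 * (pmf pw w * pmf (pv w) v * pmf (marg_wt J) (w, t))
        \<le> pmf (marg_wvt J) (w, v, t) * pmf pw w"
  shows "expect (codebook I) (\<lambda>c. \<Sum>t\<in>F. word (c i) a b (phi J t)
      * of_bool (\<not> word (c i) a b (\<lambda>w u v. good w v t) \<or> confusable_v good I' c i b t))
    \<le> measure_pmf.prob J {(w, u, v, t). \<not> good w v t} + card I' * M2 / \<gamma>0 + (M2 - 1) / \<gamma>1"
proof -
  note finc = finite_codebook[OF I(1)] and fin = finite_pw finite_pu finite_pv
  have I': "finite I'" "i \<in> I" using I by (auto intro: finite_subset)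
  let ?p = "\<lambda>c t. word (c i) a b (phi J t)"
  let ?g = "\<lambda>c j b' t. of_bool (word (c j) a b' (\<lambda>w u v. good w v t)) :: real"
  have bound: "of_bool (\<not> word (c i) a b (\<lambda>w u v. good w v t) \<or> confusable_v good I' c i b t)
    \<le> word (c i) a b (\<lambda>w u v. of_bool (\<not> good w v t)) + (\<Sum>(j, b')\<in>(I' - {i}) \<times> {..<M2}. ?g c j b' t)
      + (\<Sum>b'\<in>{..<M2} - {b}. ?g c i b' t)" for c t
  proof -
    have "confusable_v good I' c i b t \<longleftrightarrow>
       (\<exists>x\<in>(I' - {i}) \<times> {..<M2}. word (c (fst x)) a (snd x) (\<lambda>w u v. good w v t))
       \<or> (\<exists>b'\<in>{..<M2} - {b}. word (c i) a b' (\<lambda>w u v. good w v t))"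
      using I unfolding confusable_v_def word_def by fastforce
    then have "(of_bool (confusable_v good I' c i b t) :: real)
      \<le> of_bool (\<exists>x\<in>(I' - {i}) \<times> {..<M2}. word (c (fst x)) a (snd x) (\<lambda>w u v. good w v t))
       + of_bool (\<exists>b'\<in>{..<M2} - {b}. word (c i) a b' (\<lambda>w u v. good w v t))"
      by auto
    also have "\<dots> \<le> (\<Sum>(j, b')\<in>(I' - {i}) \<times> {..<M2}. ?g c j b' t) + (\<Sum>b'\<in>{..<M2} - {b}. ?g c i b' t)"
      unfolding case_prod_unfold using I' by (intro add_mono of_bool_Bex_le) auto
    finally have "of_bool (confusable_v good I' c i b t)
      \<le> (\<Sum>(j, b')\<in>(I' - {i}) \<times> {..<M2}. ?g c j b' t) + (\<Sum>b'\<in>{..<M2} - {b}. ?g c i b' t)" .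
    moreover have "(\<Sum>(j, b')\<in>(I' - {i}) \<times> {..<M2}. ?g c j b' t) \<ge> 0" "(\<Sum>b'\<in>{..<M2} - {b}. ?g c i b' t) \<ge> 0"
      by (auto intro!: sum_nonneg)
    ultimately show ?thesis
      by (cases "good (fst (c i)) (snd (snd (c i)) b) t") (simp_all only: word_def, auto)
  qed
  have "expect (codebook I) (\<lambda>c. \<Sum>t\<in>F. ?p c t
      * of_bool (\<not> word (c i) a b (\<lambda>w u v. good w v t) \<or> confusable_v good I' c i b t))
    \<le> expect (codebook I) (\<lambda>c. \<Sum>t\<in>F. ?p c t * (word (c i) a b (\<lambda>w u v. of_bool (\<not> good w v t))
      + (\<Sum>(j, b')\<in>(I' - {i}) \<times> {..<M2}. ?g c j b' t) + (\<Sum>b'\<in>{..<M2} - {b}. ?g c i b' t)))"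
    using bound by (intro expect_mono finc sum_mono mult_left_mono) (auto simp: word_def phi_nonneg)
  also have "\<dots> = expect (codebook I) (\<lambda>c. \<Sum>t\<in>F. word (c i) a b (\<lambda>w u v. phi J t w u v * of_bool (\<not> good w v t)))
     + (\<Sum>(j, b')\<in>(I' - {i}) \<times> {..<M2}. \<Sum>t\<in>F. expect (codebook I) (\<lambda>c. ?p c t * ?g c j b' t))
     + (\<Sum>b'\<in>{..<M2} - {b}. expect (codebook I) (\<lambda>c. \<Sum>t\<in>F. ?p c t * ?g c i b' t))"
    by (simp add: distrib_left sum.distrib expect_add[OF finc] expect_sum[OF finc] sum_distrib_left
       sum.swap[of _ _ F] case_prod_unfold word_def del: sum_of_bool_eq sum_mult_of_bool_eq sum_of_bool_mult_eq)
  also have "expect (codebook I) (\<lambda>c. \<Sum>t\<in>F. word (c i) a b (\<lambda>w u v. phi J t w u v * of_bool (\<not> good w v t)))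
     = expect J (\<lambda>(w, u, v, t). of_bool (\<not> good w v t))"
    by (rule sum_expect_word_phi[OF J F I(1) I'(2) ab])
  also have "\<dots> = expect J (indicator {(w, u, v, t). \<not> good w v t})"
    by (intro expect_cong) (auto simp: indicator_def)
  also have "\<dots> = measure_pmf.prob J {(w, u, v, t). \<not> good w v t}" by simp
  also have "(\<Sum>b'\<in>{..<M2} - {b}. expect (codebook I) (\<lambda>c. \<Sum>t\<in>F. ?p c t * ?g c i b' t))
      \<le> (\<Sum>b'\<in>{..<M2} - {b}. 1 / \<gamma>1)"
    using good1 ab by (intro sum_mono packing_same_cluster_v[OF F(1) I(1) I'(2)] \<gamma>) auto
  also have "\<dots> = (M2 - 1) / \<gamma>1" using ab by simp
  also have "(\<Sum>(j, b')\<in>(I' - {i}) \<times> {..<M2}. \<Sum>t\<in>F. expect (codebook I) (\<lambda>c. ?p c t * ?g c j b' t))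
      \<le> (\<Sum>(j, b')\<in>(I' - {i}) \<times> {..<M2}. 1 / \<gamma>0)"
  proof (intro sum_mono)
    fix x assume x: "x \<in> (I' - {i}) \<times> {..<M2}"
    obtain j b' where x_eq: "x = (j, b')" by (cases x)
    have ja: "j \<in> I'" "j \<noteq> i" "b' \<in> {..<M2}" using x x_eq by auto
    have "expect (codebook I) (\<lambda>c. ?p c t * ?g c j b' t)
      = expect pw (\<lambda>w. expect (pv w) (\<lambda>v. of_bool (good w v t) * pmf (marg_t J) t))" for t
      using expect_word_other_cluster[OF J I(1) I'(2), of j a b a b' t "\<lambda>w u v. of_bool (good w v t)"] ja I ab
      by (auto simp: word_def expect3_def mult.commute)
    then have "(\<Sum>t\<in>F. expect (codebook I) (\<lambda>c. ?p c t * ?g c j b' t))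
       = (\<Sum>t\<in>F. expect pw (\<lambda>w. expect (pv w) (\<lambda>v. of_bool (good w v t) * pmf (marg_t J) t)))"
      by simp
    also have "\<dots> \<le> 1 / \<gamma>0"
    proof (rule sum_expect_le_inverse[OF F(1) fin(3) \<gamma>(1), where Q = "marg_wvt J"])
      fix w v t
      show "pmf pw w * pmf (pv w) v * (of_bool (good w v t) * pmf (marg_t J) t)
         \<le> pmf (marg_wvt J) (w, v, t) / \<gamma>0"
        using good0[of w v t] \<gamma> by (cases "good w v t") (auto simp: field_simps)
    qed
    finally show "(case x of (j, b') \<Rightarrow> \<Sum>t\<in>F. expect (codebook I) (\<lambda>c. ?p c t * ?g c j b' t))
        \<le> (case x of (j, b') \<Rightarrow> 1 / \<gamma>0)" by (simp only: x_eq prod.case)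
  qed
  also have "(\<Sum>(j, b')\<in>(I' - {i}) \<times> {..<M2}. 1 / \<gamma>0) = card (I' - {i}) * M2 / \<gamma>0" by (simp add: card_cartesian_product)
  also have "\<dots> \<le> card I' * M2 / \<gamma>0"
    using I' \<gamma> by (intro divide_right_mono) (auto intro!: mult_right_mono card_mono)
  finally show ?thesis by simp
qed

end

section \<open>Typical words and conditional laws\<close>

text \<open>Stated as a product so that a vanishing sum is no exception: then \<open>g\<close> is
  zero and any law on \<open>F\<close>, such as \<open>e0\<close>, will do.\<close>

lemma exists_normalized_pmf:
  fixes g :: "'a \<Rightarrow> real"
  assumes F: "finite F" and g: "\<And>x. g x \<ge> 0" "\<And>x. x \<notin> F \<Longrightarrow> g x = 0" and e0: "set_pmf e0 \<subseteq> F"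
  shows "\<exists>e. set_pmf e \<subseteq> F \<and> (\<forall>x. sum g F * pmf e x = g x)"
proof (cases "sum g F = 0")
  case True
  then have "g x = 0" for x using F g by (cases "x \<in> F") (auto simp: sum_nonneg_eq_0_iff)
  then show ?thesis using e0 True by auto
next
  case False
  have pos: "sum g F > 0" using False g by (simp add: order_less_le sum_nonneg)
  have "(\<integral>\<^sup>+x. ennreal (g x / sum g F) \<partial>count_space UNIV) = (\<Sum>x\<in>F. ennreal (g x / sum g F))"
    using g pos by (intro nn_integral_count_space'[OF F]) (auto simp: )
  also have "\<dots> = ennreal (\<Sum>x\<in>F. g x / sum g F)" using g pos by (intro sum_ennreal) auto
  also have "(\<Sum>x\<in>F. g x / sum g F) = 1" using pos by (simp add: sum_divide_distrib[symmetric])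
  finally have *: "pmf (embed_pmf (\<lambda>x. g x / sum g F)) x = g x / sum g F" for x
    using g pos by (intro pmf_embed_pmf) auto
  have "set_pmf (embed_pmf (\<lambda>x. g x / sum g F)) \<subseteq> F"
    using * g(2) by (fastforce simp: set_pmf_iff)
  then show ?thesis
    using * pos by (intro exI[of _ "embed_pmf (\<lambda>x. g x / sum g F)"]) auto
qed

text \<open>A regular conditional law of the second component. At values of probability zero, where
  conditioning is meaningless, it is set to the unconditional marginal, so it is finitely supported
  whenever \<open>r\<close> is.\<close>

definition disint :: "('a \<times> 'b) pmf \<Rightarrow> 'a \<Rightarrow> 'b pmf" where
  "disint r a = map_pmf snd (if a \<in> fst ` set_pmf r then cond_pmf r (fst -` {a}) else r)"

lemma bind_disint: "bind_pmf (map_pmf fst r) (\<lambda>a. map_pmf (Pair a) (disint r a)) = r"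
proof (rule pmf_eqI)
  fix s :: "'a \<times> 'b"
  obtain a b where s: "s = (a, b)" by (cases s)
  have L: "pmf (bind_pmf (map_pmf fst r) (\<lambda>a. map_pmf (Pair a) (disint r a))) s
      = pmf (map_pmf fst r) a * pmf (disint r a) b"
    unfolding s by (subst pmf_bind_tagged[where h = fst]) (auto simp: pmf_map_inj' inj_on_def)
  show "pmf (bind_pmf (map_pmf fst r) (\<lambda>a. map_pmf (Pair a) (disint r a))) s = pmf r s"
  proof (cases "a \<in> fst ` set_pmf r")
    case True
    then have ne: "set_pmf r \<inter> fst -` {a} \<noteq> {}" by auto
    have "pmf (disint r a) b = measure_pmf.prob (cond_pmf r (fst -` {a})) (snd -` {b})"
      using True by (simp add: disint_def pmf_map)
    also have "\<dots> = measure_pmf.prob (cond_pmf r (fst -` {a})) {(a, b)}"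
      using ne by (intro measure_pmf.finite_measure_eq_AE) (auto simp: AE_measure_pmf_iff set_cond_pmf)
    also have "\<dots> = pmf r (a, b) / measure_pmf.prob r (fst -` {a})"
      using ne by (simp add: measure_pmf_single pmf_cond)
    finally have "pmf (disint r a) b = pmf r (a, b) / pmf (map_pmf fst r) a" by (simp add: pmf_map)
    moreover have "pmf (map_pmf fst r) a \<noteq> 0" using True by (simp add: pmf_eq_0_set_pmf)
    ultimately show ?thesis unfolding L by (simp add: s)
  next
    case False
    then have "pmf (map_pmf fst r) a = 0" by (simp add: pmf_eq_0_set_pmf)
    moreover have "pmf r (a, b) = 0" using False by (force simp: pmf_eq_0_set_pmf)
    ultimately show ?thesis unfolding L by (simp add: s)
  qed
qed

lemma finite_disint:
  assumes "finite (set_pmf r)"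
  shows "finite (set_pmf (disint r a))"
proof (cases "a \<in> fst ` set_pmf r")
  case True
  then have "set_pmf r \<inter> fst -` {a} \<noteq> {}" by auto
  then show ?thesis using True assms by (simp add: disint_def set_cond_pmf)
qed (use assms in \<open>simp add: disint_def\<close>)

section \<open>How weights pass through channels\<close>

context superposition begin

text \<open>The denominator of \<open>phi\<close> does not contain \<open>t\<close>, so a channel
  acting on \<open>t\<close> acts linearly on the weights. The channel may depend on the codeword,
  as the output maps of the receivers do.\<close>

lemma sum_phi_kernel:
  fixes J :: "('w \<times> 'u \<times> 'v \<times> 't) pmf" and k :: "'w \<Rightarrow> 'u \<Rightarrow> 'v \<Rightarrow> 't \<Rightarrow> 's pmf"
  assumes J': "J' = bind_pmf J (\<lambda>(w, u, v, t). map_pmf (\<lambda>s. (w, u, v, s)) (k w u v t))"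
    and F: "finite F" "\<And>w u v t. (w, u, v, t) \<in> set_pmf J \<Longrightarrow> t \<in> F"
    and F': "finite F'" "\<And>w u v s. (w, u, v, s) \<in> set_pmf J' \<Longrightarrow> s \<in> F'"
  shows "(\<Sum>t\<in>F. phi J t w u v * expect (k w u v t) h) = (\<Sum>s\<in>F'. phi J' s w u v * h s)"
proof -
  have J's: "pmf J' (w, u, v, s) = (\<Sum>t\<in>F. pmf J (w, u, v, t) * pmf (k w u v t) s)" for s
  proof -
    have *: "pmf (map_pmf (\<lambda>s. (w', u', v', s)) (k w' u' v' t)) (w, u, v, s)
      = (if w' = w \<and> u' = u \<and> v' = v then pmf (k w u v t) s else 0)" for w' u' v' t
      using pmf_map_inj'[of "\<lambda>s. (w, u, v, s)" "k w u v t" s] by (auto simp: inj_on_def pmf_eq_0_set_pmf)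
    have "pmf J' (w, u, v, s) = expect J (\<lambda>(w', u', v', t). pmf (map_pmf (\<lambda>s. (w', u', v', s)) (k w' u' v' t)) (w, u, v, s))"
      unfolding J' pmf_bind by (simp add: case_prod_unfold)
    also have "\<dots> = (\<Sum>a\<in>(\<lambda>t. (w, u, v, t)) ` F. pmf J a * (case a of (w', u', v', t) \<Rightarrow> pmf (map_pmf (\<lambda>s. (w', u', v', s)) (k w' u' v' t)) (w, u, v, s)))"
      by (subst integral_measure_pmf[of "(\<lambda>t. (w, u, v, t)) ` F"]) (use F in \<open>auto simp: * split: if_splits\<close>)
    also have "\<dots> = (\<Sum>t\<in>F. pmf J (w, u, v, t) * pmf (k w u v t) s)"
      by (subst sum.reindex) (auto simp: inj_on_def *)
    finally show ?thesis .
  qed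
  have "(\<Sum>t\<in>F. pmf J (w, u, v, t) * expect (k w u v t) h) = (\<Sum>t\<in>F. \<Sum>s\<in>F'. pmf J (w, u, v, t) * pmf (k w u v t) s * h s)"
  proof (intro sum.cong refl)
    fix t assume "t \<in> F"
    show "pmf J (w, u, v, t) * expect (k w u v t) h = (\<Sum>s\<in>F'. pmf J (w, u, v, t) * pmf (k w u v t) s * h s)"
    proof (cases "(w, u, v, t) \<in> set_pmf J")
      case True
      have "set_pmf (k w u v t) \<subseteq> F'"
      proof
        fix s assume "s \<in> set_pmf (k w u v t)"
        then have "(w, u, v, s) \<in> set_pmf J'" using True by (force simp: J')
        then show "s \<in> F'" by (rule F')
      qed
      then have "expect (k w u v t) h = (\<Sum>s\<in>F'. pmf (k w u v t) s * h s)"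
        by (subst integral_measure_pmf[OF F'(1)]) auto
      then show ?thesis by (simp add: sum_distrib_left mult_ac)
    qed (simp add: set_pmf_iff)
  qed
  also have "\<dots> = (\<Sum>s\<in>F'. pmf J' (w, u, v, s) * h s)"
    by (subst sum.swap) (simp add: J's sum_distrib_right)
  finally have "(\<Sum>t\<in>F. pmf J (w, u, v, t) * expect (k w u v t) h) = (\<Sum>s\<in>F'. pmf J' (w, u, v, s) * h s)" .
  then show ?thesis
    by (simp add: phi_def sum_divide_distrib[symmetric] times_divide_eq_left)
qed

lemma sum_phi_map:
  fixes J :: "('w \<times> 'u \<times> 'v \<times> 't) pmf"
  assumes F: "finite F" "\<And>w u v t. (w, u, v, t) \<in> set_pmf J \<Longrightarrow> t \<in> F"
    and F': "finite F'" "\<And>w u v t. (w, u, v, t) \<in> set_pmf J \<Longrightarrow> f t \<in> F'"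
  shows "(\<Sum>t\<in>F. phi J t w u v * h (f t)) = (\<Sum>s\<in>F'. phi (map_pmf (\<lambda>(w, u, v, t). (w, u, v, f t)) J) s w u v * h s)"
  using sum_phi_kernel[of "map_pmf (\<lambda>(w, u, v, t). (w, u, v, f t)) J" J "\<lambda>w u v t. return_pmf (f t)" F F' w u v h] F F'
  by (force simp: map_pmf_def case_prod_unfold bind_return_pmf)

end

text \<open>The last inequality is multiplied by the mass of \<open>w\<close>, so that no conditional laws are needed.\<close>

definition covering_typical where
  "covering_typical \<beta>0 \<beta>1 \<beta>2 \<beta>3 J w u v t \<longleftrightarrow>
     pmf (marg_wt J) (w, t)
       \<le> \<beta>0 * (pmf (marg_w J) w * pmf (marg_t J) t)
   \<and> pmf (marg_wut J) (w, u, t)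
       \<le> \<beta>1 * (pmf (marg_wu J) (w, u) * pmf (marg_t J) t)
   \<and> pmf (marg_wvt J) (w, v, t)
       \<le> \<beta>2 * (pmf (marg_wv J) (w, v) * pmf (marg_t J) t)
   \<and> pmf J (w, u, v, t) * pmf (marg_w J) w
       \<le> \<beta>3 * (pmf (marg_wu J) (w, u)
           * pmf (marg_wv J) (w, v) * pmf (marg_t J) t)"

text \<open>Lower bounds, with thresholds \<open>\<gamma>0\<close> and \<open>\<gamma>1\<close>, on
  the information density between (w, u) and t and on the one between u and t given w, cleared of
  denominators. The middle component may be the satellite of either receiver.\<close>

definition decodable where
  "decodable \<gamma>0 \<gamma>1 J w u t \<longleftrightarrow>
     \<gamma>0 * (pmf (map_pmf (\<lambda>(w, u, t). (w, u)) J) (w, u) * pmf (map_pmf (\<lambda>(w, u, t). t) J) t) \<le> pmf J (w, u, t)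
   \<and> \<gamma>1 * (pmf (map_pmf (\<lambda>(w, u, t). (w, u)) J) (w, u) * pmf (map_pmf (\<lambda>(w, u, t). (w, t)) J) (w, t))
       \<le> pmf J (w, u, t) * pmf (map_pmf (\<lambda>(w, u, t). w) J) w"

context superposition begin

lemma joint_fst:
  assumes "joint J"
  shows "marg_w J = pw"
proof -
  have "marg_w J = map_pmf fst (marg_wu J)"
    by (simp add: map_pmf_comp case_prod_unfold)
  also have "\<dots> = pw" using assms unfolding joint_def
    by (simp add: map_bind_pmf map_pmf_comp bind_return_pmf' map_pmf_const)
  finally show ?thesis .
qed

lemma soft_covering_typical:
  fixes J :: "('w \<times> 'u \<times> 'v \<times> 't) pmf"
  assumes J: "joint J" and I: "finite I" "I' \<subseteq> I" "I' \<noteq> {}"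
    and F: "finite F" "\<And>w u v t. (w, u, v, t) \<in> set_pmf J \<Longrightarrow> t \<in> F"
    and \<beta>: "\<beta>0 \<ge> 0" "\<beta>1 \<ge> 0" "\<beta>2 \<ge> 0" "\<beta>3 \<ge> 0"
  shows "expect (codebook I) (\<lambda>c. \<Sum>t\<in>F. \<bar>(\<Sum>i\<in>I'. word_avg (phi J t) (c i)) / card I'
      - pmf (marg_t J) t\<bar>)
    \<le> 2 * measure_pmf.prob J {(w, u, v, t). \<not> covering_typical \<beta>0 \<beta>1 \<beta>2 \<beta>3 J w u v t}
      + sqrt ((\<beta>0 + \<beta>1 / M1 + \<beta>2 / M2 + \<beta>3 / (real M1 * real M2)) / card I')"
proof -
  let ?T = "covering_typical \<beta>0 \<beta>1 \<beta>2 \<beta>3 J"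
  let ?p = "pmf (marg_t J)"
  let ?s = "sqrt ((\<beta>0 + \<beta>1 / M1 + \<beta>2 / M2 + \<beta>3 / (real M1 * real M2)) / card I')"
  have "expect (codebook I) (\<lambda>c. \<bar>(\<Sum>i\<in>I'. word_avg (phi J t) (c i)) / card I' - ?p t\<bar>)
    \<le> ?p t * ?s + 2 * expect3 (\<lambda>w u v. phi J t w u v * of_bool (\<not> ?T w u v t))" for t
  proof (rule soft_covering_pointwise[OF J I \<beta>])
    fix w u v assume T: "?T w u v t"
    note T' = T[unfolded covering_typical_def pmf_joint[OF J] joint_fst[OF J]]
    \<comment> \<open>The typicality condition carries an extra factor p(w). It cancels on the
      support of W; elsewhere \<open>J\<close> has no mass.\<close>
    show "pmf J (w, u, v, t) \<le> \<beta>3 * (pmf pw w * pmf (pu w) u * pmf (pv w) v * ?p t)"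
    proof (cases "w \<in> set_pmf pw")
      case True
      then have "pmf pw w > 0" by (simp add: pmf_positive)
      moreover have "pmf pw w * pmf J (w, u, v, t)
        \<le> pmf pw w * (\<beta>3 * (pmf pw w * pmf (pu w) u * pmf (pv w) v * ?p t))"
        using T' by (simp add: mult_ac)
      ultimately show ?thesis by (simp only: mult_le_cancel_left_pos)
    next
      case False
      then have "(w, u, v, t) \<notin> set_pmf J" using joint_fst[OF J] by force
      then show ?thesis using \<beta> by (simp add: set_pmf_iff)
    qed
  qed (auto simp: covering_typical_def pmf_joint[OF J] joint_fst[OF J])
  then have "expect (codebook I) (\<lambda>c. \<Sum>t\<in>F. \<bar>(\<Sum>i\<in>I'. word_avg (phi J t) (c i)) / card I' - ?p t\<bar>)
    \<le> (\<Sum>t\<in>F. ?p t * ?s + 2 * expect3 (\<lambda>w u v. phi J t w u v * of_bool (\<not> ?T w u v t)))"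
    unfolding expect_sum[OF finite_codebook[OF I(1)]] by (intro sum_mono)
  also have "\<dots> = (\<Sum>t\<in>F. ?p t) * ?s + 2 * (\<Sum>t\<in>F. expect3 (\<lambda>w u v. phi J t w u v * of_bool (\<not> ?T w u v t)))"
    by (simp add: sum.distrib sum_distrib_left sum_distrib_right)
  also have "(\<Sum>t\<in>F. ?p t) = 1"
    using F by (intro sum_pmf_eq_1) auto
  also have "(\<Sum>t\<in>F. expect3 (\<lambda>w u v. phi J t w u v * of_bool (\<not> ?T w u v t)))
    = expect J (\<lambda>(w, u, v, t). of_bool (\<not> ?T w u v t))"
    using sum_expect3_phi[OF J F, where h = "\<lambda>w u v t. of_bool (\<not> ?T w u v t)"] by simp
  also have "\<dots> = expect J (indicator {(w, u, v, t). \<not> ?T w u v t})"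
    by (intro expect_cong) (auto simp: indicator_def)
  also have "\<dots> = measure_pmf.prob J {(w, u, v, t). \<not> ?T w u v t}" by simp
  finally show ?thesis by simp
qed

lemma packing_decodable_u:
  fixes J :: "('w \<times> 'u \<times> 'v \<times> 't) pmf"
  assumes J: "joint J" and F: "finite F" "\<And>w u v t. (w, u, v, t) \<in> set_pmf J \<Longrightarrow> t \<in> F"
    and I: "finite I" "I' \<subseteq> I" "i \<in> I'" and ab: "a < M1" "b < M2" and \<gamma>: "\<gamma>0 > 0" "\<gamma>1 > 0"
  defines "J' \<equiv> marg_wut J"
  shows "expect (codebook I) (\<lambda>c. \<Sum>t\<in>F. word (c i) a b (phi J t)
      * of_bool (\<not> word (c i) a b (\<lambda>w u v. decodable \<gamma>0 \<gamma>1 J' w u t) \<or> confusable_u (decodable \<gamma>0 \<gamma>1 J') I' c i a t))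
    \<le> measure_pmf.prob J' {(w, u, t). \<not> decodable \<gamma>0 \<gamma>1 J' w u t} + card I' * M1 / \<gamma>0 + (M1 - 1) / \<gamma>1"
proof -
  have maps: "map_pmf (\<lambda>(w, u, t). (w, u)) J' = marg_wu J"
    "map_pmf (\<lambda>(w, u, t). (w, t)) J' = marg_wt J"
    "map_pmf (\<lambda>(w, u, t). t) J' = marg_t J"
    "map_pmf (\<lambda>(w, u, t). w) J' = marg_w J"
    by (simp_all add: J'_def map_pmf_comp case_prod_unfold)
  have "measure_pmf.prob J' B = measure_pmf.prob J ((\<lambda>(w, u, v, t). (w, u, t)) -` B)" for B
    unfolding J'_def by (rule measure_map_pmf)
  moreover have "measure_pmf.prob J ((\<lambda>(w, u, v, t). (w, u, t)) -` {(w, u, t). \<not> decodable \<gamma>0 \<gamma>1 J' w u t})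
      = measure_pmf.prob J {(w, u, v, t). \<not> decodable \<gamma>0 \<gamma>1 J' w u t}"
    by (rule arg_cong[where f = "measure_pmf.prob J"]) auto
  ultimately have pr: "measure_pmf.prob J' {(w, u, t). \<not> decodable \<gamma>0 \<gamma>1 J' w u t}
      = measure_pmf.prob J {(w, u, v, t). \<not> decodable \<gamma>0 \<gamma>1 J' w u t}"
    by (simp only:)
  show ?thesis unfolding pr
    by (rule packing_u[OF J F I ab \<gamma>])
       (unfold decodable_def maps pmf_joint[OF J] joint_fst[OF J] J'_def[symmetric], blast+)
qed

lemma packing_decodable_v:
  fixes J :: "('w \<times> 'u \<times> 'v \<times> 't) pmf"
  assumes J: "joint J" and F: "finite F" "\<And>w u v t. (w, u, v, t) \<in> set_pmf J \<Longrightarrow> t \<in> F"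
    and I: "finite I" "I' \<subseteq> I" "i \<in> I'" and ab: "a < M1" "b < M2" and \<gamma>: "\<gamma>0 > 0" "\<gamma>1 > 0"
  defines "J' \<equiv> marg_wvt J"
  shows "expect (codebook I) (\<lambda>c. \<Sum>t\<in>F. word (c i) a b (phi J t)
      * of_bool (\<not> word (c i) a b (\<lambda>w u v. decodable \<gamma>0 \<gamma>1 J' w v t) \<or> confusable_v (decodable \<gamma>0 \<gamma>1 J') I' c i b t))
    \<le> measure_pmf.prob J' {(w, v, t). \<not> decodable \<gamma>0 \<gamma>1 J' w v t} + card I' * M2 / \<gamma>0 + (M2 - 1) / \<gamma>1"
proof -
  have maps: "map_pmf (\<lambda>(w, u, t). (w, u)) J' = marg_wv J"
    "map_pmf (\<lambda>(w, u, t). (w, t)) J' = marg_wt J"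
    "map_pmf (\<lambda>(w, u, t). t) J' = marg_t J"
    "map_pmf (\<lambda>(w, u, t). w) J' = marg_w J"
    by (simp_all add: J'_def map_pmf_comp case_prod_unfold)
  have "measure_pmf.prob J' B = measure_pmf.prob J ((\<lambda>(w, u, v, t). (w, v, t)) -` B)" for B
    unfolding J'_def by (rule measure_map_pmf)
  moreover have "measure_pmf.prob J ((\<lambda>(w, u, v, t). (w, v, t)) -` {(w, v, t). \<not> decodable \<gamma>0 \<gamma>1 J' w v t})
      = measure_pmf.prob J {(w, u, v, t). \<not> decodable \<gamma>0 \<gamma>1 J' w v t}"
    by (rule arg_cong[where f = "measure_pmf.prob J"]) auto
  ultimately have pr: "measure_pmf.prob J' {(w, v, t). \<not> decodable \<gamma>0 \<gamma>1 J' w v t}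
      = measure_pmf.prob J {(w, u, v, t). \<not> decodable \<gamma>0 \<gamma>1 J' w v t}"
    by (simp only:)
  show ?thesis unfolding pr
    by (rule packing_v[OF J F I ab \<gamma>])
       (unfold decodable_def maps pmf_joint[OF J] joint_fst[OF J] J'_def[symmetric], blast+)
qed

end

section \<open>One-shot simulation\<close>

lemma bind_disint_map:
  "bind_pmf (map_pmf f p) (\<lambda>a. map_pmf (Pair a) (disint (map_pmf (\<lambda>s. (f s, g s)) p) a)) = map_pmf (\<lambda>s. (f s, g s)) p"
  using bind_disint[of "map_pmf (\<lambda>s. (f s, g s)) p"] by (simp add: map_pmf_comp)

lemma abs_expect_le:
  assumes "finite (set_pmf p)" "\<And>a. a \<in> set_pmf p \<Longrightarrow> \<bar>f a\<bar> \<le> B"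
  shows "\<bar>expect p f\<bar> \<le> B"
proof -
  have "expect p f \<le> expect p (\<lambda>_. B)" "expect p (\<lambda>_. - B) \<le> expect p f"
    using assms by (intro expect_mono; force simp: abs_le_iff)+
  then show ?thesis by auto
qed

lemma expect_nested_average:
  assumes "finite (set_pmf p)"
  shows "expect p (\<lambda>c. a c + b c + (\<Sum>i\<in>I. (\<Sum>q\<in>Q. G i q c) / N) / k)
    = expect p a + expect p b + (\<Sum>i\<in>I. (\<Sum>q\<in>Q. expect p (G i q)) / N) / k"
  by (simp add: expect_add[OF assms] expect_sum[OF assms])

text \<open>Finiteness is asked of supports rather than types because the letters will be sequences,
  whose type is infinite in general. \<open>SXt\<close> confines the outputs of the encoder, and
  \<open>\<Omega>\<close> is the range of the shared randomness.\<close>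

locale one_shot =
  fixes px :: "'x pmf" and A :: "'x \<Rightarrow> ('u \<times> 'v \<times> 'w \<times> 'xt) pmf"
    and K :: "'xt \<Rightarrow> ('yt \<times> 'zt) pmf"
    and D1 :: "'yt \<Rightarrow> 'u \<Rightarrow> 'w \<Rightarrow> 'y pmf" and D2 :: "'zt \<Rightarrow> 'v \<Rightarrow> 'w \<Rightarrow> 'z pmf"
    and SXt :: "'xt set" and \<Omega> :: "nat set" and M0 M1 M2 :: nat
  assumes finite_px: "finite (set_pmf px)" and finite_A: "finite (set_pmf (A x))"
    and finite_K: "finite (set_pmf (K xt))"
    and finite_D1: "finite (set_pmf (D1 yt u w))" and finite_D2: "finite (set_pmf (D2 zt v w))"
    and finite_SXt: "finite SXt" and A_SXt: "(u, v, w, xt) \<in> set_pmf (A x) \<Longrightarrow> xt \<in> SXt"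
    and \<Omega>: "finite \<Omega>" "\<Omega> \<noteq> {}" and M_pos: "M0 > 0" "M1 > 0" "M2 > 0"
begin

abbreviation "P \<equiv> auxiliary_joint px A K D1 D2"

definition law :: "('x \<Rightarrow> 'xt \<Rightarrow> 'yt \<Rightarrow> 'zt \<Rightarrow> 'y \<Rightarrow> 'z \<Rightarrow> 't) \<Rightarrow> ('w \<times> 'u \<times> 'v \<times> 't) pmf" where
  "law f = map_pmf (\<lambda>(x, u, v, w, xt, yt, zt, y, z). (w, u, v, f x xt yt zt y z)) P"

definition "pw = map_pmf (\<lambda>(x, u, v, w, xt, yt, zt, y, z). w) P"
definition "pu = disint (map_pmf (\<lambda>(x, u, v, w, xt, yt, zt, y, z). (w, u)) P)"
definition "pv = disint (map_pmf (\<lambda>(x, u, v, w, xt, yt, zt, y, z). (w, v)) P)"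

lemma finite_P: "finite (set_pmf P)"
  by (auto simp: auxiliary_joint_def finite_px finite_A finite_K finite_D1 finite_D2)

sublocale superposition pw pu pv M1 M2
  using finite_P M_pos by unfold_locales (auto simp: pw_def pu_def pv_def intro!: finite_disint)

lemma joint_law: "joint (law f)"
  using finite_P
    bind_disint_map[where f = "\<lambda>(x, u, v, w, xt, yt, zt, y, z). w" and g = "\<lambda>(x, u, v, w, xt, yt, zt, y, z). u" and p = P]
    bind_disint_map[where f = "\<lambda>(x, u, v, w, xt, yt, zt, y, z). w" and g = "\<lambda>(x, u, v, w, xt, yt, zt, y, z). v" and p = P]
  unfolding joint_def by (auto simp: law_def pw_def pu_def pv_def map_pmf_comp case_prod_unfold)

text \<open>The outputs at which weights are needed: the pair produced by the encoder, the source
  for its normalisation, the target triple, and what each receiver observes.\<close>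

abbreviation "JE \<equiv> law (\<lambda>x xt yt zt y z. (x, xt))"
abbreviation "JX \<equiv> law (\<lambda>x xt yt zt y z. x)"
abbreviation "JT \<equiv> law (\<lambda>x xt yt zt y z. (x, y, z))"
abbreviation "JY \<equiv> law (\<lambda>x xt yt zt y z. yt)"
abbreviation "JZ \<equiv> law (\<lambda>x xt yt zt y z. zt)"

definition outs :: "('w \<times> 'u \<times> 'v \<times> 't) pmf \<Rightarrow> 't set" where
  "outs J = (\<lambda>(w, u, v, t). t) ` set_pmf J"

lemma outsI: "(w, u, v, t) \<in> set_pmf J \<Longrightarrow> t \<in> outs J"
  by (force simp: outs_def)

lemma finite_outs: "finite (outs (law f))"
  using joint_law by (auto simp: outs_def joint_def)

lemma JE_eq: "JE = bind_pmf px (\<lambda>x. map_pmf (\<lambda>(u, v, w, xt). (w, u, v, x, xt)) (A x))"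
  by (simp add: law_def auxiliary_joint_def map_bind_pmf case_prod_unfold bind_pmf_const map_pmf_def bind_assoc_pmf bind_return_pmf)

lemma JX_eq: "JX = map_pmf (\<lambda>(w, u, v, t). (w, u, v, fst t)) JE"
  by (simp add: law_def map_pmf_comp case_prod_unfold)

text \<open>Here the factorisation of the joint law enters: given (w, u, v, x, xt), the rest is
  produced by the broadcast channel and the output maps, so \<open>sum_phi_kernel\<close>
  applies.\<close>

lemma JT_eq: "JT = bind_pmf JE (\<lambda>(w, u, v, t). map_pmf (\<lambda>s. (w, u, v, s)) (do {
    (yt, zt) \<leftarrow> K (snd t); y \<leftarrow> D1 yt u w; z \<leftarrow> D2 zt v w; return_pmf (fst t, y, z) }))"
  unfolding JE_eq
  by (simp add: law_def auxiliary_joint_def map_bind_pmf case_prod_unfold map_pmf_def bind_assoc_pmf bind_return_pmf)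

lemma JY_eq: "JY = bind_pmf JE (\<lambda>(w, u, v, t). map_pmf (\<lambda>s. (w, u, v, s)) (map_pmf fst (K (snd t))))"
  unfolding JE_eq
  by (simp add: law_def auxiliary_joint_def map_bind_pmf case_prod_unfold map_pmf_def bind_assoc_pmf bind_return_pmf bind_pmf_const)

lemma JZ_eq: "JZ = bind_pmf JE (\<lambda>(w, u, v, t). map_pmf (\<lambda>s. (w, u, v, s)) (map_pmf snd (K (snd t))))"
  unfolding JE_eq
  by (simp add: law_def auxiliary_joint_def map_bind_pmf case_prod_unfold map_pmf_def bind_assoc_pmf bind_return_pmf bind_pmf_const)

lemma JE_outs: "(w, u, v, t) \<in> set_pmf JE \<Longrightarrow> t \<in> set_pmf px \<times> SXt"
  using A_SXt unfolding JE_eq by fastforce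

lemma map_JX: "marg_t JX = px"
  unfolding JX_eq JE_eq by (simp add: map_bind_pmf map_pmf_comp case_prod_unfold map_pmf_const bind_return_pmf')

section \<open>Codebook averages, decoders and their errors\<close>

definition mean :: "('i \<Rightarrow> 'w \<times> (nat \<Rightarrow> 'u) \<times> (nat \<Rightarrow> 'v)) \<Rightarrow> 'i set \<Rightarrow> ('w \<Rightarrow> 'u \<Rightarrow> 'v \<Rightarrow> real) \<Rightarrow> real" where
  "mean c I' h = (\<Sum>i\<in>I'. word_avg h (c i)) / card I'"

lemma mean_sum: "mean c I' (\<lambda>w u v. \<Sum>t\<in>F. h t w u v) = (\<Sum>t\<in>F. mean c I' (h t))"
proof -
  have "word_avg (\<lambda>w u v. \<Sum>t\<in>F. h t w u v) C = (\<Sum>t\<in>F. word_avg (h t) C)" for C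
    unfolding word_avg_def word_def case_prod_unfold sum_divide_distrib[symmetric] by (subst sum.swap) simp
  then show ?thesis unfolding mean_def sum_divide_distrib[symmetric] by (subst sum.swap) simp
qed

lemma mean_scale: "mean c I' (\<lambda>w u v. h w u v * (k::real)) = mean c I' h * k"
  by (simp add: mean_def word_avg_def word_def case_prod_unfold sum_distrib_right[symmetric] sum_divide_distrib[symmetric])

lemma mean_nonneg: "(\<And>w u v. h w u v \<ge> 0) \<Longrightarrow> mean c I' h \<ge> 0"
  unfolding mean_def by (intro divide_nonneg_nonneg sum_nonneg word_avg_nonneg) auto

text \<open>If no codeword is good, \<open>SOME\<close> yields an arbitrary pair; this is counted as an error and is harmless,
  because \<open>D1\<close> is total.\<close>

definition dec1 :: "('w \<Rightarrow> 'u \<Rightarrow> 'yt \<Rightarrow> bool) \<Rightarrow> (nat \<times> nat \<Rightarrow> 'w \<times> (nat \<Rightarrow> 'u) \<times> (nat \<Rightarrow> 'v)) \<Rightarrow> 'yt \<Rightarrow> nat \<Rightarrow> 'y pmf" where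
  "dec1 good c yt \<omega> = (let p = SOME p. fst p < M0 \<and> snd p < M1 \<and>
        good (fst (c (\<omega>, fst p))) (fst (snd (c (\<omega>, fst p))) (snd p)) yt
     in D1 yt (fst (snd (c (\<omega>, fst p))) (snd p)) (fst (c (\<omega>, fst p))))"

definition dec2 :: "('w \<Rightarrow> 'v \<Rightarrow> 'zt \<Rightarrow> bool) \<Rightarrow> (nat \<times> nat \<Rightarrow> 'w \<times> (nat \<Rightarrow> 'u) \<times> (nat \<Rightarrow> 'v)) \<Rightarrow> 'zt \<Rightarrow> nat \<Rightarrow> 'z pmf" where
  "dec2 good c zt \<omega> = (let p = SOME p. fst p < M0 \<and> snd p < M2 \<and>
        good (fst (c (\<omega>, fst p))) (snd (snd (c (\<omega>, fst p))) (snd p)) zt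
     in D2 zt (snd (snd (c (\<omega>, fst p))) (snd p)) (fst (c (\<omega>, fst p))))"

text \<open>Both receivers know \<omega>, so only codewords with the same \<omega> compete in
  decoding.\<close>

abbreviation row :: "nat \<Rightarrow> (nat \<times> nat) set" where "row \<omega> \<equiv> {\<omega>} \<times> {..<M0}"

definition err1 where
  "err1 good c i a yt \<longleftrightarrow> \<not> good (fst (c i)) (fst (snd (c i)) a) yt \<or> confusable_u good (row (fst i)) c i a yt"

definition err2 where
  "err2 good c i b zt \<longleftrightarrow> \<not> good (fst (c i)) (snd (snd (c i)) b) zt \<or> confusable_v good (row (fst i)) c i b zt"

text \<open>Without an error the true pair passes the test and no other pair with the same \<omega>
  does, so \<open>SOME\<close> has no choice.\<close>

lemma dec1_correct:
  assumes "\<not> err1 good c i a yt" "snd i < M0" "a < M1"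
  shows "dec1 good c yt (fst i) = D1 yt (fst (snd (c i)) a) (fst (c i))"
proof -
  have "(SOME p. fst p < M0 \<and> snd p < M1 \<and>
      good (fst (c (fst i, fst p))) (fst (snd (c (fst i, fst p))) (snd p)) yt) = (snd i, a)"
  proof (rule some_equality)
    show "fst (snd i, a) < M0 \<and> snd (snd i, a) < M1 \<and>
      good (fst (c (fst i, fst (snd i, a)))) (fst (snd (c (fst i, fst (snd i, a)))) (snd (snd i, a))) yt"
      using assms by (simp add: err1_def)
  next
    fix p
    assume p: "fst p < M0 \<and> snd p < M1 \<and> good (fst (c (fst i, fst p))) (fst (snd (c (fst i, fst p))) (snd p)) yt"
    have "((fst i, fst p), snd p) = (i, a)"
      using assms(1) p unfolding err1_def confusable_u_def by (metis SigmaI lessThan_iff singletonI)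
    then show "p = (snd i, a)" by (auto simp: prod_eq_iff)
  qed
  then show ?thesis by (simp add: dec1_def)
qed

lemma dec2_correct:
  assumes "\<not> err2 good c i b zt" "snd i < M0" "b < M2"
  shows "dec2 good c zt (fst i) = D2 zt (snd (snd (c i)) b) (fst (c i))"
proof -
  have "(SOME p. fst p < M0 \<and> snd p < M2 \<and>
      good (fst (c (fst i, fst p))) (snd (snd (c (fst i, fst p))) (snd p)) zt) = (snd i, b)"
  proof (rule some_equality)
    show "fst (snd i, b) < M0 \<and> snd (snd i, b) < M2 \<and>
      good (fst (c (fst i, fst (snd i, b)))) (snd (snd (c (fst i, fst (snd i, b)))) (snd (snd i, b))) zt"
      using assms by (simp add: err2_def)
  next
    fix p
    assume p: "fst p < M0 \<and> snd p < M2 \<and> good (fst (c (fst i, fst p))) (snd (snd (c (fst i, fst p))) (snd p)) zt"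
    have "((fst i, fst p), snd p) = (i, b)"
      using assms(1) p unfolding err2_def confusable_v_def by (metis SigmaI lessThan_iff singletonI)
    then show "p = (snd i, b)" by (auto simp: prod_eq_iff)
  qed
  then show ?thesis by (simp add: dec2_def)
qed

lemma finite_dec1: "finite (set_pmf (dec1 good c yt \<omega>))"
  by (simp add: dec1_def Let_def finite_D1)

lemma finite_dec2: "finite (set_pmf (dec2 good c zt \<omega>))"
  by (simp add: dec2_def Let_def finite_D2)

text \<open>Replacing the decoded words by the true ones changes the expectation of a test function
  bounded by 1 by at most 2, and not at all unless a receiver errs. With the true words in place,
  the channels carry the weight of (x, xt) to those of (x, y, z), yt and zt.\<close>

lemma word_error_bound:
  fixes f :: "'x \<times> 'y \<times> 'z \<Rightarrow> real"
  assumes f: "\<And>s. \<bar>f s\<bar> \<le> 1" and i: "snd i < M0" and ab: "a < M1" "b < M2"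
  shows "word (c i) a b (\<lambda>w u v. \<Sum>t\<in>set_pmf px \<times> SXt. phi JE t w u v *
      expect (K (snd t)) (\<lambda>(yt, zt). expect (dec1 g1 c yt (fst i)) (\<lambda>y. expect (dec2 g2 c zt (fst i)) (\<lambda>z. f (fst t, y, z)))))
    \<le> word (c i) a b (\<lambda>w u v. \<Sum>s\<in>outs JT. phi JT s w u v * f s)
      + 2 * ((\<Sum>y\<in>outs JY. word (c i) a b (phi JY y) * of_bool (err1 g1 c i a y))
           + (\<Sum>z\<in>outs JZ. word (c i) a b (phi JZ z) * of_bool (err2 g2 c i b z)))"
proof -
  define w where "w = fst (c i)"
  define u where "u = fst (snd (c i)) a"
  define v where "v = snd (snd (c i)) b"
  let ?F = "set_pmf px \<times> SXt"
  have F: "finite ?F" "\<And>w u v t. (w, u, v, t) \<in> set_pmf JE \<Longrightarrow> t \<in> ?F"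
    using finite_px finite_SXt JE_outs by auto
  have out: "finite (outs JT)" "\<And>w u v t. (w, u, v, t) \<in> set_pmf JT \<Longrightarrow> t \<in> outs JT"
    "finite (outs JY)" "\<And>w u v t. (w, u, v, t) \<in> set_pmf JY \<Longrightarrow> t \<in> outs JY"
    "finite (outs JZ)" "\<And>w u v t. (w, u, v, t) \<in> set_pmf JZ \<Longrightarrow> t \<in> outs JZ"
    by (auto intro: finite_outs outsI)
  note fins = finite_K finite_D1 finite_D2 finite_dec1 finite_dec2
  let ?e1 = "\<lambda>y. of_bool (err1 g1 c i a y) :: real" and ?e2 = "\<lambda>z. of_bool (err2 g2 c i b z) :: real"
  have pt: "expect (K (snd t)) (\<lambda>(yt, zt). expect (dec1 g1 c yt (fst i)) (\<lambda>y. expect (dec2 g2 c zt (fst i)) (\<lambda>z. f (fst t, y, z))))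
    \<le> expect (do { (yt, zt) \<leftarrow> K (snd t); y \<leftarrow> D1 yt u w; z \<leftarrow> D2 zt v w; return_pmf (fst t, y, z) }) f
      + 2 * (expect (map_pmf fst (K (snd t))) ?e1 + expect (map_pmf snd (K (snd t))) ?e2)" for t
  proof -
    have "expect (dec1 g1 c yt (fst i)) (\<lambda>y. expect (dec2 g2 c zt (fst i)) (\<lambda>z. f (fst t, y, z)))
      \<le> expect (D1 yt u w) (\<lambda>y. expect (D2 zt v w) (\<lambda>z. f (fst t, y, z))) + 2 * (?e1 yt + ?e2 zt)" for yt zt
    proof (cases "err1 g1 c i a yt \<or> err2 g2 c i b zt")
      case True
      have "\<bar>expect p (\<lambda>y. expect q (\<lambda>z. f (fst t, y, z)))\<bar> \<le> 1" if "finite (set_pmf p)" "finite (set_pmf q)" for p q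
        using that f by (intro abs_expect_le) auto
      from this[OF finite_dec1[of g1 c yt "fst i"] finite_dec2[of g2 c zt "fst i"]]
        this[OF finite_D1[of yt u w] finite_D2[of zt v w]]
      show ?thesis using True by (auto simp: of_bool_def)
    next
      case False
      then show ?thesis using dec1_correct[of g1 c i a yt] dec2_correct[of g2 c i b zt] i ab
        by (simp add: w_def u_def v_def)
    qed
    then have "expect (K (snd t)) (\<lambda>s. expect (dec1 g1 c (fst s) (fst i)) (\<lambda>y. expect (dec2 g2 c (snd s) (fst i)) (\<lambda>z. f (fst t, y, z))))
      \<le> expect (K (snd t)) (\<lambda>s. expect (D1 (fst s) u w) (\<lambda>y. expect (D2 (snd s) v w) (\<lambda>z. f (fst t, y, z)))
         + 2 * (?e1 (fst s) + ?e2 (snd s)))"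
      by (intro expect_mono finite_K)
    also have "\<dots> = expect (K (snd t)) (\<lambda>s. expect (D1 (fst s) u w) (\<lambda>y. expect (D2 (snd s) v w) (\<lambda>z. f (fst t, y, z))))
        + 2 * (expect (map_pmf fst (K (snd t))) ?e1 + expect (map_pmf snd (K (snd t))) ?e2)"
      by (simp only: expect_add[OF finite_K] integral_mult_right_zero integral_map_pmf)
    finally show ?thesis by (simp add: case_prod_unfold expect_bind fins)
  qed
  have "(\<Sum>t\<in>?F. phi JE t w u v *
      expect (K (snd t)) (\<lambda>(yt, zt). expect (dec1 g1 c yt (fst i)) (\<lambda>y. expect (dec2 g2 c zt (fst i)) (\<lambda>z. f (fst t, y, z)))))
    \<le> (\<Sum>t\<in>?F. phi JE t w u v * (expect (do { (yt, zt) \<leftarrow> K (snd t); y \<leftarrow> D1 yt u w; z \<leftarrow> D2 zt v w; return_pmf (fst t, y, z) }) f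
      + 2 * (expect (map_pmf fst (K (snd t))) ?e1 + expect (map_pmf snd (K (snd t))) ?e2)))"
    by (intro sum_mono mult_left_mono pt phi_nonneg)
  also have "\<dots> = (\<Sum>t\<in>?F. phi JE t w u v * expect (do { (yt, zt) \<leftarrow> K (snd t); y \<leftarrow> D1 yt u w; z \<leftarrow> D2 zt v w; return_pmf (fst t, y, z) }) f)
     + 2 * ((\<Sum>t\<in>?F. phi JE t w u v * expect (map_pmf fst (K (snd t))) ?e1)
        + (\<Sum>t\<in>?F. phi JE t w u v * expect (map_pmf snd (K (snd t))) ?e2))"
    by (simp add: distrib_left sum.distrib sum_distrib_left mult_ac del: integral_map_pmf)
  also have "\<dots> = (\<Sum>s\<in>outs JT. phi JT s w u v * f s) + 2 * ((\<Sum>y\<in>outs JY. phi JY y w u v * ?e1 y) + (\<Sum>z\<in>outs JZ. phi JZ z w u v * ?e2 z))"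
    using sum_phi_kernel[OF JT_eq F out(1,2), where w = w and u = u and v = v and h = f] sum_phi_kernel[OF JY_eq F out(3,4), where w = w and u = u and v = v and h = ?e1]
      sum_phi_kernel[OF JZ_eq F out(5,6), where w = w and u = u and v = v and h = ?e2] by (simp only:)
  finally show ?thesis by (simp add: word_def w_def u_def v_def)
qed

section \<open>Encoder, simulated law and total loss\<close>

definition indices where "indices = \<Omega> \<times> {..<M0}"

lemma indices_props: "finite indices" "\<omega> \<in> \<Omega> \<Longrightarrow> row \<omega> \<subseteq> indices" "row \<omega> \<noteq> {}" "indices \<noteq> {}" "card (row \<omega>) = M0" "card indices = card \<Omega> * M0"
  using \<Omega> M_pos by (auto simp: indices_def card_cartesian_product)

definition sim where
  "sim enc d1 d2 = do { x \<leftarrow> px; \<omega> \<leftarrow> pmf_of_set \<Omega>; xt \<leftarrow> enc x \<omega>; (yt, zt) \<leftarrow> K xt; y \<leftarrow> d1 yt \<omega>; z \<leftarrow> d2 zt \<omega>;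
     return_pmf (x, y, z) }"

text \<open>The product form determines the encoder only where the normalising sum over the codebook is
  nonzero; elsewhere any law on \<open>SXt\<close> is allowed.\<close>

definition encoder_for where
  "encoder_for c enc \<longleftrightarrow> (\<forall>x \<omega>. set_pmf (enc x \<omega>) \<subseteq> SXt \<and>
     (\<forall>xt. mean c (row \<omega>) (phi JX x) * pmf (enc x \<omega>) xt = mean c (row \<omega>) (phi JE (x, xt))))"

lemma encoder_exists: "\<exists>enc. encoder_for c enc"
proof -
  have "\<exists>e. set_pmf e \<subseteq> SXt \<and> (\<forall>xt. mean c (row \<omega>) (phi JX x) * pmf e xt = mean c (row \<omega>) (phi JE (x, xt)))" for x \<omega>
  proof -
    have "\<exists>e. set_pmf e \<subseteq> SXt \<and> (\<forall>xt. (\<Sum>xt\<in>SXt. mean c (row \<omega>) (phi JE (x, xt))) * pmf e xt = mean c (row \<omega>) (phi JE (x, xt)))"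
    proof (rule exists_normalized_pmf[OF finite_SXt])
      show "mean c (row \<omega>) (phi JE (x, xt)) \<ge> 0" for xt by (intro mean_nonneg phi_nonneg)
      fix xt assume "xt \<notin> SXt"
      then have "phi JE (x, xt) = (\<lambda>w u v. 0)"
        using JE_outs by (auto simp: phi_def fun_eq_iff set_pmf_iff)
      then show "mean c (row \<omega>) (phi JE (x, xt)) = 0" by (simp add: mean_def word_avg_def word_def case_prod_unfold)
    next
      \<comment> \<open>The fallback law for a vanishing normalising sum: the \<open>xt\<close>
        marginal of \<open>A x\<close>.\<close>
      show "set_pmf (map_pmf (\<lambda>(u, v, w, xt). xt) (A x)) \<subseteq> SXt" using A_SXt by auto
    qed
    moreover have "(\<Sum>xt\<in>SXt. mean c (row \<omega>) (phi JE (x, xt))) = mean c (row \<omega>) (phi JX x)"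
    proof -
      have "phi JX x w u v = (\<Sum>xt\<in>SXt. phi JE (x, xt) w u v)" for w u v
      proof -
        \<comment> \<open>The encoder must exist also at an \<open>x\<close> of probability zero, so
          \<open>x\<close> is added to the support before its term is singled out.\<close>
        let ?F = "insert x (set_pmf px) \<times> SXt"
        have F: "finite ?F" "\<And>w u v t. (w, u, v, t) \<in> set_pmf JE \<Longrightarrow> t \<in> ?F"
          using finite_px finite_SXt JE_outs by auto
        have "(\<Sum>t\<in>?F. phi JE t w u v * of_bool (fst t = x)) = (\<Sum>s\<in>insert x (set_pmf px). phi JX s w u v * of_bool (s = x))"
          unfolding JX_eq using F finite_px
        proof (intro sum_phi_map[where h = "\<lambda>s. of_bool (s = x)"])
          fix w u v t assume "(w, u, v, t) \<in> set_pmf JE"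
          then show "fst t \<in> insert x (set_pmf px)" using JE_outs[of w u v t] by (cases t) simp
        qed (use F in blast)+
        also have "\<dots> = phi JX x w u v" using finite_px by (simp add: of_bool_def if_distrib[of "\<lambda>x. _ * x"] cong: if_cong)
        also have "(\<Sum>t\<in>?F. phi JE t w u v * of_bool (fst t = x)) = (\<Sum>x'\<in>insert x (set_pmf px). \<Sum>xt\<in>SXt. phi JE (x', xt) w u v * of_bool (x' = x))"
          by (simp only: sum.cartesian_product case_prod_unfold fst_conv snd_conv prod.collapse)
        also have "\<dots> = (\<Sum>x'\<in>insert x (set_pmf px). (\<Sum>xt\<in>SXt. phi JE (x', xt) w u v) * of_bool (x' = x))"
          by (simp only: sum_distrib_right)
        also have "\<dots> = (\<Sum>xt\<in>SXt. phi JE (x, xt) w u v)" using finite_px by (simp add: of_bool_def if_distrib[of "\<lambda>x. _ * x"] cong: if_cong)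
        finally show ?thesis by simp
      qed
      then have "phi JX x = (\<lambda>w u v. \<Sum>xt\<in>SXt. phi JE (x, xt) w u v)" by (simp add: fun_eq_iff)
      then show ?thesis by (simp add: mean_sum)
    qed
    ultimately show ?thesis by simp
  qed
  then have "\<forall>x. \<exists>g. \<forall>\<omega>. set_pmf (g \<omega>) \<subseteq> SXt \<and>
      (\<forall>xt. mean c (row \<omega>) (phi JX x) * pmf (g \<omega>) xt = mean c (row \<omega>) (phi JE (x, xt)))"
    by (intro allI choice)
  then show ?thesis unfolding encoder_for_def by (rule choice)
qed

text \<open>The losses in turn: normalising the encoder for each \<omega>, the mismatch between the
  codebook average and the target law, and wrong decoding. The factor 2 is the range of a test
  function with values between -1 and 1.\<close>

definition cost where
  "cost g1 g2 c =
     (\<Sum>\<omega>\<in>\<Omega>. \<Sum>x\<in>set_pmf px. \<bar>mean c (row \<omega>) (phi JX x) - pmf px x\<bar>) / card \<Omega>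
   + (\<Sum>s\<in>outs JT. \<bar>mean c indices (phi JT s) - pmf (marg_t JT) s\<bar>)
   + (\<Sum>i\<in>indices. (\<Sum>(a, b)\<in>{..<M1} \<times> {..<M2}.
        2 * ((\<Sum>y\<in>outs JY. word (c i) a b (phi JY y) * of_bool (err1 g1 c i a y))
           + (\<Sum>z\<in>outs JZ. word (c i) a b (phi JZ z) * of_bool (err2 g2 c i b z)))) / (real M1 * real M2)) / card indices"

lemma sum_indices: "(\<Sum>i\<in>indices. g i) = (\<Sum>\<omega>\<in>\<Omega>. \<Sum>i\<in>row \<omega>. g i)"
proof -
  have "(\<Sum>i\<in>row \<omega>. g i) = (\<Sum>m<M0. g (\<omega>, m))" for \<omega>
    by (rule sum.reindex_bij_witness[of _ "\<lambda>m. (\<omega>, m)" snd]) auto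
  then show ?thesis by (simp add: indices_def sum.cartesian_product)
qed

text \<open>The total variation distance is estimated by testing against functions bounded by 1, which keeps
  the argument within expectations of sequentially composed channels.\<close>

lemma test_bound:
  fixes f :: "'x \<times> 'y \<times> 'z \<Rightarrow> real"
  assumes f: "\<And>s. \<bar>f s\<bar> \<le> 1" and enc: "encoder_for c enc"
  shows "expect (sim enc (dec1 g1 c) (dec2 g2 c)) f - expect (marg_t JT) f \<le> cost g1 g2 c"
proof -
  let ?r = "\<lambda>x xt \<omega>. expect (K xt) (\<lambda>(yt, zt). expect (dec1 g1 c yt \<omega>) (\<lambda>y. expect (dec2 g2 c zt \<omega>) (\<lambda>z. f (x, y, z))))"
  let ?SX = "set_pmf px" and ?Tg = "marg_t JT"
  let ?q = "\<lambda>\<omega> x. mean c (row \<omega>) (phi JX x)"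
  have fe: "finite (set_pmf (enc x \<omega>))" and sube: "set_pmf (enc x \<omega>) \<subseteq> SXt"
    and enc_eq: "?q \<omega> x * pmf (enc x \<omega>) xt = mean c (row \<omega>) (phi JE (x, xt))" for x xt \<omega>
    using enc finite_SXt by (auto simp: encoder_for_def intro: finite_subset)
  note fins = finite_K finite_dec1 finite_dec2 finite_px fe
  have r1: "\<bar>?r x xt \<omega>\<bar> \<le> 1" for x xt \<omega>
    using f fins by (intro abs_expect_le) (auto intro!: abs_expect_le)
  have "expect (sim enc (dec1 g1 c) (dec2 g2 c)) f
      = expect px (\<lambda>x. (\<Sum>\<omega>\<in>\<Omega>. expect (enc x \<omega>) (\<lambda>xt. ?r x xt \<omega>)) / card \<Omega>)"
    using \<Omega> unfolding sim_def by (simp add: expect_bind fins case_prod_unfold integral_pmf_of_set)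
  also have "\<dots> = (\<Sum>x\<in>?SX. pmf px x * ((\<Sum>\<omega>\<in>\<Omega>. expect (enc x \<omega>) (\<lambda>xt. ?r x xt \<omega>)) / card \<Omega>))"
    by (subst integral_measure_pmf[OF finite_px]) auto
  also have "\<dots> = (\<Sum>\<omega>\<in>\<Omega>. \<Sum>x\<in>?SX. pmf px x * expect (enc x \<omega>) (\<lambda>xt. ?r x xt \<omega>)) / card \<Omega>"
    by (subst sum.swap) (simp add: sum_distrib_left sum_divide_distrib)
  finally have S1: "expect (sim enc (dec1 g1 c) (dec2 g2 c)) f = \<dots>" .
  \<comment> \<open>The source law is replaced by the codebook average \<open>?q\<close>, at the
    price of the first term of \<open>cost\<close>. Multiplication by \<open>?q\<close> then undoes
    the normalisation of the encoder and leaves the weight of (x, xt).\<close>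
  have "pmf px x * expect (enc x \<omega>) (\<lambda>xt. ?r x xt \<omega>)
     \<le> ?q \<omega> x * expect (enc x \<omega>) (\<lambda>xt. ?r x xt \<omega>) + \<bar>?q \<omega> x - pmf px x\<bar>" for x \<omega>
  proof -
    have "\<bar>(pmf px x - ?q \<omega> x) * expect (enc x \<omega>) (\<lambda>xt. ?r x xt \<omega>)\<bar> \<le> \<bar>pmf px x - ?q \<omega> x\<bar> * 1"
      unfolding abs_mult using abs_expect_le[OF fe r1] by (intro mult_left_mono) auto
    then show ?thesis by (simp add: algebra_simps abs_if split: if_splits)
  qed
  then have S2: "expect (sim enc (dec1 g1 c) (dec2 g2 c)) f
     \<le> (\<Sum>\<omega>\<in>\<Omega>. \<Sum>x\<in>?SX. ?q \<omega> x * expect (enc x \<omega>) (\<lambda>xt. ?r x xt \<omega>) + \<bar>?q \<omega> x - pmf px x\<bar>) / card \<Omega>"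
    unfolding S1 by (intro divide_right_mono sum_mono) auto
  have S3: "(\<Sum>x\<in>?SX. ?q \<omega> x * expect (enc x \<omega>) (\<lambda>xt. ?r x xt \<omega>))
    = mean c (row \<omega>) (\<lambda>w u v. \<Sum>t\<in>?SX \<times> SXt. phi JE t w u v * ?r (fst t) (snd t) \<omega>)" for \<omega>
  proof -
    have "?q \<omega> x * expect (enc x \<omega>) (\<lambda>xt. ?r x xt \<omega>) = (\<Sum>xt\<in>SXt. mean c (row \<omega>) (phi JE (x, xt)) * ?r x xt \<omega>)" for x
    proof -
      have "expect (enc x \<omega>) (\<lambda>xt. ?r x xt \<omega>) = (\<Sum>xt\<in>SXt. pmf (enc x \<omega>) xt * ?r x xt \<omega>)"
        using sube by (subst integral_measure_pmf[OF finite_SXt]) auto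
      then show ?thesis by (simp only: enc_eq[symmetric] sum_distrib_left mult.assoc)
    qed
    then show ?thesis unfolding mean_sum mean_scale
      by (simp only: sum.cartesian_product case_prod_unfold fst_conv snd_conv prod.collapse)
  qed
  let ?E = "\<lambda>i a b. 2 * ((\<Sum>y\<in>outs JY. word (c i) a b (phi JY y) * of_bool (err1 g1 c i a y))
           + (\<Sum>z\<in>outs JZ. word (c i) a b (phi JZ z) * of_bool (err2 g2 c i b z)))"
  have "(\<Sum>\<omega>\<in>\<Omega>. \<Sum>x\<in>?SX. ?q \<omega> x * expect (enc x \<omega>) (\<lambda>xt. ?r x xt \<omega>)) / card \<Omega>
    = (\<Sum>i\<in>indices. (\<Sum>(a, b)\<in>{..<M1} \<times> {..<M2}. word (c i) a b (\<lambda>w u v. \<Sum>t\<in>?SX \<times> SXt. phi JE t w u v * ?r (fst t) (snd t) (fst i))) / (real M1 * real M2)) / card indices"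
  proof -
    let ?H = "\<lambda>\<omega> w u v. \<Sum>t\<in>?SX \<times> SXt. phi JE t w u v * ?r (fst t) (snd t) \<omega>"
    have "mean c (row \<omega>) (?H \<omega>)
      = (\<Sum>i\<in>row \<omega>. (\<Sum>(a, b)\<in>{..<M1} \<times> {..<M2}. word (c i) a b (?H (fst i))) / (real M1 * real M2)) / M0" for \<omega>
      unfolding mean_def word_avg_def indices_props by (intro arg_cong2[where f = "(/)"] sum.cong refl) auto
    then show ?thesis
      unfolding S3 sum_indices indices_props(6) by (simp only: sum_divide_distrib[symmetric] of_nat_mult divide_divide_eq_left mult_ac)
  qed
  also have "\<dots> \<le> (\<Sum>i\<in>indices. (\<Sum>(a, b)\<in>{..<M1} \<times> {..<M2}. word (c i) a b (\<lambda>w u v. \<Sum>s\<in>outs JT. phi JT s w u v * f s) + ?E i a b) / (real M1 * real M2)) / card indices"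
  proof (intro divide_right_mono sum_mono)
    fix i p assume "i \<in> indices" and p: "p \<in> {..<M1} \<times> {..<M2}"
    obtain a b where p_eq: "p = (a, b)" by (cases p)
    have "snd i < M0" "a < M1" "b < M2" using \<open>i \<in> indices\<close> p p_eq by (auto simp: indices_def)
    from word_error_bound[of f, OF f this, of c g1 g2]
    show "(case p of (a, b) \<Rightarrow> word (c i) a b (\<lambda>w u v. \<Sum>t\<in>?SX \<times> SXt. phi JE t w u v * ?r (fst t) (snd t) (fst i)))
      \<le> (case p of (a, b) \<Rightarrow> word (c i) a b (\<lambda>w u v. \<Sum>s\<in>outs JT. phi JT s w u v * f s) + ?E i a b)"
      unfolding p_eq prod.case .
  qed auto
  also have "\<dots> = mean c indices (\<lambda>w u v. \<Sum>s\<in>outs JT. phi JT s w u v * f s)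
      + (\<Sum>i\<in>indices. (\<Sum>(a, b)\<in>{..<M1} \<times> {..<M2}. ?E i a b) / (real M1 * real M2)) / card indices"
    by (simp add: mean_def word_avg_def case_prod_unfold sum.distrib add_divide_distrib)
  also have "mean c indices (\<lambda>w u v. \<Sum>s\<in>outs JT. phi JT s w u v * f s) = (\<Sum>s\<in>outs JT. mean c indices (phi JT s) * f s)"
    by (simp add: mean_sum mean_scale)
  also have "\<dots> \<le> (\<Sum>s\<in>outs JT. pmf ?Tg s * f s + \<bar>mean c indices (phi JT s) - pmf ?Tg s\<bar>)"
  proof (intro sum_mono)
    fix s
    have "\<bar>(mean c indices (phi JT s) - pmf ?Tg s) * f s\<bar> \<le> \<bar>mean c indices (phi JT s) - pmf ?Tg s\<bar> * 1"
      unfolding abs_mult by (intro mult_left_mono f) auto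
    then show "mean c indices (phi JT s) * f s \<le> pmf ?Tg s * f s + \<bar>mean c indices (phi JT s) - pmf ?Tg s\<bar>"
      by (simp add: algebra_simps abs_if split: if_splits)
  qed
  also have "\<dots> = expect ?Tg f + (\<Sum>s\<in>outs JT. \<bar>mean c indices (phi JT s) - pmf ?Tg s\<bar>)"
    by (subst integral_measure_pmf[OF finite_outs[of "\<lambda>x xt yt zt y z. (x, y, z)"]]) (auto simp: sum.distrib outs_def)
  finally have S4: "(\<Sum>\<omega>\<in>\<Omega>. \<Sum>x\<in>?SX. ?q \<omega> x * expect (enc x \<omega>) (\<lambda>xt. ?r x xt \<omega>)) / card \<Omega>
     \<le> expect ?Tg f + (\<Sum>s\<in>outs JT. \<bar>mean c indices (phi JT s) - pmf ?Tg s\<bar>)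
      + (\<Sum>i\<in>indices. (\<Sum>(a, b)\<in>{..<M1} \<times> {..<M2}. ?E i a b) / (real M1 * real M2)) / card indices" by simp
  show ?thesis
    using S2 S4 unfolding cost_def sum.distrib add_divide_distrib by linarith
qed

text \<open>The sign of the difference of the two laws is a test function that attains twice the
  total variation distance.\<close>

lemma tv_dist_le_cost:
  assumes enc: "encoder_for c enc"
  shows "2 * tv_dist (sim enc (dec1 g1 c) (dec2 g2 c)) (marg_t JT) \<le> cost g1 g2 c"
proof -
  let ?S = "sim enc (dec1 g1 c) (dec2 g2 c)" and ?Tg = "marg_t JT"
  let ?F = "set_pmf ?S \<union> set_pmf ?Tg"
  define f where "f s = (if pmf ?S s \<ge> pmf ?Tg s then 1 else - 1 :: real)" for s
  have fe: "finite (set_pmf (enc x \<omega>))" for x \<omega>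
    using enc finite_SXt by (auto simp: encoder_for_def intro: finite_subset)
  have "finite (set_pmf ?S)"
    using \<Omega> by (auto simp: sim_def finite_px fe finite_K finite_dec1 finite_dec2)
  then have F: "finite ?F" using finite_outs[of "\<lambda>x xt yt zt y z. (x, y, z)"] by (simp add: outs_def)
  have "2 * tv_dist ?S ?Tg = (\<Sum>s\<in>?F. \<bar>pmf ?S s - pmf ?Tg s\<bar>)"
    by (subst tv_dist_finite[OF F]) auto
  also have "\<dots> = (\<Sum>s\<in>?F. pmf ?S s * f s) - (\<Sum>s\<in>?F. pmf ?Tg s * f s)"
    unfolding sum_subtractf[symmetric] by (intro sum.cong) (auto simp: f_def)
  also have "(\<Sum>s\<in>?F. pmf ?S s * f s) = expect ?S f"
    by (subst integral_measure_pmf[OF F]) auto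
  also have "(\<Sum>s\<in>?F. pmf ?Tg s * f s) = expect ?Tg f"
    by (subst integral_measure_pmf[OF F]) auto
  also have "expect ?S f - expect ?Tg f \<le> cost g1 g2 c"
    by (intro test_bound enc) (simp add: f_def)
  finally show ?thesis .
qed

definition cov_err where
  "cov_err \<beta>0 \<beta>1 \<beta>2 \<beta>3 J k = 2 * measure_pmf.prob J {(w, u, v, t). \<not> covering_typical \<beta>0 \<beta>1 \<beta>2 \<beta>3 J w u v t}
      + sqrt ((\<beta>0 + \<beta>1 / M1 + \<beta>2 / M2 + \<beta>3 / (real M1 * real M2)) / real k)"

text \<open>\<open>M0 * M\<close> counts all words with the same \<omega>, \<open>M - 1\<close> the
  rival satellites of one cloud.\<close>

definition pack_err where
  "pack_err \<gamma>0 \<gamma>1 J M = measure_pmf.prob J {(w, u, t). \<not> decodable \<gamma>0 \<gamma>1 J w u t} + real M0 * real M / \<gamma>0 + real (M - 1) / \<gamma>1"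

abbreviation "JY1 \<equiv> marg_wut JY"
abbreviation "JZ2 \<equiv> marg_wvt JZ"

lemma expect_cost:
  assumes \<beta>: "\<beta>0 \<ge> 0" "\<beta>1 \<ge> 0" "\<beta>2 \<ge> 0" "\<beta>3 \<ge> 0"
    and \<beta>': "\<beta>0' \<ge> 0" "\<beta>1' \<ge> 0" "\<beta>2' \<ge> 0" "\<beta>3' \<ge> 0"
    and \<gamma>: "\<gamma>0 > 0" "\<gamma>1 > 0" and \<gamma>': "\<gamma>0' > 0" "\<gamma>1' > 0"
  shows "expect (codebook indices) (cost (decodable \<gamma>0 \<gamma>1 JY1) (decodable \<gamma>0' \<gamma>1' JZ2))
    \<le> cov_err \<beta>0 \<beta>1 \<beta>2 \<beta>3 JX M0 + cov_err \<beta>0' \<beta>1' \<beta>2' \<beta>3' JT (card \<Omega> * M0)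
      + 2 * (pack_err \<gamma>0 \<gamma>1 JY1 M1 + pack_err \<gamma>0' \<gamma>1' JZ2 M2)"
proof -
  let ?g1 = "decodable \<gamma>0 \<gamma>1 JY1" and ?g2 = "decodable \<gamma>0' \<gamma>1' JZ2"
  note finc = finite_codebook[OF indices_props(1)]
  let ?a = "\<lambda>c. (\<Sum>\<omega>\<in>\<Omega>. \<Sum>x\<in>set_pmf px. \<bar>mean c (row \<omega>) (phi JX x) - pmf px x\<bar>) / card \<Omega>"
  let ?b = "\<lambda>c. \<Sum>s\<in>outs JT. \<bar>mean c indices (phi JT s) - pmf (marg_t JT) s\<bar>"
  let ?e1 = "\<lambda>c i a b. \<Sum>y\<in>outs JY. word (c i) a b (phi JY y) * of_bool (err1 ?g1 c i a y)"
  let ?e2 = "\<lambda>c i a b. \<Sum>z\<in>outs JZ. word (c i) a b (phi JZ z) * of_bool (err2 ?g2 c i b z)"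
  have a: "expect (codebook indices) ?a \<le> cov_err \<beta>0 \<beta>1 \<beta>2 \<beta>3 JX M0"
  proof -
    have "expect (codebook indices) (\<lambda>c. \<Sum>x\<in>set_pmf px. \<bar>mean c (row \<omega>) (phi JX x) - pmf px x\<bar>)
      \<le> cov_err \<beta>0 \<beta>1 \<beta>2 \<beta>3 JX M0" if "\<omega> \<in> \<Omega>" for \<omega>
    proof -
      have mem: "x \<in> set_pmf px" if "(w, u, v, x) \<in> set_pmf JX" for w u v x
      proof -
        have "x \<in> set_pmf (marg_t JX)" using that by force
        then show ?thesis unfolding map_JX .
      qed
      show ?thesis unfolding mean_def cov_err_def indices_props(5)
        by (rule soft_covering_typical[where J = JX and F = "set_pmf px", OF joint_law indices_props(1) indices_props(2)[OF that] indices_props(3)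
            finite_px mem \<beta>, unfolded map_JX indices_props(5)])
    qed
    then have "(\<Sum>\<omega>\<in>\<Omega>. expect (codebook indices) (\<lambda>c. \<Sum>x\<in>set_pmf px. \<bar>mean c (row \<omega>) (phi JX x) - pmf px x\<bar>)) / card \<Omega>
       \<le> (\<Sum>\<omega>\<in>\<Omega>. cov_err \<beta>0 \<beta>1 \<beta>2 \<beta>3 JX M0) / card \<Omega>"
      by (intro divide_right_mono sum_mono) auto
    also have "\<dots> = cov_err \<beta>0 \<beta>1 \<beta>2 \<beta>3 JX M0" using \<Omega> by simp
    finally show ?thesis by (simp add: expect_sum[OF finc])
  qed
  have b: "expect (codebook indices) ?b \<le> cov_err \<beta>0' \<beta>1' \<beta>2' \<beta>3' JT (card \<Omega> * M0)"
    unfolding mean_def cov_err_def indices_props(6)[symmetric]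
    by (rule soft_covering_typical[where J = JT and F = "outs JT", OF joint_law indices_props(1) order_refl indices_props(4) finite_outs outsI \<beta>'])
  have e: "expect (codebook indices) (\<lambda>c. 2 * (?e1 c i a b + ?e2 c i a b))
     \<le> 2 * (pack_err \<gamma>0 \<gamma>1 JY1 M1 + pack_err \<gamma>0' \<gamma>1' JZ2 M2)"
    if "i \<in> indices" and ab: "a < M1" "b < M2" for i a b
  proof -
    have row: "row (fst i) \<subseteq> indices" "i \<in> row (fst i)" using \<open>i \<in> indices\<close> by (auto simp: indices_def)
    have "expect (codebook indices) (\<lambda>c. ?e1 c i a b) \<le> pack_err \<gamma>0 \<gamma>1 JY1 M1"
      unfolding err1_def pack_err_def word_def
      by (rule packing_decodable_u[where J = JY and F = "outs JY", OF joint_law finite_outs outsI indices_props(1) row ab \<gamma>,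
          unfolded word_def indices_props(5) of_nat_mult])
    moreover have "expect (codebook indices) (\<lambda>c. ?e2 c i a b) \<le> pack_err \<gamma>0' \<gamma>1' JZ2 M2"
      unfolding err2_def pack_err_def word_def
      by (rule packing_decodable_v[where J = JZ and F = "outs JZ", OF joint_law finite_outs outsI indices_props(1) row ab \<gamma>',
          unfolded word_def indices_props(5) of_nat_mult])
    ultimately show ?thesis by (simp add: expect_add[OF finc])
  qed
  define G where "G i p c = 2 * (?e1 c i (fst p) (snd p) + ?e2 c i (fst p) (snd p))" for i p c
  define fa where "fa = ?a"
  define fb where "fb = ?b"
  let ?S = "{..<M1} \<times> {..<M2}" and ?N = "real M1 * real M2"
  have "cost ?g1 ?g2 = (\<lambda>c. fa c + fb c + (\<Sum>i\<in>indices. (\<Sum>p\<in>?S. G i p c) / ?N) / card indices)"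
    by (rule ext) (simp only: cost_def fa_def fb_def G_def case_prod_unfold)
  then have "expect (codebook indices) (cost ?g1 ?g2) = expect (codebook indices) fa + expect (codebook indices) fb
     + (\<Sum>i\<in>indices. (\<Sum>p\<in>?S. expect (codebook indices) (G i p)) / ?N) / card indices"
    by (simp only: expect_nested_average[OF finc])
  also have "(\<Sum>i\<in>indices. (\<Sum>p\<in>?S. expect (codebook indices) (G i p)) / ?N) / card indices
     \<le> (\<Sum>i\<in>indices. (\<Sum>p\<in>?S. 2 * (pack_err \<gamma>0 \<gamma>1 JY1 M1 + pack_err \<gamma>0' \<gamma>1' JZ2 M2)) / ?N) / card indices"
  proof (intro divide_right_mono sum_mono)
    fix i p assume "i \<in> indices" "p \<in> ?S"
    then show "expect (codebook indices) (G i p) \<le> 2 * (pack_err \<gamma>0 \<gamma>1 JY1 M1 + pack_err \<gamma>0' \<gamma>1' JZ2 M2)"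
      unfolding G_def by (intro e) auto
  qed auto
  also have "\<dots> = 2 * (pack_err \<gamma>0 \<gamma>1 JY1 M1 + pack_err \<gamma>0' \<gamma>1' JZ2 M2)"
    using indices_props(1,4) M_pos by (simp add: card_cartesian_product)
  finally show ?thesis using a b unfolding fa_def fb_def by linarith
qed

text \<open>Derandomisation: some codebook costs no more than the average one. The sets
  \<open>SY\<close> and \<open>SZ\<close> will keep the outputs of the decoders among the sequences
  of the block length, as the notion of a code demands.\<close>

lemma one_shot_simulation:
  assumes \<beta>: "\<beta>0 \<ge> 0" "\<beta>1 \<ge> 0" "\<beta>2 \<ge> 0" "\<beta>3 \<ge> 0"
    and \<beta>': "\<beta>0' \<ge> 0" "\<beta>1' \<ge> 0" "\<beta>2' \<ge> 0" "\<beta>3' \<ge> 0"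
    and \<gamma>: "\<gamma>0 > 0" "\<gamma>1 > 0" and \<gamma>': "\<gamma>0' > 0" "\<gamma>1' > 0"
    and SY: "\<And>yt u w. set_pmf (D1 yt u w) \<subseteq> SY" and SZ: "\<And>zt v w. set_pmf (D2 zt v w) \<subseteq> SZ"
  shows "\<exists>enc d1 d2. (\<forall>x \<omega>. set_pmf (enc x \<omega>) \<subseteq> SXt) \<and> (\<forall>yt \<omega>. set_pmf (d1 yt \<omega>) \<subseteq> SY)
    \<and> (\<forall>zt \<omega>. set_pmf (d2 zt \<omega>) \<subseteq> SZ)
    \<and> 2 * tv_dist (sim enc d1 d2) (map_pmf (\<lambda>(x, u, v, w, xt, yt, zt, y, z). (x, y, z)) P)
      \<le> cov_err \<beta>0 \<beta>1 \<beta>2 \<beta>3 JX M0 + cov_err \<beta>0' \<beta>1' \<beta>2' \<beta>3' JT (card \<Omega> * M0)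
      + 2 * (pack_err \<gamma>0 \<gamma>1 JY1 M1 + pack_err \<gamma>0' \<gamma>1' JZ2 M2)"
proof -
  let ?g1 = "decodable \<gamma>0 \<gamma>1 JY1" and ?g2 = "decodable \<gamma>0' \<gamma>1' JZ2"
  obtain c where c: "cost ?g1 ?g2 c \<le> expect (codebook indices) (cost ?g1 ?g2)"
    using expect_exists_le[OF finite_codebook[OF indices_props(1)], of "cost ?g1 ?g2"] by blast
  obtain enc where enc: "encoder_for c enc" using encoder_exists by blast
  have tgt: "marg_t JT = map_pmf (\<lambda>(x, u, v, w, xt, yt, zt, y, z). (x, y, z)) P"
    by (simp add: law_def map_pmf_comp case_prod_unfold)
  have "2 * tv_dist (sim enc (dec1 ?g1 c) (dec2 ?g2 c)) (map_pmf (\<lambda>(x, u, v, w, xt, yt, zt, y, z). (x, y, z)) P)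
    \<le> cov_err \<beta>0 \<beta>1 \<beta>2 \<beta>3 JX M0 + cov_err \<beta>0' \<beta>1' \<beta>2' \<beta>3' JT (card \<Omega> * M0)
      + 2 * (pack_err \<gamma>0 \<gamma>1 JY1 M1 + pack_err \<gamma>0' \<gamma>1' JZ2 M2)"
    using tv_dist_le_cost[OF enc, of ?g1 ?g2] c expect_cost[OF \<beta> \<beta>' \<gamma> \<gamma>'] unfolding tgt by linarith
  moreover have "set_pmf (enc x \<omega>) \<subseteq> SXt" for x \<omega> using enc by (simp add: encoder_for_def)
  moreover have "set_pmf (dec1 g c yt \<omega>) \<subseteq> SY" "set_pmf (dec2 g' c zt \<omega>) \<subseteq> SZ" for g yt \<omega> g' zt
    using SY SZ by (simp_all add: dec1_def dec2_def Let_def)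
  ultimately show ?thesis by blast
qed

end

section \<open>Asymptotic equipartition\<close>

lemma map_seq_map_Pi_pmf:
  "map_pmf (seq_map n h) (Pi_pmf {..<n} undefined q) = Pi_pmf {..<n} undefined (\<lambda>i. map_pmf h (q i))"
proof -
  have "Pi_pmf {..<n} undefined (\<lambda>i. map_pmf h (q i))
      = bind_pmf (Pi_pmf {..<n} undefined q) (\<lambda>s. Pi_pmf {..<n} undefined (\<lambda>i. return_pmf (h (s i))))"
    unfolding map_pmf_def by (rule Pi_pmf_bind) simp
  also have "\<dots> = map_pmf (seq_map n h) (Pi_pmf {..<n} undefined q)"
    by (simp add: map_pmf_def seq_map_def restrict_def)
  finally show ?thesis by simp
qed

lemma map_seq_map_iid_pmf: "map_pmf (seq_map n h) (iid_pmf n S) = iid_pmf n (map_pmf h S)"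
  unfolding iid_pmf_def by (rule map_seq_map_Pi_pmf)

lemma pmf_map_Pi_seqs:
  fixes n :: nat
  assumes "\<And>s. g s = g s0 \<longleftrightarrow> (\<forall>i<n. h (s i) = h (s0 i))"
  shows "pmf (map_pmf g (Pi_pmf {..<n} undefined q)) (g s0) = (\<Prod>i<n. pmf (map_pmf h (q i)) (h (s0 i)))"
proof -
  have "g -` {g s0} = seq_map n h -` {seq_map n h s0}"
    using assms by (auto simp: seq_map_eq_iff)
  then have "pmf (map_pmf g (Pi_pmf {..<n} undefined q)) (g s0)
      = pmf (map_pmf (seq_map n h) (Pi_pmf {..<n} undefined q)) (seq_map n h s0)"
    by (simp add: pmf_map)
  also have "\<dots> = (\<Prod>i<n. pmf (map_pmf h (q i)) (h (s0 i)))"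
    unfolding map_seq_map_Pi_pmf by (subst pmf_Pi') (auto simp: seq_map_def)
  finally show ?thesis .
qed

lemma pmf_map_iid_seqs:
  assumes "\<And>s. g s = g s0 \<longleftrightarrow> (\<forall>i<n. h (s i) = h (s0 i))"
  shows "pmf (map_pmf g (iid_pmf n S)) (g s0) = (\<Prod>i<n. pmf (map_pmf h S) (h (s0 i)))"
  unfolding iid_pmf_def by (rule pmf_map_Pi_seqs[where h = h]) (rule assms)

lemma set_iid_pmf: "s \<in> set_pmf (iid_pmf n S) \<Longrightarrow> i < n \<Longrightarrow> s i \<in> set_pmf S"
  unfolding iid_pmf_def by (subst (asm) set_Pi_pmf) (auto simp: PiE_dflt_def)

text \<open>Hoeffding's inequality for summands in an interval of length 2B: the exponent 2 (n
  \<delta>)^2 / (n (2B)^2) equals n \<delta>^2 / (2 B^2).\<close>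

lemma iid_sum_tail_bound:
  fixes f :: "'s \<Rightarrow> real"
  assumes B: "B > 0" "\<And>s. s \<in> set_pmf S \<Longrightarrow> \<bar>f s\<bar> \<le> B" and \<delta>: "\<delta> \<ge> 0" and n: "n > 0"
  shows "measure_pmf.prob (iid_pmf n S) {s. (\<Sum>i<n. f (s i)) \<ge> real n * (expect S f + \<delta>)}
    \<le> exp (- (\<delta>\<^sup>2 / (2 * B\<^sup>2)) * real n)"
proof -
  let ?M = "iid_pmf n S"
  have comp: "map_pmf (\<lambda>s. s i) ?M = S" if "i < n" for i
    using that by (simp add: iid_pmf_def Pi_pmf_component)
  have ex: "expect ?M (\<lambda>s. f (s i)) = expect S f" if "i < n" for i
    using integral_map_pmf[of "\<lambda>s. s i" ?M f] by (simp add: comp[OF that])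
  interpret Hoeffding_ineq "measure_pmf ?M" "{..<n}" "\<lambda>i s. f (s i)" "\<lambda>_. - B" "\<lambda>_. B" "real n * expect S f"
  proof unfold_locales
    have "prob_space.indep_vars ?M (\<lambda>_. count_space UNIV) (\<lambda>x f. f x) {..<n}"
      unfolding iid_pmf_def by (rule indep_vars_Pi_pmf) simp
    then show "prob_space.indep_vars ?M (\<lambda>_. borel) (\<lambda>i s. f (s i)) {..<n}"
      by (rule prob_space.indep_vars_compose2[OF measure_pmf.prob_space_axioms]) auto
    show "AE s in ?M. f (s i) \<in> {- B..B}" if "i \<in> {..<n}" for i
    proof (rule AE_pmfI)
      fix s assume "s \<in> set_pmf ?M"
      then show "f (s i) \<in> {- B..B}" using B(2)[OF set_iid_pmf, of s n i] that by (auto simp: abs_le_iff)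
    qed
    show "real n * expect S f \<equiv> \<Sum>i<n. expect ?M (\<lambda>s. f (s i))"
      by (rule eq_reflection) (simp add: ex)
  qed simp
  have "measure_pmf.prob ?M {s\<in>space ?M. (\<Sum>i<n. f (s i)) \<ge> real n * expect S f + real n * \<delta>}
      \<le> exp (- 2 * (real n * \<delta>)\<^sup>2 / (\<Sum>i<n. (B - - B)\<^sup>2))"
    using B \<delta> n by (intro Hoeffding_ineq_ge) auto
  also have "- 2 * (real n * \<delta>)\<^sup>2 / (\<Sum>i<n. (B - - B)\<^sup>2) = - (\<delta>\<^sup>2 / (2 * B\<^sup>2)) * real n"
    using B n by (simp add: power2_eq_square field_simps)
  finally show ?thesis by (simp add: algebra_simps)
qed

lemma iid_sum_tail_tendsto:
  fixes f :: "'s \<Rightarrow> real"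
  assumes B: "\<And>s. s \<in> set_pmf S \<Longrightarrow> \<bar>f s\<bar> \<le> B" and \<delta>: "\<delta> > 0"
  shows "(\<lambda>n. measure_pmf.prob (iid_pmf n S) {s. (\<Sum>i<n. f (s i)) \<ge> real n * (expect S f + \<delta>)}) \<longlonglongrightarrow> 0"
proof (rule tendsto_sandwich[OF _ _ tendsto_const])
  \<comment> \<open>A strictly positive bound is required even if \<open>f\<close> vanishes on the
    support.\<close>
  define C where "C = \<bar>B\<bar> + 1"
  have C: "C > 0" "\<And>s. s \<in> set_pmf S \<Longrightarrow> \<bar>f s\<bar> \<le> C" using B by (force simp: C_def)+
  show "\<forall>\<^sub>F n in sequentially. measure_pmf.prob (iid_pmf n S) {s. (\<Sum>i<n. f (s i)) \<ge> real n * (expect S f + \<delta>)}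
     \<le> exp (- (\<delta>\<^sup>2 / (2 * C\<^sup>2)) * real n)"
    using eventually_gt_at_top[of 0] by eventually_elim (intro iid_sum_tail_bound C, use \<delta> in auto)
  have pos: "\<delta>\<^sup>2 / (2 * C\<^sup>2) > 0" using \<delta> C by simp
  have "(\<lambda>n. exp (- k * real n)) \<longlonglongrightarrow> 0" if "k > 0" for k :: real using that by real_asymp
  from this[OF pos] show "(\<lambda>n. exp (- (\<delta>\<^sup>2 / (2 * C\<^sup>2)) * real n)) \<longlonglongrightarrow> 0" .
qed (simp_all)

text \<open>The law of large numbers for the logarithm of a likelihood ratio, exponentiated. The
  sample space of \<open>S\<close> may be infinite; finitely many positive values of
  \<open>a\<close> and \<open>b\<close> keep the logarithms bounded.\<close>

lemma product_ratio_tendsto: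
  fixes a b :: "'s \<Rightarrow> real"
  assumes pos: "\<And>s. s \<in> set_pmf S \<Longrightarrow> a s > 0 \<and> b s > 0"
    and fin: "finite (a ` set_pmf S)" "finite (b ` set_pmf S)"
    and \<mu>: "expect S (\<lambda>s. log 2 (a s)) - expect S (\<lambda>s. log 2 (b s)) \<le> \<mu>"
    and \<delta>: "\<delta> > 0"
  shows "(\<lambda>n. measure_pmf.prob (iid_pmf n S)
    {s. \<not> (\<Prod>i<n. a (s i)) \<le> 2 powr (real n * (\<mu> + \<delta>)) * (\<Prod>i<n. b (s i))}) \<longlonglongrightarrow> 0"
proof (rule tendsto_sandwich[OF _ _ tendsto_const])
  let ?f = "\<lambda>s. log 2 (a s) - log 2 (b s)"
  let ?g = "\<lambda>x :: real. \<bar>log 2 x\<bar>"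
  define Ba where "Ba = (\<Sum>x\<in>a ` set_pmf S. ?g x)"
  define Bb where "Bb = (\<Sum>x\<in>b ` set_pmf S. ?g x)"
  have Ba: "?g (a s) \<le> Ba" if "s \<in> set_pmf S" for s
    unfolding Ba_def using that by (intro member_le_sum fin) auto
  have Bb: "?g (b s) \<le> Bb" if "s \<in> set_pmf S" for s
    unfolding Bb_def using that by (intro member_le_sum fin) auto
  have B: "\<bar>?f s\<bar> \<le> Ba + Bb" if "s \<in> set_pmf S" for s
    using Ba[OF that] Bb[OF that] by linarith
  have "expect S ?f = expect S (\<lambda>s. log 2 (a s)) - expect S (\<lambda>s. log 2 (b s))"
  proof (rule Bochner_Integration.integral_diff)
    show "integrable S (\<lambda>s. log 2 (a s))"
      by (rule measure_pmf.integrable_const_bound[of _ Ba]) (auto simp: AE_measure_pmf_iff Ba)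
    show "integrable S (\<lambda>s. log 2 (b s))"
      by (rule measure_pmf.integrable_const_bound[of _ Bb]) (auto simp: AE_measure_pmf_iff Bb)
  qed
  then have \<mu>': "expect S ?f \<le> \<mu>" using \<mu> by simp
  show "\<forall>\<^sub>F n in sequentially. measure_pmf.prob (iid_pmf n S)
      {s. \<not> (\<Prod>i<n. a (s i)) \<le> 2 powr (real n * (\<mu> + \<delta>)) * (\<Prod>i<n. b (s i))}
    \<le> measure_pmf.prob (iid_pmf n S) {s. (\<Sum>i<n. ?f (s i)) \<ge> real n * (expect S ?f + \<delta>)}"
  proof (rule always_eventually, rule allI, rule measure_pmf.finite_measure_mono_AE)
    fix n
    have "(\<Prod>i<n. a (s i)) \<le> 2 powr (real n * (\<mu> + \<delta>)) * (\<Prod>i<n. b (s i))"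
      if s: "s \<in> set_pmf (iid_pmf n S)" and lt: "(\<Sum>i<n. ?f (s i)) < real n * (expect S ?f + \<delta>)" for s
    proof -
      have p: "a (s i) > 0" "b (s i) > 0" if "i < n" for i using pos set_iid_pmf[OF s that] by auto
      have "(\<Prod>i<n. a (s i)) = (\<Prod>i<n. 2 powr (?f (s i)) * b (s i))"
      proof (intro prod.cong refl)
        fix i assume "i \<in> {..<n}"
        then show "a (s i) = 2 powr (?f (s i)) * b (s i)" using p[of i] by (simp add: powr_diff)
      qed
      also have "\<dots> = 2 powr (\<Sum>i<n. ?f (s i)) * (\<Prod>i<n. b (s i))"
        by (simp add: prod.distrib powr_sum)
      also have "\<dots> \<le> 2 powr (real n * (\<mu> + \<delta>)) * (\<Prod>i<n. b (s i))"
      proof (rule mult_right_mono)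
        have "real n * (expect S ?f + \<delta>) \<le> real n * (\<mu> + \<delta>)" using \<mu>' by (intro mult_left_mono) auto
        then show "2 powr (\<Sum>i<n. ?f (s i)) \<le> 2 powr (real n * (\<mu> + \<delta>))" using lt by (intro powr_mono) auto
        show "(\<Prod>i<n. b (s i)) \<ge> 0" using p by (intro prod_nonneg) (auto intro: less_imp_le)
      qed
      finally show ?thesis .
    qed
    then show "AE s in iid_pmf n S. s \<in> {s. \<not> (\<Prod>i<n. a (s i)) \<le> 2 powr (real n * (\<mu> + \<delta>)) * (\<Prod>i<n. b (s i))}
      \<longrightarrow> s \<in> {s. (\<Sum>i<n. ?f (s i)) \<ge> real n * (expect S ?f + \<delta>)}"
      by (intro AE_pmfI) (simp only: mem_Collect_eq, meson not_le)
  qed auto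
  show "(\<lambda>n. measure_pmf.prob (iid_pmf n S) {s. (\<Sum>i<n. ?f (s i)) \<ge> real n * (expect S ?f + \<delta>)}) \<longlonglongrightarrow> 0"
    by (rule iid_sum_tail_tendsto[OF B \<delta>])
qed simp_all

text \<open>Ensures bounded, integrable logarithms on an arbitrary sample space, and is closed under
  products.\<close>

definition tame :: "'s pmf \<Rightarrow> ('s \<Rightarrow> real) \<Rightarrow> bool" where
  "tame S f \<longleftrightarrow> (\<forall>s\<in>set_pmf S. f s > 0) \<and> finite (f ` set_pmf S)"

lemma tame_one: "tame S (\<lambda>_. 1)"
  by (auto simp: tame_def set_pmf_not_empty intro!: finite_subset[of _ "{1}"])

lemma tame_mult:
  assumes "tame S f" "tame S g"
  shows "tame S (\<lambda>s. f s * g s)"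
proof -
  have "(\<lambda>s. f s * g s) ` set_pmf S \<subseteq> (\<lambda>(x, y). x * y) ` (f ` set_pmf S \<times> g ` set_pmf S)" by auto
  moreover have "finite ((\<lambda>(x, y). x * y) ` (f ` set_pmf S \<times> g ` set_pmf S))"
    using assms by (auto simp: tame_def intro!: finite_imageI[OF finite_cartesian_product])
  ultimately have "finite ((\<lambda>s. f s * g s) ` set_pmf S)" by (rule finite_subset)
  then show ?thesis using assms by (auto simp: tame_def)
qed

lemma tame_integrable_log:
  assumes "tame S f"
  shows "integrable S (\<lambda>s. log 2 (f s))"
proof (rule measure_pmf.integrable_const_bound[of _ "\<Sum>x\<in>f ` set_pmf S. \<bar>log 2 x\<bar>"])
  have "norm (log 2 (f s)) \<le> (\<Sum>x\<in>f ` set_pmf S. \<bar>log 2 x\<bar>)" if "s \<in> set_pmf S" for s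
    using assms that unfolding real_norm_def tame_def
    by (intro member_le_sum[of _ _ "\<lambda>x. \<bar>log 2 x\<bar>"]) auto
  then show "AE s in S. norm (log 2 (f s)) \<le> (\<Sum>x\<in>f ` set_pmf S. \<bar>log 2 x\<bar>)"
    by (rule AE_pmfI)
qed simp

lemma expect_log_mult:
  assumes "tame S f" "tame S g"
  shows "expect S (\<lambda>s. log 2 (f s * g s)) = expect S (\<lambda>s. log 2 (f s)) + expect S (\<lambda>s. log 2 (g s))"
proof -
  have "expect S (\<lambda>s. log 2 (f s * g s)) = expect S (\<lambda>s. log 2 (f s) + log 2 (g s))"
    using assms by (intro expect_cong) (auto simp: tame_def log_mult)
  also have "\<dots> = expect S (\<lambda>s. log 2 (f s)) + expect S (\<lambda>s. log 2 (g s))"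
    by (intro Bochner_Integration.integral_add tame_integrable_log assms)
  finally show ?thesis .
qed

text \<open>Two factors against three is the largest shape among the typicality conditions; smaller
  ones are padded with the constant 1.\<close>

lemma tame_ratio_tendsto:
  assumes "tame S f1" "tame S f2" "tame S g1" "tame S g2" "tame S g3"
    and \<mu>: "expect S (\<lambda>s. log 2 (f1 s)) + expect S (\<lambda>s. log 2 (f2 s))
      - (expect S (\<lambda>s. log 2 (g1 s)) + expect S (\<lambda>s. log 2 (g2 s)) + expect S (\<lambda>s. log 2 (g3 s))) = \<mu>"
    and \<delta>: "\<delta> > 0"
  shows "(\<lambda>n. measure_pmf.prob (iid_pmf n S)
    {s. \<not> (\<Prod>i<n. f1 (s i)) * (\<Prod>i<n. f2 (s i))
      \<le> 2 powr (real n * (\<mu> + \<delta>)) * ((\<Prod>i<n. g1 (s i)) * (\<Prod>i<n. g2 (s i)) * (\<Prod>i<n. g3 (s i)))}) \<longlonglongrightarrow> 0"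
proof -
  note t = assms(1-5) tame_mult
  have "tame S (\<lambda>s. f1 s * f2 s)" "tame S (\<lambda>s. g1 s * g2 s * g3 s)" by (intro t)+
  moreover have "expect S (\<lambda>s. log 2 (f1 s * f2 s)) - expect S (\<lambda>s. log 2 (g1 s * g2 s * g3 s)) = \<mu>"
    using \<mu> by (simp add: expect_log_mult t)
  ultimately show ?thesis
    using product_ratio_tendsto[of S "\<lambda>s. f1 s * f2 s" "\<lambda>s. g1 s * g2 s * g3 s" \<mu> \<delta>] \<delta>
    by (simp add: tame_def prod.distrib)
qed

section \<open>Entropy and the exponents of typicality\<close>

definition pmass :: "'s pmf \<Rightarrow> ('s \<Rightarrow> 'a) \<Rightarrow> 's \<Rightarrow> real" where
  "pmass S A s = pmf (map_pmf A S) (A s)"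

text \<open>Entropy in bits. Written over the sample space instead of the range of \<open>A\<close>,
  it is literally a mean to which the law of large numbers applies.\<close>

definition ent :: "'s pmf \<Rightarrow> ('s \<Rightarrow> 'a) \<Rightarrow> real" where
  "ent S A = - expect S (\<lambda>s. log 2 (pmass S A s))"

lemma tame_pmass: "tame S (pmass S (A :: 's \<Rightarrow> 'a :: finite))"
proof -
  have "pmass S A ` set_pmf S \<subseteq> range (pmf (map_pmf A S))" by (auto simp: pmass_def)
  then have "finite (pmass S A ` set_pmf S)" by (rule finite_subset) simp
  then show ?thesis by (auto simp: tame_def pmass_def pmf_positive)
qed

text \<open>\<open>g\<close> may arrange the letters as a tuple of sequences instead of a sequence
  of tuples; only equality of the letters counts.\<close>

lemma pmass_iid:
  assumes "\<And>s. g s = g s0 \<longleftrightarrow> (\<forall>i<n. h (s i) = h (s0 i))"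
  shows "pmf (map_pmf g (iid_pmf n S)) (g s0) = (\<Prod>i<n. pmass S h (s0 i))"
  unfolding pmass_def by (rule pmf_map_iid_seqs[where h = h]) (rule assms)

lemma measure_le_sum_tendsto:
  assumes "finite I" "\<And>n. B n \<subseteq> (\<Union>k\<in>I. E k n)" "\<And>k. k \<in> I \<Longrightarrow> (\<lambda>n. measure_pmf.prob (M n) (E k n)) \<longlonglongrightarrow> 0"
  shows "(\<lambda>n. measure_pmf.prob (M n) (B n)) \<longlonglongrightarrow> 0"
proof (rule tendsto_sandwich[OF _ _ tendsto_const])
  have "measure_pmf.prob (M n) (B n) \<le> (\<Sum>k\<in>I. measure_pmf.prob (M n) (E k n))" for n
  proof -
    have "measure_pmf.prob (M n) (B n) \<le> measure_pmf.prob (M n) (\<Union>k\<in>I. E k n)"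
      using assms(2) by (intro measure_pmf.finite_measure_mono) auto
    also have "\<dots> \<le> (\<Sum>k\<in>I. measure_pmf.prob (M n) (E k n))"
      by (intro measure_pmf.finite_measure_subadditive_finite assms(1)) auto
    finally show ?thesis .
  qed
  then show "\<forall>\<^sub>F n in sequentially. measure_pmf.prob (M n) (B n) \<le> (\<Sum>k\<in>I. measure_pmf.prob (M n) (E k n))"
    by simp
  show "(\<lambda>n. \<Sum>k\<in>I. measure_pmf.prob (M n) (E k n)) \<longlonglongrightarrow> 0"
    using tendsto_sum[of I "\<lambda>k n. measure_pmf.prob (M n) (E k n)" "\<lambda>_. 0"] assms(3) by simp
qed simp_all

text \<open>The exponents are I(W; \<theta>), I(W U; \<theta>), I(W V; \<theta>) and I(U V W;
  \<theta>) + I(U; V | W), the last summand being the price of drawing the satellites independently.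
  The encoding \<open>\<tau>\<close> of the output block is left open because the target is a triple
  of sequences.\<close>

lemma covering_typical_tendsto:
  fixes W :: "'s \<Rightarrow> 'w::finite" and U :: "'s \<Rightarrow> 'u::finite" and V :: "'s \<Rightarrow> 'v::finite" and \<theta> :: "'s \<Rightarrow> 't::finite"
  assumes \<tau>: "\<And>n s s'. \<tau> n s = \<tau> n s' \<longleftrightarrow> (\<forall>i<n. \<theta> (s i) = \<theta> (s' i))"
    and J: "\<And>n. J n = map_pmf (\<lambda>s. (seq_map n W s, seq_map n U s, seq_map n V s, \<tau> n s)) (iid_pmf n S)"
    and e: "e0 = ent S W + ent S \<theta> - ent S (W \<bowtie> \<theta>)"
      "e1 = ent S (W \<bowtie> U) + ent S \<theta> - ent S (W \<bowtie> U \<bowtie> \<theta>)"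
      "e2 = ent S (W \<bowtie> V) + ent S \<theta> - ent S (W \<bowtie> V \<bowtie> \<theta>)"
      "e3 = ent S (W \<bowtie> U) + ent S (W \<bowtie> V) + ent S \<theta> - ent S W - ent S (W \<bowtie> U \<bowtie> V \<bowtie> \<theta>)"
    and \<delta>: "\<delta> > 0"
  shows "(\<lambda>n. measure_pmf.prob (J n) {(w, u, v, t). \<not> covering_typical (2 powr (real n * (e0 + \<delta>)))
      (2 powr (real n * (e1 + \<delta>))) (2 powr (real n * (e2 + \<delta>))) (2 powr (real n * (e3 + \<delta>))) (J n) w u v t}) \<longlonglongrightarrow> 0"
proof -
  let ?P = "\<lambda>A (s :: nat \<Rightarrow> 's) n. \<Prod>i<n. pmass S A (s i)"
  define E0 where "E0 n = {s. \<not> ?P (W \<bowtie> \<theta>) s n * (\<Prod>i<n. 1) \<le> 2 powr (real n * (e0 + \<delta>)) * (?P W s n * ?P \<theta> s n * (\<Prod>i<n. 1))}" for n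
  define E1 where "E1 n = {s. \<not> ?P (W \<bowtie> U \<bowtie> \<theta>) s n * (\<Prod>i<n. 1) \<le> 2 powr (real n * (e1 + \<delta>)) * (?P (W \<bowtie> U) s n * ?P \<theta> s n * (\<Prod>i<n. 1))}" for n
  define E2 where "E2 n = {s. \<not> ?P (W \<bowtie> V \<bowtie> \<theta>) s n * (\<Prod>i<n. 1) \<le> 2 powr (real n * (e2 + \<delta>)) * (?P (W \<bowtie> V) s n * ?P \<theta> s n * (\<Prod>i<n. 1))}" for n
  define E3 where "E3 n = {s. \<not> ?P (W \<bowtie> U \<bowtie> V \<bowtie> \<theta>) s n * ?P W s n \<le> 2 powr (real n * (e3 + \<delta>)) * (?P (W \<bowtie> U) s n * ?P (W \<bowtie> V) s n * ?P \<theta> s n)}" for n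
  note t = tame_pmass tame_one
  have lims: "(\<lambda>n. measure_pmf.prob (iid_pmf n S) (E0 n)) \<longlonglongrightarrow> 0" "(\<lambda>n. measure_pmf.prob (iid_pmf n S) (E1 n)) \<longlonglongrightarrow> 0"
    "(\<lambda>n. measure_pmf.prob (iid_pmf n S) (E2 n)) \<longlonglongrightarrow> 0" "(\<lambda>n. measure_pmf.prob (iid_pmf n S) (E3 n)) \<longlonglongrightarrow> 0"
    unfolding E0_def E1_def E2_def E3_def
    by ((rule tame_ratio_tendsto, (rule t)+, simp add: e ent_def, rule \<delta>)+)
  have pm0: "pmf (marg_wt (J n)) (seq_map n W s, \<tau> n s) = ?P (W \<bowtie> \<theta>) s n" for s n
    unfolding J map_pmf_comp prod.case using pmass_iid[of "\<lambda>s. (seq_map n W s, \<tau> n s)" s n "W \<bowtie> \<theta>" S] by (auto simp: \<tau> seq_map_eq_iff)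
  have pm1: "pmf (marg_wut (J n)) (seq_map n W s, seq_map n U s, \<tau> n s) = ?P (W \<bowtie> U \<bowtie> \<theta>) s n" for s n
    unfolding J map_pmf_comp prod.case using pmass_iid[of "\<lambda>s. (seq_map n W s, seq_map n U s, \<tau> n s)" s n "W \<bowtie> U \<bowtie> \<theta>" S] by (auto simp: \<tau> seq_map_eq_iff)
  have pm2: "pmf (marg_wvt (J n)) (seq_map n W s, seq_map n V s, \<tau> n s) = ?P (W \<bowtie> V \<bowtie> \<theta>) s n" for s n
    unfolding J map_pmf_comp prod.case using pmass_iid[of "\<lambda>s. (seq_map n W s, seq_map n V s, \<tau> n s)" s n "W \<bowtie> V \<bowtie> \<theta>" S] by (auto simp: \<tau> seq_map_eq_iff)
  have pm3: "pmf (J n) (seq_map n W s, seq_map n U s, seq_map n V s, \<tau> n s) = ?P (W \<bowtie> U \<bowtie> V \<bowtie> \<theta>) s n" for s n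
    unfolding J map_pmf_comp prod.case using pmass_iid[of "\<lambda>s. (seq_map n W s, seq_map n U s, seq_map n V s, \<tau> n s)" s n "W \<bowtie> U \<bowtie> V \<bowtie> \<theta>" S] by (auto simp: \<tau> seq_map_eq_iff)
  have pm4: "pmf (marg_w (J n)) (seq_map n W s) = ?P W s n" for s n
    unfolding J map_pmf_comp prod.case using pmass_iid[of "\<lambda>s. seq_map n W s" s n "W" S] by (auto simp: \<tau> seq_map_eq_iff)
  have pm5: "pmf (marg_t (J n)) (\<tau> n s) = ?P \<theta> s n" for s n
    unfolding J map_pmf_comp prod.case using pmass_iid[of "\<lambda>s. \<tau> n s" s n "\<theta>" S] by (auto simp: \<tau> seq_map_eq_iff)
  have pm6: "pmf (marg_wu (J n)) (seq_map n W s, seq_map n U s) = ?P (W \<bowtie> U) s n" for s n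
    unfolding J map_pmf_comp prod.case using pmass_iid[of "\<lambda>s. (seq_map n W s, seq_map n U s)" s n "W \<bowtie> U" S] by (auto simp: \<tau> seq_map_eq_iff)
  have pm7: "pmf (marg_wv (J n)) (seq_map n W s, seq_map n V s) = ?P (W \<bowtie> V) s n" for s n
    unfolding J map_pmf_comp prod.case using pmass_iid[of "\<lambda>s. (seq_map n W s, seq_map n V s)" s n "W \<bowtie> V" S] by (auto simp: \<tau> seq_map_eq_iff)
  note pm = pm0 pm1 pm2 pm3 pm4 pm5 pm6 pm7
  let ?B = "\<lambda>n. {s. \<not> covering_typical (2 powr (real n * (e0 + \<delta>)))
      (2 powr (real n * (e1 + \<delta>))) (2 powr (real n * (e2 + \<delta>))) (2 powr (real n * (e3 + \<delta>))) (J n)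
      (seq_map n W s) (seq_map n U s) (seq_map n V s) (\<tau> n s)}"
  have "(\<lambda>n. measure_pmf.prob (iid_pmf n S) (?B n)) \<longlonglongrightarrow> 0"
  proof (rule measure_le_sum_tendsto[of "{0,1,2,3::nat}" _ "\<lambda>k n. if k = 0 then E0 n else if k = 1 then E1 n else if k = 2 then E2 n else E3 n"])
    show "?B n \<subseteq> (\<Union>k\<in>{0,1,2,3::nat}. if k = 0 then E0 n else if k = 1 then E1 n else if k = 2 then E2 n else E3 n)" for n
      unfolding covering_typical_def pm E0_def E1_def E2_def E3_def by auto
  qed (use lims in auto)
  moreover have "measure_pmf.prob (J n) {(w, u, v, t). \<not> covering_typical (2 powr (real n * (e0 + \<delta>)))
      (2 powr (real n * (e1 + \<delta>))) (2 powr (real n * (e2 + \<delta>))) (2 powr (real n * (e3 + \<delta>))) (J n) w u v t}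
    = measure_pmf.prob (iid_pmf n S) (?B n)" for n
    by (subst (1) J, subst measure_map_pmf) (rule arg_cong[where f = "measure_pmf.prob (iid_pmf n S)"], auto)
  ultimately show ?thesis by simp
qed

text \<open>The exponents are I(W U; \<theta>) and I(U; \<theta> | W), lowered by \<delta> since
  decoding needs lower bounds on information densities.\<close>

lemma decodable_tendsto:
  fixes W :: "'s \<Rightarrow> 'w::finite" and U :: "'s \<Rightarrow> 'u::finite" and \<theta> :: "'s \<Rightarrow> 't::finite"
  assumes J: "\<And>n. J n = map_pmf (\<lambda>s. (seq_map n W s, seq_map n U s, seq_map n \<theta> s)) (iid_pmf n S)"
    and e: "e0 = ent S (W \<bowtie> U) + ent S \<theta> - ent S (W \<bowtie> U \<bowtie> \<theta>)"
      "e1 = ent S (W \<bowtie> U) + ent S (W \<bowtie> \<theta>) - ent S W - ent S (W \<bowtie> U \<bowtie> \<theta>)"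
    and \<delta>: "\<delta> > 0"
  shows "(\<lambda>n. measure_pmf.prob (J n) {(w, u, t). \<not> decodable (2 powr (real n * (e0 - \<delta>)))
      (2 powr (real n * (e1 - \<delta>))) (J n) w u t}) \<longlonglongrightarrow> 0"
proof -
  let ?P = "\<lambda>A (s :: nat \<Rightarrow> 's) n. \<Prod>i<n. pmass S A (s i)"
  define E0 where "E0 n = {s. \<not> ?P (W \<bowtie> U) s n * ?P \<theta> s n \<le> 2 powr (real n * (- e0 + \<delta>)) * (?P (W \<bowtie> U \<bowtie> \<theta>) s n * (\<Prod>i<n. 1) * (\<Prod>i<n. 1))}" for n
  define E1 where "E1 n = {s. \<not> ?P (W \<bowtie> U) s n * ?P (W \<bowtie> \<theta>) s n \<le> 2 powr (real n * (- e1 + \<delta>)) * (?P (W \<bowtie> U \<bowtie> \<theta>) s n * ?P W s n * (\<Prod>i<n. 1))}" for n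
  note t = tame_pmass tame_one
  have lims: "(\<lambda>n. measure_pmf.prob (iid_pmf n S) (E0 n)) \<longlonglongrightarrow> 0" "(\<lambda>n. measure_pmf.prob (iid_pmf n S) (E1 n)) \<longlonglongrightarrow> 0"
    unfolding E0_def E1_def
    by ((rule tame_ratio_tendsto, (rule t)+, simp add: e ent_def, rule \<delta>)+)
  have pm0: "pmf (J n) (seq_map n W s, seq_map n U s, seq_map n \<theta> s) = ?P (W \<bowtie> U \<bowtie> \<theta>) s n" for s n
    unfolding J map_pmf_comp prod.case using pmass_iid[of "\<lambda>s. (seq_map n W s, seq_map n U s, seq_map n \<theta> s)" s n "W \<bowtie> U \<bowtie> \<theta>" S] by (auto simp: seq_map_eq_iff)
  have pm1: "pmf (map_pmf (\<lambda>(w, u, t). w) (J n)) (seq_map n W s) = ?P W s n" for s n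
    unfolding J map_pmf_comp prod.case using pmass_iid[of "\<lambda>s. seq_map n W s" s n "W" S] by (auto simp: seq_map_eq_iff)
  have pm2: "pmf (map_pmf (\<lambda>(w, u, t). t) (J n)) (seq_map n \<theta> s) = ?P \<theta> s n" for s n
    unfolding J map_pmf_comp prod.case using pmass_iid[of "\<lambda>s. seq_map n \<theta> s" s n "\<theta>" S] by (auto simp: seq_map_eq_iff)
  have pm3: "pmf (map_pmf (\<lambda>(w, u, t). (w, u)) (J n)) (seq_map n W s, seq_map n U s) = ?P (W \<bowtie> U) s n" for s n
    unfolding J map_pmf_comp prod.case using pmass_iid[of "\<lambda>s. (seq_map n W s, seq_map n U s)" s n "W \<bowtie> U" S] by (auto simp: seq_map_eq_iff)
  have pm4: "pmf (map_pmf (\<lambda>(w, u, t). (w, t)) (J n)) (seq_map n W s, seq_map n \<theta> s) = ?P (W \<bowtie> \<theta>) s n" for s n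
    unfolding J map_pmf_comp prod.case using pmass_iid[of "\<lambda>s. (seq_map n W s, seq_map n \<theta> s)" s n "W \<bowtie> \<theta>" S] by (auto simp: seq_map_eq_iff)
  note pm = pm0 pm1 pm2 pm3 pm4
  \<comment> \<open>Turns lower bounds on information densities into the upper bounds on likelihood
    ratios that the law of large numbers provides.\<close>
  have flip: "2 powr (real n * (k - \<delta>)) * x \<le> y \<longleftrightarrow> x \<le> 2 powr (real n * (- k + \<delta>)) * y" for n k x y
  proof -
    define c where "c = 2 powr (real n * (k - \<delta>))"
    have "2 powr (real n * (- k + \<delta>)) = 2 powr (- (real n * (k - \<delta>)))" by (simp add: algebra_simps)
    then have "2 powr (real n * (- k + \<delta>)) = 1 / c" by (simp add: c_def powr_minus_divide)
    moreover have "c * x \<le> y \<longleftrightarrow> x \<le> 1 / c * y" if "c > 0" using that by (simp add: field_simps)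
    moreover have "c > 0" by (simp add: c_def)
    ultimately show ?thesis unfolding c_def[symmetric] by simp
  qed
  let ?B = "\<lambda>n. {s. \<not> decodable (2 powr (real n * (e0 - \<delta>))) (2 powr (real n * (e1 - \<delta>))) (J n)
      (seq_map n W s) (seq_map n U s) (seq_map n \<theta> s)}"
  have "(\<lambda>n. measure_pmf.prob (iid_pmf n S) (?B n)) \<longlonglongrightarrow> 0"
  proof (rule measure_le_sum_tendsto[of "{0,1::nat}" _ "\<lambda>k n. if k = 0 then E0 n else E1 n"])
    show "?B n \<subseteq> (\<Union>k\<in>{0,1::nat}. if k = 0 then E0 n else E1 n)" for n
      unfolding decodable_def pm E0_def E1_def flip by auto
  qed (use lims in auto)
  moreover have "measure_pmf.prob (J n) {(w, u, t). \<not> decodable (2 powr (real n * (e0 - \<delta>)))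
      (2 powr (real n * (e1 - \<delta>))) (J n) w u t} = measure_pmf.prob (iid_pmf n S) (?B n)" for n
    by (subst (1) J, subst measure_map_pmf) (rule arg_cong[where f = "measure_pmf.prob (iid_pmf n S)"], auto)
  ultimately show ?thesis by simp
qed

section \<open>Blocks of length \<open>n\<close>\<close>

lemma set_Pi_seqs: "s \<in> set_pmf (Pi_pmf {..<n} undefined q) \<Longrightarrow> s \<in> seqs n"
  using set_Pi_pmf_subset[of "{..<n}" undefined q] by (auto simp: seqs_def PiE_def extensional_def)

lemma seq_map_seq_map: "seq_map n f (seq_map n g s) = seq_map n (\<lambda>a. f (g a)) s"
  by (auto simp: seq_map_def fun_eq_iff)

lemma finite_seqs: "finite (seqs n :: (nat \<Rightarrow> 'a :: finite) set)"
  by (simp add: seqs_def finite_PiE)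

definition seq_source :: "nat \<Rightarrow> ('x \<Rightarrow> ('u \<times> 'v \<times> 'w \<times> 'xt) pmf) \<Rightarrow> (nat \<Rightarrow> 'x)
    \<Rightarrow> ((nat \<Rightarrow> 'u) \<times> (nat \<Rightarrow> 'v) \<times> (nat \<Rightarrow> 'w) \<times> (nat \<Rightarrow> 'xt)) pmf" where
  "seq_source n A x = map_pmf (\<lambda>s. (seq_map n fst s, seq_map n (\<lambda>a. fst (snd a)) s,
     seq_map n (\<lambda>a. fst (snd (snd a))) s, seq_map n (\<lambda>a. snd (snd (snd a))) s))
     (Pi_pmf {..<n} undefined (\<lambda>i. A (x i)))"

definition seq_output :: "nat \<Rightarrow> ('a \<Rightarrow> 'b \<Rightarrow> 'c \<Rightarrow> 'd pmf) \<Rightarrow> (nat \<Rightarrow> 'a) \<Rightarrow> (nat \<Rightarrow> 'b) \<Rightarrow> (nat \<Rightarrow> 'c) \<Rightarrow> (nat \<Rightarrow> 'd) pmf" where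
  "seq_output n D a b c = Pi_pmf {..<n} undefined (\<lambda>i. D (a i) (b i) (c i))"

lemma set_seq_output: "set_pmf (seq_output n D a b c) \<subseteq> seqs n"
  by (auto simp: seq_output_def dest: set_Pi_seqs)

lemma pmf_seq_source:
  assumes "u \<in> seqs n" "v \<in> seqs n" "w \<in> seqs n" "xt \<in> seqs n"
  shows "pmf (seq_source n A x) (u, v, w, xt) = (\<Prod>i<n. pmf (A (x i)) (u i, v i, w i, xt i))"
proof -
  let ?g = "\<lambda>s. (seq_map n fst s, seq_map n (\<lambda>a. fst (snd a)) s,
     seq_map n (\<lambda>a. fst (snd (snd a))) s, seq_map n (\<lambda>a. snd (snd (snd a))) s)"
  let ?s = "\<lambda>i. (u i, v i, w i, xt i)"
  have "?g ?s = (u, v, w, xt)"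
    using assms by (simp add: seq_map_def seqs_def PiE_def extensional_restrict)
  moreover have "pmf (map_pmf ?g (Pi_pmf {..<n} undefined (\<lambda>i. A (x i)))) (?g ?s)
    = (\<Prod>i<n. pmf (map_pmf (\<lambda>a. a) (A (x i))) (?s i))"
    by (rule pmf_map_Pi_seqs[where h = "\<lambda>a. a"]) (auto simp: seq_map_eq_iff prod_eq_iff)
  ultimately show ?thesis by (simp add: seq_source_def)
qed

text \<open>Composing the block versions of all channels gives n independent copies of the joint
  law, because both masses are the same product over positions. Tuples with a component outside
  \<open>seqs n\<close> have mass zero on both sides.\<close>

lemma auxiliary_joint_seqs:
  fixes A :: "'x \<Rightarrow> ('u \<times> 'v \<times> 'w \<times> 'xt) pmf" and K :: "'xt \<Rightarrow> ('yt \<times> 'zt) pmf"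
    and D1 :: "'yt \<Rightarrow> 'u \<Rightarrow> 'w \<Rightarrow> 'y pmf" and D2 :: "'zt \<Rightarrow> 'v \<Rightarrow> 'w \<Rightarrow> 'z pmf"
  shows "auxiliary_joint (iid_pmf n p) (seq_source n A) (memoryless n K) (seq_output n D1) (seq_output n D2)
    = map_pmf (\<lambda>s. (seq_map n fst s, seq_map n (\<lambda>a. fst (snd a)) s, seq_map n (\<lambda>a. fst (snd (snd a))) s,
        seq_map n (\<lambda>a. fst (snd (snd (snd a)))) s, seq_map n (\<lambda>a. fst (snd (snd (snd (snd a))))) s,
        seq_map n (\<lambda>a. fst (snd (snd (snd (snd (snd a)))))) s, seq_map n (\<lambda>a. fst (snd (snd (snd (snd (snd (snd a))))))) s,
        seq_map n (\<lambda>a. fst (snd (snd (snd (snd (snd (snd (snd a)))))))) s, seq_map n (\<lambda>a. snd (snd (snd (snd (snd (snd (snd (snd a)))))))) s))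
      (iid_pmf n (auxiliary_joint p A K D1 D2))" (is "?L = map_pmf ?g ?M")
proof (rule pmf_eqI)
  fix c :: "(nat \<Rightarrow> 'x) \<times> (nat \<Rightarrow> 'u) \<times> (nat \<Rightarrow> 'v) \<times> (nat \<Rightarrow> 'w) \<times> (nat \<Rightarrow> 'xt) \<times> (nat \<Rightarrow> 'yt) \<times> (nat \<Rightarrow> 'zt) \<times> (nat \<Rightarrow> 'y) \<times> (nat \<Rightarrow> 'z)"
  obtain x u v w xt yt r where "c = (x, u, v, w, xt, yt, r)" by (cases c rule: prod_cases7)
  moreover obtain zt y z where "r = (zt, y, z)" by (cases r rule: prod_cases3)
  ultimately have c: "c = (x, u, v, w, xt, yt, zt, y, z)" by simp
  show "pmf ?L c = pmf (map_pmf ?g ?M) c"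
  proof (cases "x \<in> seqs n \<and> u \<in> seqs n \<and> v \<in> seqs n \<and> w \<in> seqs n \<and> xt \<in> seqs n \<and> yt \<in> seqs n \<and> zt \<in> seqs n \<and> y \<in> seqs n \<and> z \<in> seqs n")
    case True
    let ?s = "\<lambda>i. (x i, u i, v i, w i, xt i, yt i, zt i, y i, z i)"
    have gs: "?g ?s = c" using True by (simp add: c seq_map_def seqs_def PiE_def extensional_restrict)
    have "pmf (map_pmf ?g ?M) (?g ?s) = (\<Prod>i<n. pmf (map_pmf (\<lambda>a. a) (auxiliary_joint p A K D1 D2)) (?s i))"
      by (rule pmf_map_iid_seqs[where h = "\<lambda>a. a"]) (auto simp: seq_map_eq_iff prod_eq_iff)
    then have R: "pmf (map_pmf ?g ?M) c = (\<Prod>i<n. pmf p (x i) * pmf (A (x i)) (u i, v i, w i, xt i) * pmf (K (xt i)) (yt i, zt i)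
       * pmf (D1 (yt i) (u i) (w i)) (y i) * pmf (D2 (zt i) (v i) (w i)) (z i))"
      unfolding gs by (simp add: pmf_auxiliary_joint)
    have out: "pmf (seq_output n D a b e) d = (\<Prod>i<n. pmf (D (a i) (b i) (e i)) (d i))" if "d \<in> seqs n" for D :: "'aa \<Rightarrow> 'bb \<Rightarrow> 'ee \<Rightarrow> 'dd pmf" and a b e d
      unfolding seq_output_def using that by (subst pmf_Pi') (auto simp: seqs_def PiE_def extensional_def)
    show ?thesis unfolding R unfolding c pmf_auxiliary_joint
      using True by (simp add: pmf_iid_pmf pmf_seq_source pmf_memoryless out prod.distrib)
  next
    case False
    have "pmf (map_pmf ?g ?M) c = 0"
    proof -
      have "c \<notin> set_pmf (map_pmf ?g ?M)" using False by (auto simp: c)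
      then show ?thesis by (rule pmf_eq_0_set_pmf[THEN iffD2])
    qed
    moreover have "c \<notin> set_pmf ?L"
      using False
      by (auto simp: c auxiliary_joint_def seq_source_def memoryless_def iid_pmf_def
          dest: set_Pi_seqs subsetD[OF set_seq_output])
    then have "pmf ?L c = 0" by (simp add: set_pmf_iff)
    ultimately show ?thesis by simp
  qed
qed

locale simulation_setup =
  fixes p :: "'x::finite pmf"
    and T :: "'x \<Rightarrow> ('y::finite \<times> 'z::finite) pmf"
    and K :: "'xt::finite \<Rightarrow> ('yt::finite \<times> 'zt::finite) pmf"
    and R :: real
    and A :: "'x \<Rightarrow> ('u::finite \<times> 'v::finite \<times> 'w::finite \<times> 'xt) pmf"
    and D1 :: "'yt \<Rightarrow> 'u \<Rightarrow> 'w \<Rightarrow> 'y pmf"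
    and D2 :: "'zt \<Rightarrow> 'v \<Rightarrow> 'w \<Rightarrow> 'z pmf"
    and S :: "'s pmf"
    and X :: "'s \<Rightarrow> 'x" and U :: "'s \<Rightarrow> 'u" and V :: "'s \<Rightarrow> 'v" and W :: "'s \<Rightarrow> 'w"
    and Xt :: "'s \<Rightarrow> 'xt" and Yt :: "'s \<Rightarrow> 'yt" and Zt :: "'s \<Rightarrow> 'zt"
    and Y :: "'s \<Rightarrow> 'y" and Z :: "'s \<Rightarrow> 'z"
  assumes R_nonneg: "R \<ge> 0"
    and joint_eq: "map_pmf (X \<bowtie> U \<bowtie> V \<bowtie> W \<bowtie> Xt \<bowtie> Yt \<bowtie> Zt \<bowtie> Y \<bowtie> Z) S = auxiliary_joint p A K D1 D2"
    and target_eq: "map_pmf (X \<bowtie> Y \<bowtie> Z) S = source_target p T"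
begin

abbreviation "Pn n \<equiv> auxiliary_joint (iid_pmf n p) (seq_source n A) (memoryless n K) (seq_output n D1) (seq_output n D2)"

lemma Pn_eq: "Pn n = map_pmf (\<lambda>s. (seq_map n X s, seq_map n U s, seq_map n V s, seq_map n W s, seq_map n Xt s,
    seq_map n Yt s, seq_map n Zt s, seq_map n Y s, seq_map n Z s)) (iid_pmf n S)"
  unfolding auxiliary_joint_seqs joint_eq[symmetric] map_seq_map_iid_pmf[symmetric] map_pmf_comp seq_map_seq_map
  by simp

lemma iid_triple_eq: "iid_triple n (source_target p T)
    = map_pmf (\<lambda>s. (seq_map n X s, seq_map n Y s, seq_map n Z s)) (iid_pmf n S)"
  unfolding iid_triple_def target_eq[symmetric] map_seq_map_iid_pmf[symmetric] map_pmf_comp seq_map_seq_map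
  by simp

definition "JXn n = map_pmf (\<lambda>s. (seq_map n W s, seq_map n U s, seq_map n V s, seq_map n X s)) (iid_pmf n S)"
definition "JTn n = map_pmf (\<lambda>s. (seq_map n W s, seq_map n U s, seq_map n V s, (seq_map n X s, seq_map n Y s, seq_map n Z s))) (iid_pmf n S)"
definition "JYn n = map_pmf (\<lambda>s. (seq_map n W s, seq_map n U s, seq_map n Yt s)) (iid_pmf n S)"
definition "JZn n = map_pmf (\<lambda>s. (seq_map n W s, seq_map n V s, seq_map n Zt s)) (iid_pmf n S)"

text \<open>Rounding 2^(nR) down loses at most a factor 2, as this number is at least 1; such a
  factor is invisible at the exponential scale.\<close>

lemma messages: "finite (messages n R)" "messages n R \<noteq> {}" "2 powr (real n * R) / 2 \<le> card (messages n R)"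
proof -
  have ge1: "2 powr (real n * R) \<ge> 1" using R_nonneg by (simp add: ge_one_powr_ge_zero)
  then have fl: "\<lfloor>2 powr (real n * R)\<rfloor> \<ge> 1" by simp
  have card: "real (card (messages n R)) = of_int \<lfloor>2 powr (real n * R)\<rfloor>" using fl by (simp add: messages_def)
  have "nat \<lfloor>2 powr (real n * R)\<rfloor> \<ge> 1" using fl by linarith
  then show "finite (messages n R)" "messages n R \<noteq> {}" by (auto simp: messages_def)
  have "2 powr (real n * R) < of_int \<lfloor>2 powr (real n * R)\<rfloor> + 1" by linarith
  moreover have "(1::real) \<le> of_int \<lfloor>2 powr (real n * R)\<rfloor>" using fl by linarith
  ultimately show "2 powr (real n * R) / 2 \<le> card (messages n R)" unfolding card by linarith
qed

text \<open>The one-shot bound with sequences as letters and \<open>messages n R\<close> as the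
  range of the shared randomness.\<close>

lemma n_letter_simulation:
  assumes M: "M0 > 0" "M1 > 0" "M2 > 0"
    and \<beta>: "\<beta>0 \<ge> 0" "\<beta>1 \<ge> 0" "\<beta>2 \<ge> 0" "\<beta>3 \<ge> 0"
    and \<beta>': "\<beta>0' \<ge> 0" "\<beta>1' \<ge> 0" "\<beta>2' \<ge> 0" "\<beta>3' \<ge> 0"
    and \<gamma>: "\<gamma>0 > 0" "\<gamma>1 > 0" and \<gamma>': "\<gamma>0' > 0" "\<gamma>1' > 0"
  shows "\<exists>enc dec1 dec2. is_code n R enc dec1 dec2 \<and>
    2 * tv_dist (induced_marginal n R p K enc dec1 dec2) (iid_triple n (source_target p T))
    \<le> (2 * measure_pmf.prob (JXn n) {(w, u, v, t). \<not> covering_typical \<beta>0 \<beta>1 \<beta>2 \<beta>3 (JXn n) w u v t}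
      + sqrt ((\<beta>0 + \<beta>1 / real M1 + \<beta>2 / real M2 + \<beta>3 / (real M1 * real M2)) / real M0))
    + (2 * measure_pmf.prob (JTn n) {(w, u, v, t). \<not> covering_typical \<beta>0' \<beta>1' \<beta>2' \<beta>3' (JTn n) w u v t}
      + sqrt ((\<beta>0' + \<beta>1' / real M1 + \<beta>2' / real M2 + \<beta>3' / (real M1 * real M2)) / real (card (messages n R) * M0)))
    + 2 * ((measure_pmf.prob (JYn n) {(w, u, t). \<not> decodable \<gamma>0 \<gamma>1 (JYn n) w u t} + real M0 * real M1 / \<gamma>0 + real (M1 - 1) / \<gamma>1)
         + (measure_pmf.prob (JZn n) {(w, u, t). \<not> decodable \<gamma>0' \<gamma>1' (JZn n) w u t} + real M0 * real M2 / \<gamma>0' + real (M2 - 1) / \<gamma>1'))"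
proof -
  interpret os: one_shot "iid_pmf n p" "seq_source n A" "memoryless n K" "seq_output n D1" "seq_output n D2" "seqs n" "messages n R" M0 M1 M2
  proof unfold_locales
    have fP: "finite (set_pmf (Pi_pmf {..<n} undefined q))" for q :: "nat \<Rightarrow> 'q::finite pmf"
      by (rule finite_set_Pi_pmf) auto
    show "finite (set_pmf (iid_pmf n p))" by (simp add: iid_pmf_def fP)
    show "finite (set_pmf (seq_source n A x))" for x by (simp add: seq_source_def fP)
    show "finite (set_pmf (memoryless n K xt))" for xt by (simp add: memoryless_def fP)
    show "finite (set_pmf (seq_output n D1 yt u w))" for yt u w by (simp add: seq_output_def fP)
    show "finite (set_pmf (seq_output n D2 zt v w))" for zt v w by (simp add: seq_output_def fP)
    show "(u, v, w, xt) \<in> set_pmf (seq_source n A x) \<Longrightarrow> xt \<in> seqs n" for u v w xt x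
      by (auto simp: seq_source_def)
  qed (use messages M finite_seqs in auto)
  have laws: "os.law (\<lambda>x xt yt zt y z. x) = JXn n" "os.law (\<lambda>x xt yt zt y z. (x, y, z)) = JTn n"
    "marg_wut (os.law (\<lambda>x xt yt zt y z. yt)) = JYn n"
    "marg_wvt (os.law (\<lambda>x xt yt zt y z. zt)) = JZn n"
    by (simp_all add: os.law_def Pn_eq map_pmf_comp JXn_def JTn_def JYn_def JZn_def)
  have tgt: "map_pmf (\<lambda>(x, u, v, w, xt, yt, zt, y, z). (x, y, z)) (Pn n) = iid_triple n (source_target p T)"
    by (simp add: Pn_eq map_pmf_comp iid_triple_eq)
  have sim: "os.sim enc d1 d2 = induced_marginal n R p K enc d1 d2" for enc d1 d2
    by (simp add: os.sim_def induced_marginal_def induced_def case_prod_unfold bind_assoc_pmf bind_return_pmf)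
  from os.one_shot_simulation[OF \<beta> \<beta>' \<gamma> \<gamma>' set_seq_output set_seq_output]
  show ?thesis
    unfolding os.cov_err_def os.pack_err_def laws tgt sim is_code_def is_seq_kernel_def
    apply (elim exE conjE)
    subgoal for enc d1 d2
      by (rule exI[of _ enc], rule exI[of _ d1], rule exI[of _ d2]) blast
    done
qed

end

section \<open>Entropies and rates\<close>

lemma sum_pmf_map_eq_expect:
  fixes f :: "'s \<Rightarrow> 'a::finite"
  shows "(\<Sum>c\<in>UNIV. pmf (map_pmf f S) c * g c) = expect S (\<lambda>s. g (f s))"
proof -
  have "expect (map_pmf f S) g = (\<Sum>c\<in>UNIV. pmf (map_pmf f S) c * g c)"
    by (subst integral_measure_pmf[of UNIV]) auto
  then show ?thesis by simp
qed

lemma mutual_info_eq_ent: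
  fixes A :: "'s \<Rightarrow> 'a::finite" and B :: "'s \<Rightarrow> 'b::finite"
  shows "\<I>\<^bsub>S\<^esub>(A ; B) = ent S A + ent S B - ent S (A \<bowtie> B)"
proof -
  have "\<I>\<^bsub>S\<^esub>(A ; B) = expect S (\<lambda>s. log 2 (pmass S (A \<bowtie> B) s / (pmass S A s * pmass S B s)))"
    unfolding mutual_info_eq case_prod_unfold prod.collapse sum_pmf_map_eq_expect by (simp add: pmass_def)
  also have "\<dots> = expect S (\<lambda>s. log 2 (pmass S (A \<bowtie> B) s) - log 2 (pmass S A s * pmass S B s))"
  proof (intro expect_cong)
    fix s assume s: "s \<in> set_pmf S"
    have "pmass S (A \<bowtie> B) s > 0" "pmass S A s > 0" "pmass S B s > 0"
      using s by (simp_all add: pmass_def pmf_positive)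
    then show "log 2 (pmass S (A \<bowtie> B) s / (pmass S A s * pmass S B s))
      = log 2 (pmass S (A \<bowtie> B) s) - log 2 (pmass S A s * pmass S B s)"
      by (simp add: log_divide)
  qed
  also have "\<dots> = expect S (\<lambda>s. log 2 (pmass S (A \<bowtie> B) s)) - expect S (\<lambda>s. log 2 (pmass S A s * pmass S B s))"
    by (intro Bochner_Integration.integral_diff tame_integrable_log tame_mult tame_pmass)
  finally show ?thesis by (simp add: expect_log_mult tame_pmass ent_def)
qed

lemma cond_mutual_info_eq_ent:
  fixes A :: "'s \<Rightarrow> 'a::finite" and B :: "'s \<Rightarrow> 'b::finite" and C :: "'s \<Rightarrow> 'c::finite"
  shows "\<I>\<^bsub>S\<^esub>(A ; B \<bar> C) = ent S (A \<bowtie> C) + ent S (B \<bowtie> C) - ent S C - ent S (A \<bowtie> B \<bowtie> C)"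
proof -
  have "\<I>\<^bsub>S\<^esub>(A ; B \<bar> C) = expect S (\<lambda>s. log 2 (pmass S (A \<bowtie> B \<bowtie> C) s / (pmass S (A \<bowtie> C) s * (pmass S (B \<bowtie> C) s / pmass S C s))))"
    unfolding cond_mutual_info_eq case_prod_unfold prod.collapse sum_pmf_map_eq_expect by (simp add: pmass_def)
  also have "\<dots> = expect S (\<lambda>s. log 2 (pmass S (A \<bowtie> B \<bowtie> C) s * pmass S C s) - log 2 (pmass S (A \<bowtie> C) s * pmass S (B \<bowtie> C) s))"
  proof (intro expect_cong)
    fix s assume s: "s \<in> set_pmf S"
    have "pmass S (A \<bowtie> B \<bowtie> C) s > 0" "pmass S (A \<bowtie> C) s > 0" "pmass S (B \<bowtie> C) s > 0" "pmass S C s > 0"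
      using s by (simp_all add: pmass_def pmf_positive)
    then show "log 2 (pmass S (A \<bowtie> B \<bowtie> C) s / (pmass S (A \<bowtie> C) s * (pmass S (B \<bowtie> C) s / pmass S C s)))
      = log 2 (pmass S (A \<bowtie> B \<bowtie> C) s * pmass S C s) - log 2 (pmass S (A \<bowtie> C) s * pmass S (B \<bowtie> C) s)"
      by (simp add: log_divide log_mult)
  qed
  also have "\<dots> = expect S (\<lambda>s. log 2 (pmass S (A \<bowtie> B \<bowtie> C) s * pmass S C s)) - expect S (\<lambda>s. log 2 (pmass S (A \<bowtie> C) s * pmass S (B \<bowtie> C) s))"
    by (intro Bochner_Integration.integral_diff tame_integrable_log tame_mult tame_pmass)
  finally show ?thesis by (simp add: expect_log_mult tame_pmass ent_def)
qed

lemma cond_mutual_info_nonneg: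
  fixes A :: "'s \<Rightarrow> 'a::finite" and B :: "'s \<Rightarrow> 'b::finite" and C :: "'s \<Rightarrow> 'c::finite"
  shows "0 \<le> \<I>\<^bsub>S\<^esub>(A ; B \<bar> C)"
proof -
  interpret information_space "measure_pmf S" 2 by (rule information_space_pmf)
  have "simple_function S A" "simple_function S B" "simple_function S C" by (simp_all add: simple_function_def)
  then show ?thesis unfolding cond_mutual_info_def
    using conditional_mutual_information_nonneg[of A B C] by simp
qed

text \<open>Entropy depends only on the partition that a variable induces, so components can be
  reordered and regrouped at will.\<close>

lemma ent_cong:
  assumes "\<And>s s'. A s = A s' \<longleftrightarrow> B s = B s'"
  shows "ent S A = ent S B"
proof -
  have "A -` {A s} = B -` {B s}" for s using assms by auto
  then have "pmass S A = pmass S B" by (simp add: fun_eq_iff pmass_def pmf_map)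
  then show ?thesis by (simp add: ent_def)
qed

lemma mutual_info_nonneg:
  fixes A :: "'s \<Rightarrow> 'a::finite" and B :: "'s \<Rightarrow> 'b::finite"
  shows "0 \<le> \<I>\<^bsub>S\<^esub>(A ; B)"
proof -
  \<comment> \<open>Plain mutual information is the conditional one given a constant.\<close>
  have "ent S (\<lambda>_. ()) = 0" by (simp add: ent_def pmass_def)
  moreover have "ent S (A \<bowtie> (\<lambda>_. ())) = ent S A" "ent S (B \<bowtie> (\<lambda>_. ())) = ent S B"
    "ent S (A \<bowtie> B \<bowtie> (\<lambda>_. ())) = ent S (A \<bowtie> B)" by (auto intro!: ent_cong)
  ultimately show ?thesis
    using cond_mutual_info_nonneg[of S A B "\<lambda>_. ()"] by (simp add: mutual_info_eq_ent cond_mutual_info_eq_ent)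
qed

text \<open>The alternative \<open>r1 = 0\<close> covers the case \<open>C1 = 0\<close>: a single satellite needs no decoding.\<close>

lemma rates_exist:
  fixes L0 L1 L2 L3 C1 C2 C01 C02 :: real
  assumes "0 \<le> L0" "L0 \<le> L1" "L0 \<le> L2" "L1 \<le> L3" "L2 \<le> L3" "0 \<le> C1" "0 \<le> C2" "C1 \<le> C01" "C2 \<le> C02"
    and "L1 < C01" "L2 < C02" "L3 < C01 + C2" "L3 < C02 + C1" "L0 + L3 < C01 + C02"
  shows "\<exists>r0 r1 r2. 0 \<le> r1 \<and> 0 \<le> r2 \<and> L0 < r0 \<and> L1 < r0 + r1 \<and> L2 < r0 + r2 \<and> L3 < r0 + r1 + r2
    \<and> (r1 < C1 \<or> r1 = 0) \<and> r0 + r1 < C01 \<and> (r2 < C2 \<or> r2 = 0) \<and> r0 + r2 < C02"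
proof -
  \<comment> \<open>Fourier-Motzkin elimination: at a given \<open>r0\<close> the best choices are
    \<open>r1\<close> just below \<open>min C1 (C01 - r0)\<close> and \<open>r2\<close> just below
    \<open>min C2 (C02 - r0)\<close>. Demanding that these suffice leaves the bounds
    \<open>lb\<close> and \<open>ub\<close> on \<open>r0\<close>.\<close>
  define lb where "lb = max (max L0 (L1 - C1)) (max (L2 - C2) (L3 - C1 - C2))"
  define ub where "ub = min (min C01 C02) (C01 + C02 - L3)"
  have lt: "lb < ub" using assms unfolding lb_def ub_def by (simp add: max_def min_def) 
  define r0 where "r0 = (lb + ub) / 2"
  have lb: "L0 < r0" "L1 - C1 < r0" "L2 - C2 < r0" "L3 - C1 - C2 < r0"
    and ub: "r0 < C01" "r0 < C02" "r0 < C01 + C02 - L3"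
    using lt unfolding r0_def by (auto simp: lb_def ub_def)
  define m1 where "m1 = min C1 (C01 - r0)"
  define m2 where "m2 = min C2 (C02 - r0)"
  have m: "L1 < r0 + m1" "L2 < r0 + m2" "L3 < r0 + m1 + m2"
    using lb ub assms unfolding m1_def m2_def by (auto simp: min_def)
  \<comment> \<open>The satellite rates must stay strictly below their maxima. The slack for
    \<open>L3\<close> is used up by both reductions at once, and a quarter of the smallest slack
    leaves room for that.\<close>
  define \<epsilon> where "\<epsilon> = min (min (r0 + m1 - L1) (r0 + m2 - L2)) (r0 + m1 + m2 - L3) / 4"
  have \<epsilon>: "\<epsilon> > 0" "L1 < r0 + m1 - \<epsilon>" "L2 < r0 + m2 - \<epsilon>" "L3 < r0 + m1 + m2 - 2 * \<epsilon>"
  proof -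
    show "\<epsilon> > 0" using m by (simp add: \<epsilon>_def)
    then have "4 * \<epsilon> \<le> r0 + m1 - L1" "4 * \<epsilon> \<le> r0 + m2 - L2" "4 * \<epsilon> \<le> r0 + m1 + m2 - L3"
      by (simp_all add: \<epsilon>_def)
    then show "L1 < r0 + m1 - \<epsilon>" "L2 < r0 + m2 - \<epsilon>" "L3 < r0 + m1 + m2 - 2 * \<epsilon>"
      using \<open>\<epsilon> > 0\<close> by linarith+
  qed
  \<comment> \<open>The cut at 0 takes effect when \<open>m1\<close> is below
    \<open>\<epsilon>\<close>; then \<open>r1 = 0\<close>, which is the permitted
    alternative.\<close>
  define r1 where "r1 = max 0 (m1 - \<epsilon>)"
  define r2 where "r2 = max 0 (m2 - \<epsilon>)"
  have "0 \<le> r1 \<and> 0 \<le> r2 \<and> m1 - \<epsilon> \<le> r1 \<and> m2 - \<epsilon> \<le> r2 \<and> (r1 < C1 \<or> r1 = 0) \<and> r0 + r1 < C01 \<and> (r2 < C2 \<or> r2 = 0) \<and> r0 + r2 < C02"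
    using \<epsilon>(1) ub unfolding r1_def r2_def m1_def m2_def by (auto simp: max_def min_def)
  then show ?thesis using lb(1) \<epsilon> by (intro exI[of _ r0] exI[of _ r1] exI[of _ r2]) linarith
qed

section \<open>Codebook sizes and vanishing error terms\<close>

definition codebook_size :: "real \<Rightarrow> nat \<Rightarrow> nat" where
  "codebook_size r n = nat \<lceil>2 powr (real n * r)\<rceil>"

text \<open>Rounding up costs at most a factor 2 and gives exactly one codeword at rate 0. In the
  last bound the subtraction of 1 absorbs the rounding.\<close>

lemma codebook_size_bounds:
  assumes "r \<ge> 0"
  shows "codebook_size r n > 0" "2 powr (real n * r) \<le> real (codebook_size r n)" "real (codebook_size r n) \<le> 2 * 2 powr (real n * r)"
    "real (codebook_size r n - 1) \<le> (if r = 0 then 0 else 2 powr (real n * r))"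
proof -
  have ge1: "2 powr (real n * r) \<ge> 1" using assms by (simp add: ge_one_powr_ge_zero)
  then have c: "\<lceil>2 powr (real n * r)\<rceil> \<ge> 1" by linarith
  have eq: "real (codebook_size r n) = of_int \<lceil>2 powr (real n * r)\<rceil>" using c by (simp add: codebook_size_def)
  have lt: "of_int \<lceil>2 powr (real n * r)\<rceil> < 2 powr (real n * r) + 1" by linarith
  show pos: "codebook_size r n > 0" unfolding codebook_size_def using c by linarith
  show "2 powr (real n * r) \<le> real (codebook_size r n)" unfolding eq by linarith
  show "real (codebook_size r n) \<le> 2 * 2 powr (real n * r)" using lt ge1 unfolding eq by linarith
  have "real (codebook_size r n - 1) = real (codebook_size r n) - 1" using pos by (simp add: of_nat_diff)
  then have "real (codebook_size r n - 1) \<le> 2 powr (real n * r)" using lt unfolding eq by linarith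
  moreover have "codebook_size r n = 1" if "r = 0" using that by (simp add: codebook_size_def)
  ultimately show "real (codebook_size r n - 1) \<le> (if r = 0 then 0 else 2 powr (real n * r))" by simp
qed

lemma powr_tendsto_0:
  assumes "c < (0 :: real)"
  shows "(\<lambda>n. C * 2 powr (real n * c)) \<longlonglongrightarrow> 0"
proof -
  have "(\<lambda>n. C * 2 powr (- (real n * k))) \<longlonglongrightarrow> 0" if "k > 0" for k :: real
    using that by real_asymp
  from this[of "- c"] show ?thesis using assms by simp
qed

lemma tendsto_0_if_le_powr:
  fixes f :: "nat \<Rightarrow> real"
  assumes "\<And>n. 0 \<le> f n" "\<And>n. f n \<le> C * 2 powr (real n * c)" "c < 0"
  shows "f \<longlonglongrightarrow> 0"
  by (rule tendsto_sandwich[OF _ _ tendsto_const powr_tendsto_0[OF assms(3), where C = C]]) (auto simp: assms)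

text \<open>Four exponents against four rates: \<open>\<rho>\<close> is the rate of independent
  clusters, to which the satellites add \<open>r1\<close>, \<open>r2\<close> or both. The constant
  \<open>c\<close> absorbs the rounding of the number of messages.\<close>

lemma covering_rate_tendsto:
  fixes k :: "nat \<Rightarrow> nat"
  assumes r: "r1 \<ge> 0" "r2 \<ge> 0" and c: "c > 0" and k: "\<And>n. real (k n) \<ge> c * 2 powr (real n * \<rho>)"
    and e: "e0 + \<delta> < \<rho>" "e1 + \<delta> < \<rho> + r1" "e2 + \<delta> < \<rho> + r2" "e3 + \<delta> < \<rho> + r1 + r2"
  shows "(\<lambda>n. sqrt ((2 powr (real n * (e0 + \<delta>)) + 2 powr (real n * (e1 + \<delta>)) / real (codebook_size r1 n)
     + 2 powr (real n * (e2 + \<delta>)) / real (codebook_size r2 n)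
     + 2 powr (real n * (e3 + \<delta>)) / (real (codebook_size r1 n) * real (codebook_size r2 n))) / real (k n))) \<longlonglongrightarrow> 0"
proof -
  have kpos: "real (k n) > 0" for n using k[of n] c by (smt (verit) mult_pos_pos powr_gt_zero)
  have *: "(\<lambda>n. 2 powr (real n * a) / m n / real (k n)) \<longlonglongrightarrow> 0"
    if m: "\<And>n. m n \<ge> 2 powr (real n * s)" and a: "a < \<rho> + s" for m :: "nat \<Rightarrow> real" and a s
  proof (rule tendsto_0_if_le_powr[of _ "1 / c" "a - s - \<rho>"])
    fix n
    have mp: "m n > 0" using m[of n] by (smt (verit) powr_gt_zero)
    show "0 \<le> 2 powr (real n * a) / m n / real (k n)" using mp kpos[of n] by simp
    have "2 powr (real n * s) * (c * 2 powr (real n * \<rho>)) \<le> m n * real (k n)"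
      using m[of n] k[of n] mp c by (intro mult_mono) auto
    then have "2 powr (real n * a) / (m n * real (k n)) \<le> 2 powr (real n * a) / (2 powr (real n * s) * (c * 2 powr (real n * \<rho>)))"
      using mp kpos[of n] c by (intro divide_left_mono) auto
    also have "\<dots> = 1 / c * 2 powr (real n * (a - s - \<rho>))"
      by (simp add: right_diff_distrib powr_diff)
    finally show "2 powr (real n * a) / m n / real (k n) \<le> 1 / c * 2 powr (real n * (a - s - \<rho>))" by simp
  qed (use a in simp)
  have n12: "real (codebook_size r1 n) * real (codebook_size r2 n) \<ge> 2 powr (real n * (r1 + r2))" for n
    unfolding distrib_left powr_add using codebook_size_bounds[OF r(1), of n] codebook_size_bounds[OF r(2), of n] by (intro mult_mono) auto
  have "(\<lambda>n. 2 powr (real n * (e0 + \<delta>)) / 1 / real (k n) + 2 powr (real n * (e1 + \<delta>)) / real (codebook_size r1 n) / real (k n)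
     + 2 powr (real n * (e2 + \<delta>)) / real (codebook_size r2 n) / real (k n)
     + 2 powr (real n * (e3 + \<delta>)) / (real (codebook_size r1 n) * real (codebook_size r2 n)) / real (k n)) \<longlonglongrightarrow> 0 + 0 + 0 + 0"
  proof (intro tendsto_add)
    show "(\<lambda>n. 2 powr (real n * (e0 + \<delta>)) / 1 / real (k n)) \<longlonglongrightarrow> 0"
      by (rule *[where s = 0]) (use e in auto)
    show "(\<lambda>n. 2 powr (real n * (e1 + \<delta>)) / real (codebook_size r1 n) / real (k n)) \<longlonglongrightarrow> 0"
      by (rule *[where s = r1]) (use e codebook_size_bounds r in auto)
    show "(\<lambda>n. 2 powr (real n * (e2 + \<delta>)) / real (codebook_size r2 n) / real (k n)) \<longlonglongrightarrow> 0"
      by (rule *[where s = r2]) (use e codebook_size_bounds r in auto)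
    show "(\<lambda>n. 2 powr (real n * (e3 + \<delta>)) / (real (codebook_size r1 n) * real (codebook_size r2 n)) / real (k n)) \<longlonglongrightarrow> 0"
      by (rule *[where s = "r1 + r2"]) (use e n12 in auto)
  qed
  from tendsto_real_sqrt[OF this] show ?thesis by (simp add: add_divide_distrib)
qed

text \<open>At \<open>r1 = 0\<close> the second term is identically zero because there is no rival
  satellite, whatever the value of \<open>e1\<close>.\<close>

lemma packing_rate_tendsto:
  assumes r: "r0 \<ge> 0" "r1 \<ge> 0" and e: "r0 + r1 < e0 - \<delta>" "r1 = 0 \<or> r1 < e1 - \<delta>"
  shows "(\<lambda>n. real (codebook_size r0 n) * real (codebook_size r1 n) / 2 powr (real n * (e0 - \<delta>))
     + real (codebook_size r1 n - 1) / 2 powr (real n * (e1 - \<delta>))) \<longlonglongrightarrow> 0"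
proof -
  have "(\<lambda>n. real (codebook_size r0 n) * real (codebook_size r1 n) / 2 powr (real n * (e0 - \<delta>))) \<longlonglongrightarrow> 0"
  proof (rule tendsto_0_if_le_powr[of _ 4 "r0 + r1 - (e0 - \<delta>)"])
    fix n
    have "real (codebook_size r0 n) * real (codebook_size r1 n) \<le> (2 * 2 powr (real n * r0)) * (2 * 2 powr (real n * r1))"
      using codebook_size_bounds[OF r(1), of n] codebook_size_bounds[OF r(2), of n] by (intro mult_mono) auto
    then have "real (codebook_size r0 n) * real (codebook_size r1 n) / 2 powr (real n * (e0 - \<delta>))
       \<le> (2 * 2 powr (real n * r0)) * (2 * 2 powr (real n * r1)) / 2 powr (real n * (e0 - \<delta>))"
      by (intro divide_right_mono) auto
    also have "\<dots> = 4 * 2 powr (real n * (r0 + r1 - (e0 - \<delta>)))"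
      by (simp add: right_diff_distrib distrib_left powr_diff powr_add)
    finally show "real (codebook_size r0 n) * real (codebook_size r1 n) / 2 powr (real n * (e0 - \<delta>)) \<le> 4 * 2 powr (real n * (r0 + r1 - (e0 - \<delta>)))" .
  qed (use e in auto)
  moreover have "(\<lambda>n. real (codebook_size r1 n - 1) / 2 powr (real n * (e1 - \<delta>))) \<longlonglongrightarrow> 0"
  proof (cases "r1 = 0")
    case True
    then show ?thesis by (simp add: codebook_size_def)
  next
    case False
    show ?thesis
    proof (rule tendsto_0_if_le_powr[of _ 1 "r1 - (e1 - \<delta>)"])
      fix n
      have "real (codebook_size r1 n - 1) / 2 powr (real n * (e1 - \<delta>)) \<le> 2 powr (real n * r1) / 2 powr (real n * (e1 - \<delta>))"
        using codebook_size_bounds(4)[OF r(2), of n] False by (intro divide_right_mono) auto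
      then show "real (codebook_size r1 n - 1) / 2 powr (real n * (e1 - \<delta>)) \<le> 1 * 2 powr (real n * (r1 - (e1 - \<delta>)))"
        by (simp add: right_diff_distrib powr_diff)
    qed (use e False in auto)
  qed
  ultimately show ?thesis using tendsto_add by fastforce
qed

lemma exists_common_slack:
  assumes "finite A" "\<And>x. x \<in> A \<Longrightarrow> x > (0 :: real)"
  shows "\<exists>\<delta>>0. \<forall>x\<in>A. \<delta> < x"
proof (cases "A = {}")
  case False
  then have "Min A > 0" using assms by simp
  moreover have "Min A / 2 < x" if "x \<in> A" for x
    using Min_le[OF assms(1) that] \<open>Min A > 0\<close> by linarith
  ultimately show ?thesis by (intro exI[of _ "Min A / 2"]) simp
qed (intro exI[of _ 1], simp)

context simulation_setup begin

text \<open>The codewords of all \<omega> together cover the target, so \<open>R\<close> is added to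
  the cloud rate there; the encoder is normalised for each single \<omega>, hence without
  \<open>R\<close>.\<close>

lemma admissible_if_rates:
  assumes r: "0 \<le> r0" "0 \<le> r1" "0 \<le> r2"
    and eX: "eX0 = ent S W + ent S X - ent S (W \<bowtie> X)"
      "eX1 = ent S (W \<bowtie> U) + ent S X - ent S (W \<bowtie> U \<bowtie> X)"
      "eX2 = ent S (W \<bowtie> V) + ent S X - ent S (W \<bowtie> V \<bowtie> X)"
      "eX3 = ent S (W \<bowtie> U) + ent S (W \<bowtie> V) + ent S X - ent S W - ent S (W \<bowtie> U \<bowtie> V \<bowtie> X)"
    and eT: "eT0 = ent S W + ent S (X \<bowtie> Y \<bowtie> Z) - ent S (W \<bowtie> X \<bowtie> Y \<bowtie> Z)"
      "eT1 = ent S (W \<bowtie> U) + ent S (X \<bowtie> Y \<bowtie> Z) - ent S (W \<bowtie> U \<bowtie> X \<bowtie> Y \<bowtie> Z)"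
      "eT2 = ent S (W \<bowtie> V) + ent S (X \<bowtie> Y \<bowtie> Z) - ent S (W \<bowtie> V \<bowtie> X \<bowtie> Y \<bowtie> Z)"
      "eT3 = ent S (W \<bowtie> U) + ent S (W \<bowtie> V) + ent S (X \<bowtie> Y \<bowtie> Z) - ent S W - ent S (W \<bowtie> U \<bowtie> V \<bowtie> X \<bowtie> Y \<bowtie> Z)"
    and eY: "c01 = ent S (W \<bowtie> U) + ent S Yt - ent S (W \<bowtie> U \<bowtie> Yt)"
      "c1 = ent S (W \<bowtie> U) + ent S (W \<bowtie> Yt) - ent S W - ent S (W \<bowtie> U \<bowtie> Yt)"
    and eZ: "c02 = ent S (W \<bowtie> V) + ent S Zt - ent S (W \<bowtie> V \<bowtie> Zt)"
      "c2 = ent S (W \<bowtie> V) + ent S (W \<bowtie> Zt) - ent S W - ent S (W \<bowtie> V \<bowtie> Zt)"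
    and X: "eX0 < r0" "eX1 < r0 + r1" "eX2 < r0 + r2" "eX3 < r0 + r1 + r2"
    and T: "eT0 < R + r0" "eT1 < R + r0 + r1" "eT2 < R + r0 + r2" "eT3 < R + r0 + r1 + r2"
    and Y: "r0 + r1 < c01" "r1 < c1 \<or> r1 = 0" and Z: "r0 + r2 < c02" "r2 < c2 \<or> r2 = 0"
  shows "in_admissible_region p T K R"
proof -
  \<comment> \<open>One \<delta> is to lie below all gaps. For a satellite rate 0 the gap to
    \<open>c1\<close> or \<open>c2\<close> may be zero or negative and is replaced by the harmless
    value 1.\<close>
  let ?A = "{r0 - eX0, r0 + r1 - eX1, r0 + r2 - eX2, r0 + r1 + r2 - eX3,
     R + r0 - eT0, R + r0 + r1 - eT1, R + r0 + r2 - eT2, R + r0 + r1 + r2 - eT3,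
     c01 - (r0 + r1), c02 - (r0 + r2), if r1 = 0 then 1 else c1 - r1, if r2 = 0 then 1 else c2 - r2}"
  obtain \<delta> where \<delta>: "\<delta> > 0" and slack: "\<forall>x\<in>?A. \<delta> < x"
    using exists_common_slack[of ?A] X T Y Z by fastforce
  define pX where "pX n = measure_pmf.prob (JXn n) {(w, u, v, t). \<not> covering_typical (2 powr (real n * (eX0 + \<delta>)))
      (2 powr (real n * (eX1 + \<delta>))) (2 powr (real n * (eX2 + \<delta>))) (2 powr (real n * (eX3 + \<delta>))) (JXn n) w u v t}" for n
  define pT where "pT n = measure_pmf.prob (JTn n) {(w, u, v, t). \<not> covering_typical (2 powr (real n * (eT0 + \<delta>)))
      (2 powr (real n * (eT1 + \<delta>))) (2 powr (real n * (eT2 + \<delta>))) (2 powr (real n * (eT3 + \<delta>))) (JTn n) w u v t}" for n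
  define pY where "pY n = measure_pmf.prob (JYn n) {(w, u, t). \<not> decodable (2 powr (real n * (c01 - \<delta>)))
      (2 powr (real n * (c1 - \<delta>))) (JYn n) w u t}" for n
  define pZ where "pZ n = measure_pmf.prob (JZn n) {(w, u, t). \<not> decodable (2 powr (real n * (c02 - \<delta>)))
      (2 powr (real n * (c2 - \<delta>))) (JZn n) w u t}" for n
  define sX where "sX n = sqrt ((2 powr (real n * (eX0 + \<delta>)) + 2 powr (real n * (eX1 + \<delta>)) / real (codebook_size r1 n)
     + 2 powr (real n * (eX2 + \<delta>)) / real (codebook_size r2 n)
     + 2 powr (real n * (eX3 + \<delta>)) / (real (codebook_size r1 n) * real (codebook_size r2 n))) / real (codebook_size r0 n))" for n
  define sT where "sT n = sqrt ((2 powr (real n * (eT0 + \<delta>)) + 2 powr (real n * (eT1 + \<delta>)) / real (codebook_size r1 n)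
     + 2 powr (real n * (eT2 + \<delta>)) / real (codebook_size r2 n)
     + 2 powr (real n * (eT3 + \<delta>)) / (real (codebook_size r1 n) * real (codebook_size r2 n))) / real (card (messages n R) * codebook_size r0 n))" for n
  define qY where "qY n = real (codebook_size r0 n) * real (codebook_size r1 n) / 2 powr (real n * (c01 - \<delta>))
     + real (codebook_size r1 n - 1) / 2 powr (real n * (c1 - \<delta>))" for n
  define qZ where "qZ n = real (codebook_size r0 n) * real (codebook_size r2 n) / 2 powr (real n * (c02 - \<delta>))
     + real (codebook_size r2 n - 1) / 2 powr (real n * (c2 - \<delta>))" for n
  define B where "B n = (2 * pX n + sX n) + (2 * pT n + sT n) + 2 * ((pY n + qY n) + (pZ n + qZ n))" for n
  have "\<exists>enc dec1 dec2. is_code n R enc dec1 dec2 \<and>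
    2 * tv_dist (induced_marginal n R p K enc dec1 dec2) (iid_triple n (source_target p T)) \<le> B n" for n
    unfolding B_def pX_def pT_def pY_def pZ_def sX_def sT_def qY_def qZ_def add.assoc[symmetric, of "measure_pmf.prob _ _"]
    by (rule n_letter_simulation) (use codebook_size_bounds(1) r in auto)
  then obtain enc dec1 dec2 where code: "\<And>n. is_code n R (enc n) (dec1 n) (dec2 n)"
    and tv: "\<And>n. 2 * tv_dist (induced_marginal n R p K (enc n) (dec1 n) (dec2 n)) (iid_triple n (source_target p T)) \<le> B n"
    by metis
  have "pX \<longlonglongrightarrow> 0"
    unfolding pX_def
    by (rule covering_typical_tendsto[where \<tau> = "\<lambda>n. seq_map n X" and \<theta> = X and W = W and U = U and V = V and S = S])
       (auto simp: seq_map_eq_iff JXn_def eX \<delta>)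
  moreover have "pT \<longlonglongrightarrow> 0"
    unfolding pT_def
    by (rule covering_typical_tendsto[where \<tau> = "\<lambda>n s. (seq_map n X s, seq_map n Y s, seq_map n Z s)" and \<theta> = "X \<bowtie> Y \<bowtie> Z" and W = W and U = U and V = V and S = S])
       (auto simp: seq_map_eq_iff JTn_def eT \<delta>)
  moreover have "pY \<longlonglongrightarrow> 0"
    unfolding pY_def by (rule decodable_tendsto[where \<theta> = Yt and W = W and U = U and S = S]) (auto simp: JYn_def eY \<delta>)
  moreover have "pZ \<longlonglongrightarrow> 0"
    unfolding pZ_def by (rule decodable_tendsto[where \<theta> = Zt and W = W and U = V and S = S]) (auto simp: JZn_def eZ \<delta>)
  moreover have "sX \<longlonglongrightarrow> 0"
    unfolding sX_def by (rule covering_rate_tendsto[where c = 1 and \<rho> = r0]) (use slack r codebook_size_bounds(2)[OF r(1)] in auto)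
  moreover have "sT \<longlonglongrightarrow> 0"
    unfolding sT_def
  proof (rule covering_rate_tendsto[where c = "1 / 2" and \<rho> = "R + r0"])
    fix n
    have "2 powr (real n * R) / 2 * 2 powr (real n * r0) \<le> real (card (messages n R)) * real (codebook_size r0 n)"
      using messages(3)[of n] codebook_size_bounds(2)[OF r(1), of n] by (intro mult_mono) auto
    then show "1 / 2 * 2 powr (real n * (R + r0)) \<le> real (card (messages n R) * codebook_size r0 n)"
      by (simp add: distrib_left powr_add)
  qed (use slack r in auto)
  moreover have "qY \<longlonglongrightarrow> 0"
    unfolding qY_def by (rule packing_rate_tendsto) (use slack r in \<open>auto split: if_splits\<close>)
  moreover have "qZ \<longlonglongrightarrow> 0"
    unfolding qZ_def by (rule packing_rate_tendsto) (use slack r in \<open>auto split: if_splits\<close>)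
  ultimately have "B \<longlonglongrightarrow> (2 * 0 + 0) + (2 * 0 + 0) + 2 * ((0 + 0) + (0 + 0))"
    unfolding B_def by (intro tendsto_intros)
  then have lim: "(\<lambda>n. B n / 2) \<longlonglongrightarrow> 0" using tendsto_divide[of B 0 sequentially "\<lambda>_. 2" 2] by simp
  have "(\<lambda>n. tv_dist (induced_marginal n R p K (enc n) (dec1 n) (dec2 n)) (iid_triple n (source_target p T))) \<longlonglongrightarrow> 0"
  proof (rule tendsto_sandwich[OF _ _ tendsto_const lim])
    show "\<forall>\<^sub>F n in sequentially. 0 \<le> tv_dist (induced_marginal n R p K (enc n) (dec1 n) (dec2 n)) (iid_triple n (source_target p T))"
      by (simp add: tv_dist_def infsum_nonneg)
    show "\<forall>\<^sub>F n in sequentially. tv_dist (induced_marginal n R p K (enc n) (dec1 n) (dec2 n)) (iid_triple n (source_target p T)) \<le> B n / 2"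
      using tv by (intro always_eventually allI) (simp add: field_simps)
  qed
  then show ?thesis unfolding in_admissible_region_def using code by blast
qed

end

theorem theorem9:
  fixes p :: "'x::finite pmf"
    and T :: "'x \<Rightarrow> ('y::finite \<times> 'z::finite) pmf"
    and K :: "'xt::finite \<Rightarrow> ('yt::finite \<times> 'zt::finite) pmf"
    and R :: real
    and A :: "'x \<Rightarrow> ('u::finite \<times> 'v::finite \<times> 'w::finite \<times> 'xt) pmf"
    and D1 :: "'yt \<Rightarrow> 'u \<Rightarrow> 'w \<Rightarrow> 'y pmf"
    and D2 :: "'zt \<Rightarrow> 'v \<Rightarrow> 'w \<Rightarrow> 'z pmf"
    and S :: "'s pmf"
    and X :: "'s \<Rightarrow> 'x" and U :: "'s \<Rightarrow> 'u" and V :: "'s \<Rightarrow> 'v" and W :: "'s \<Rightarrow> 'w"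
    and Xt :: "'s \<Rightarrow> 'xt" and Yt :: "'s \<Rightarrow> 'yt" and Zt :: "'s \<Rightarrow> 'zt"
    and Y :: "'s \<Rightarrow> 'y" and Z :: "'s \<Rightarrow> 'z"
  assumes "R \<ge> 0"
    and "map_pmf (X \<bowtie> U \<bowtie> V \<bowtie> W \<bowtie> Xt \<bowtie> Yt \<bowtie> Zt \<bowtie> Y \<bowtie> Z) S = auxiliary_joint p A K D1 D2"
    and "map_pmf (X \<bowtie> Y \<bowtie> Z) S = source_target p T"
    and "\<I>\<^bsub>S\<^esub>(W \<bowtie> U ; Yt) > \<I>\<^bsub>S\<^esub>(U \<bowtie> W ; X)"
    and "R + \<I>\<^bsub>S\<^esub>(W \<bowtie> U ; Yt) > \<I>\<^bsub>S\<^esub>(U \<bowtie> W ; X \<bowtie> Y \<bowtie> Z)"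
    and "\<I>\<^bsub>S\<^esub>(W \<bowtie> V ; Zt) > \<I>\<^bsub>S\<^esub>(W \<bowtie> V ; X)"
    and "R + \<I>\<^bsub>S\<^esub>(W \<bowtie> V ; Zt) > \<I>\<^bsub>S\<^esub>(W \<bowtie> V ; X \<bowtie> Y \<bowtie> Z)"
    and "\<I>\<^bsub>S\<^esub>(W \<bowtie> U ; Yt) + \<I>\<^bsub>S\<^esub>(W \<bowtie> V ; Zt)
           > \<I>\<^bsub>S\<^esub>(U \<bowtie> W ; X) + \<I>\<^bsub>S\<^esub>(W \<bowtie> V ; X) + \<I>\<^bsub>S\<^esub>(U ; V \<bar> W \<bowtie> X)"
    and "2 * R + \<I>\<^bsub>S\<^esub>(U \<bowtie> W ; Yt) + \<I>\<^bsub>S\<^esub>(V \<bowtie> W ; Zt)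
           > \<I>\<^bsub>S\<^esub>(U \<bowtie> W ; X \<bowtie> Y \<bowtie> Z) + \<I>\<^bsub>S\<^esub>(V \<bowtie> W ; X \<bowtie> Y \<bowtie> Z)
             + \<I>\<^bsub>S\<^esub>(U ; V \<bar> W \<bowtie> X \<bowtie> Y \<bowtie> Z)"
    and "min (\<I>\<^bsub>S\<^esub>(W ; Yt)) (\<I>\<^bsub>S\<^esub>(W ; Zt)) + \<I>\<^bsub>S\<^esub>(U ; Yt \<bar> W) + \<I>\<^bsub>S\<^esub>(V ; Zt \<bar> W)
           > \<I>\<^bsub>S\<^esub>(W ; X) + \<I>\<^bsub>S\<^esub>(U ; X \<bar> W) + \<I>\<^bsub>S\<^esub>(V ; X \<bar> W) + \<I>\<^bsub>S\<^esub>(U ; V \<bar> W \<bowtie> X)"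
    and "R + min (\<I>\<^bsub>S\<^esub>(W ; Yt)) (\<I>\<^bsub>S\<^esub>(W ; Zt)) + \<I>\<^bsub>S\<^esub>(U ; Yt \<bar> W) + \<I>\<^bsub>S\<^esub>(V ; Zt \<bar> W)
           > \<I>\<^bsub>S\<^esub>(W ; X \<bowtie> Y \<bowtie> Z) + \<I>\<^bsub>S\<^esub>(U ; X \<bowtie> Y \<bowtie> Z \<bar> W) + \<I>\<^bsub>S\<^esub>(V ; X \<bowtie> Y \<bowtie> Z \<bar> W)
             + \<I>\<^bsub>S\<^esub>(U ; V \<bar> W \<bowtie> X \<bowtie> Y \<bowtie> Z)"
    and "R + \<I>\<^bsub>S\<^esub>(W ; Y \<bowtie> Z \<bar> X) + \<I>\<^bsub>S\<^esub>(U \<bowtie> W ; Yt) + \<I>\<^bsub>S\<^esub>(V \<bowtie> W ; Zt)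
           > \<I>\<^bsub>S\<^esub>(U \<bowtie> W ; X \<bowtie> Y \<bowtie> Z) + \<I>\<^bsub>S\<^esub>(V \<bowtie> W ; X \<bowtie> Y \<bowtie> Z)
             + \<I>\<^bsub>S\<^esub>(U ; V \<bar> W \<bowtie> X \<bowtie> Y \<bowtie> Z)"
  shows "in_admissible_region p T K R"
proof -
  interpret simulation_setup p T K R A D1 D2 S X U V W Xt Yt Zt Y Z
    using assms(1-3) by unfold_locales
  define eX0 where "eX0 = ent S W + ent S X - ent S (W \<bowtie> X)"
  define eX1 where "eX1 = ent S (W \<bowtie> U) + ent S X - ent S (W \<bowtie> U \<bowtie> X)"
  define eX2 where "eX2 = ent S (W \<bowtie> V) + ent S X - ent S (W \<bowtie> V \<bowtie> X)"
  define eX3 where "eX3 = ent S (W \<bowtie> U) + ent S (W \<bowtie> V) + ent S X - ent S W - ent S (W \<bowtie> U \<bowtie> V \<bowtie> X)"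
  define eT0 where "eT0 = ent S W + ent S (X \<bowtie> Y \<bowtie> Z) - ent S (W \<bowtie> X \<bowtie> Y \<bowtie> Z)"
  define eT1 where "eT1 = ent S (W \<bowtie> U) + ent S (X \<bowtie> Y \<bowtie> Z) - ent S (W \<bowtie> U \<bowtie> X \<bowtie> Y \<bowtie> Z)"
  define eT2 where "eT2 = ent S (W \<bowtie> V) + ent S (X \<bowtie> Y \<bowtie> Z) - ent S (W \<bowtie> V \<bowtie> X \<bowtie> Y \<bowtie> Z)"
  define eT3 where "eT3 = ent S (W \<bowtie> U) + ent S (W \<bowtie> V) + ent S (X \<bowtie> Y \<bowtie> Z) - ent S W - ent S (W \<bowtie> U \<bowtie> V \<bowtie> X \<bowtie> Y \<bowtie> Z)"
  define c01 where "c01 = ent S (W \<bowtie> U) + ent S Yt - ent S (W \<bowtie> U \<bowtie> Yt)"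
  define c1 where "c1 = ent S (W \<bowtie> U) + ent S (W \<bowtie> Yt) - ent S W - ent S (W \<bowtie> U \<bowtie> Yt)"
  define c02 where "c02 = ent S (W \<bowtie> V) + ent S Zt - ent S (W \<bowtie> V \<bowtie> Zt)"
  define c2 where "c2 = ent S (W \<bowtie> V) + ent S (W \<bowtie> Zt) - ent S W - ent S (W \<bowtie> V \<bowtie> Zt)"
  note defs = eX0_def eX1_def eX2_def eX3_def eT0_def eT1_def eT2_def eT3_def c01_def c1_def c02_def c2_def
  \<comment> \<open>Every entropy is brought to one fixed order of its variables, so that the
    informations become linear forms in common atoms and \<open>linarith\<close> can compare
    them.\<close>
  have canon:
    "ent S (U \<bowtie> W) = ent S (W \<bowtie> U)" "ent S (V \<bowtie> W) = ent S (W \<bowtie> V)"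
    "ent S ((W \<bowtie> U) \<bowtie> Yt) = ent S (W \<bowtie> U \<bowtie> Yt)" "ent S ((U \<bowtie> W) \<bowtie> Yt) = ent S (W \<bowtie> U \<bowtie> Yt)"
    "ent S (U \<bowtie> Yt \<bowtie> W) = ent S (W \<bowtie> U \<bowtie> Yt)" "ent S (Yt \<bowtie> W) = ent S (W \<bowtie> Yt)"
    "ent S ((W \<bowtie> V) \<bowtie> Zt) = ent S (W \<bowtie> V \<bowtie> Zt)" "ent S ((V \<bowtie> W) \<bowtie> Zt) = ent S (W \<bowtie> V \<bowtie> Zt)"
    "ent S (V \<bowtie> Zt \<bowtie> W) = ent S (W \<bowtie> V \<bowtie> Zt)" "ent S (Zt \<bowtie> W) = ent S (W \<bowtie> Zt)"
    "ent S ((U \<bowtie> W) \<bowtie> X) = ent S (W \<bowtie> U \<bowtie> X)" "ent S (U \<bowtie> W \<bowtie> X) = ent S (W \<bowtie> U \<bowtie> X)"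
    "ent S (U \<bowtie> X \<bowtie> W) = ent S (W \<bowtie> U \<bowtie> X)" "ent S (X \<bowtie> W) = ent S (W \<bowtie> X)"
    "ent S ((W \<bowtie> V) \<bowtie> X) = ent S (W \<bowtie> V \<bowtie> X)" "ent S (V \<bowtie> W \<bowtie> X) = ent S (W \<bowtie> V \<bowtie> X)"
    "ent S (V \<bowtie> X \<bowtie> W) = ent S (W \<bowtie> V \<bowtie> X)"
    "ent S (U \<bowtie> V \<bowtie> W \<bowtie> X) = ent S (W \<bowtie> U \<bowtie> V \<bowtie> X)" "ent S ((U \<bowtie> V) \<bowtie> W \<bowtie> X) = ent S (W \<bowtie> U \<bowtie> V \<bowtie> X)"
    "ent S ((U \<bowtie> W) \<bowtie> X \<bowtie> Y \<bowtie> Z) = ent S (W \<bowtie> U \<bowtie> X \<bowtie> Y \<bowtie> Z)"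
    "ent S (U \<bowtie> W \<bowtie> X \<bowtie> Y \<bowtie> Z) = ent S (W \<bowtie> U \<bowtie> X \<bowtie> Y \<bowtie> Z)"
    "ent S (U \<bowtie> (X \<bowtie> Y \<bowtie> Z) \<bowtie> W) = ent S (W \<bowtie> U \<bowtie> X \<bowtie> Y \<bowtie> Z)"
    "ent S ((W \<bowtie> V) \<bowtie> X \<bowtie> Y \<bowtie> Z) = ent S (W \<bowtie> V \<bowtie> X \<bowtie> Y \<bowtie> Z)"
    "ent S ((V \<bowtie> W) \<bowtie> X \<bowtie> Y \<bowtie> Z) = ent S (W \<bowtie> V \<bowtie> X \<bowtie> Y \<bowtie> Z)"
    "ent S (V \<bowtie> W \<bowtie> X \<bowtie> Y \<bowtie> Z) = ent S (W \<bowtie> V \<bowtie> X \<bowtie> Y \<bowtie> Z)"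
    "ent S (V \<bowtie> (X \<bowtie> Y \<bowtie> Z) \<bowtie> W) = ent S (W \<bowtie> V \<bowtie> X \<bowtie> Y \<bowtie> Z)"
    "ent S ((X \<bowtie> Y \<bowtie> Z) \<bowtie> W) = ent S (W \<bowtie> X \<bowtie> Y \<bowtie> Z)"
    "ent S (U \<bowtie> V \<bowtie> W \<bowtie> X \<bowtie> Y \<bowtie> Z) = ent S (W \<bowtie> U \<bowtie> V \<bowtie> X \<bowtie> Y \<bowtie> Z)"
    "ent S ((Y \<bowtie> Z) \<bowtie> X) = ent S (X \<bowtie> Y \<bowtie> Z)" "ent S (W \<bowtie> (Y \<bowtie> Z) \<bowtie> X) = ent S (W \<bowtie> X \<bowtie> Y \<bowtie> Z)"
    "ent S ((Y \<bowtie> Z) \<bowtie> W \<bowtie> X) = ent S (W \<bowtie> X \<bowtie> Y \<bowtie> Z)"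
    "ent S ((U \<bowtie> V) \<bowtie> (Y \<bowtie> Z) \<bowtie> W \<bowtie> X) = ent S (W \<bowtie> U \<bowtie> V \<bowtie> X \<bowtie> Y \<bowtie> Z)"
    by (rule ent_cong, auto)+
  note expand = mutual_info_eq_ent cond_mutual_info_eq_ent canon
  have single: "eX1 < c01" "eT1 < R + c01" "eX2 < c02" "eT2 < R + c02"
    using assms(4-7) unfolding expand defs by linarith+
  \<comment> \<open>By the chain rule, I(U W; \<theta>) + I(V W; \<theta>) + I(U; V | W \<theta>) is
    the sum of the first and the last covering exponent at \<theta>. The term I(W; Y Z | X) in the
    last hypothesis is \<open>eT0 - eX0\<close>, which turns that hypothesis into the third
    inequality.\<close>
  have pair: "eX0 + eX3 < c01 + c02" "eT0 + eT3 < 2 * R + c01 + c02" "eX0 + eT3 < R + c01 + c02"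
    using assms(8,9,12) unfolding expand defs by linarith+
  \<comment> \<open>Each minimum yields two inequalities, since \<open>c01\<close> is I(W; Yt) +
    I(U; Yt | W) and likewise for \<open>c02\<close>.\<close>
  have mixed: "eX3 < c01 + c2" "eX3 < c02 + c1" "eT3 < R + c01 + c2" "eT3 < R + c02 + c1"
    using assms(10,11) unfolding expand defs by (simp_all add: min_def split: if_splits)
  \<comment> \<open>The difference of the two sides is I(U V; Y Z | W X). It supplies the missing
    cross term \<open>eT0 + eX3\<close> from the bound on \<open>eX0 + eT3\<close>.\<close>
  have gap: "eT0 + eX3 \<le> eX0 + eT3"
    using cond_mutual_info_nonneg[of S "U \<bowtie> V" "Y \<bowtie> Z" "W \<bowtie> X"] unfolding expand defs by linarith
  have shannon: "0 \<le> eX0" "eX0 \<le> eX1" "eX0 \<le> eX2" "eX1 \<le> eX3" "eX2 \<le> eX3"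
      "eT0 \<le> eT1" "eT0 \<le> eT2" "eT1 \<le> eT3" "eT2 \<le> eT3" "0 \<le> c1" "0 \<le> c2" "c1 \<le> c01" "c2 \<le> c02"
    using mutual_info_nonneg[of S W X] cond_mutual_info_nonneg[of S U X W] cond_mutual_info_nonneg[of S V X W]
      cond_mutual_info_nonneg[of S U V "W \<bowtie> X"] cond_mutual_info_nonneg[of S U "X \<bowtie> Y \<bowtie> Z" W]
      cond_mutual_info_nonneg[of S V "X \<bowtie> Y \<bowtie> Z" W] cond_mutual_info_nonneg[of S U V "W \<bowtie> X \<bowtie> Y \<bowtie> Z"]
      cond_mutual_info_nonneg[of S U Yt W] cond_mutual_info_nonneg[of S V Zt W]
      mutual_info_nonneg[of S W Yt] mutual_info_nonneg[of S W Zt]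
    unfolding expand defs by linarith+
  \<comment> \<open>Covering for each \<omega> and covering of the target bound the same rates from
    below, so the larger bound is taken; the sum condition of \<open>rates_exist\<close> then splits
    into the four combinations of source and target exponents.\<close>
  have "\<exists>r0 r1 r2. 0 \<le> r1 \<and> 0 \<le> r2 \<and> max eX0 (eT0 - R) < r0 \<and> max eX1 (eT1 - R) < r0 + r1
      \<and> max eX2 (eT2 - R) < r0 + r2 \<and> max eX3 (eT3 - R) < r0 + r1 + r2
      \<and> (r1 < c1 \<or> r1 = 0) \<and> r0 + r1 < c01 \<and> (r2 < c2 \<or> r2 = 0) \<and> r0 + r2 < c02"
    by (rule rates_exist) (use single pair mixed gap shannon in \<open>auto simp: max_def\<close>)
  then obtain r0 r1 r2 where "0 \<le> r1" "0 \<le> r2" "max eX0 (eT0 - R) < r0" "max eX1 (eT1 - R) < r0 + r1"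
    "max eX2 (eT2 - R) < r0 + r2" "max eX3 (eT3 - R) < r0 + r1 + r2"
    "r1 < c1 \<or> r1 = 0" "r0 + r1 < c01" "r2 < c2 \<or> r2 = 0" "r0 + r2 < c02" by blast
  then show ?thesis
    using shannon(1)
    by (intro admissible_if_rates[of r0 r1 r2, OF _ _ _ eX0_def eX1_def eX2_def eX3_def eT0_def eT1_def eT2_def eT3_def c01_def c1_def c02_def c2_def])
       auto
qed

end
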